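(* Let $X$ be a simplicial complex and let $Y\subseteq X$ be a subcomplex. Assume the following conditions hold: (1) The space $X\setminus Y$ is dense in $X$. (2) For each point $y\in Y$ and each open neighborhood $U\subseteq X$ containing $y$, there exists an open neighborhood $V\subseteq U$ with $y\in V$ such that $V\setminus Y$ is path connected. (3) For each point $y\in Y$, there exists a path connected open neighborhood $V$ of $y$ such that $\pi_2(V)=0$ and the natural map $\pi_1(V\setminus Y,v)\to\pi_1(V,v)$ is injective for each $v\in V\setminus Y$. Let $S$ be a compact manifold of dimension at most $2$ with (possibly empty) boundary, and let $S'\subset S$ be a closed subset containing $\partial S$ such that $S$ admits a triangulation with $S'$ as a subcomplex. Then for every continuous map $f\colon (S,S')\to (X,X\setminus Y)$ such that $f$ is simplicial on $S'$, there exists a map $h\colon S\to X$ such that $h$ is homotopic to $f$ (rel $S'$) and $h(S)\cap Y=\emptyset$.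
   Context: A simplicial complex here means a topological space equipped with a triangulation (covering by simplices with characteristic homeomorphisms from standard simplices, satisfying the usual axioms, with the weak topology: a set is open iff its intersection with every simplex is open in that simplex). A subcomplex is a union of simplices with the induced triangulation. A map of simplicial complexes is simplicial if it carries each simplex linearly onto a simplex. "$f$ is simplicial on $S'$" means that $f|_{S'}$ is simplicial with respect to the triangulation of $S'$ (as a subcomplex of the triangulated $S$) and the given triangulation of $X$. $f\colon(S,S')\to(X,X\setminus Y)$ means $f(S')\subseteq X\setminus Y$. *)

theory Defs
  imports "HOL-Analysis.Analysis" "HOL-Homology.Simplices" "HOL-Algebra.Group"
begin

section \<open>Triangulations\<close>

text \<open>
  The data of a triangulation of a space with underlying type \<open>'a\<close>: a collection of simplices
  (as subsets), each with a dimension and a characteristic map from the standard simplex of that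
  dimension. Nothing is assumed about the number of simplices, their dimensions, or local
  finiteness.
\<close>

record 'a triangulation =
  simplices :: "'a set set"
  simplex_dim :: "'a set \<Rightarrow> nat"
  char_map :: "'a set \<Rightarrow> (nat \<Rightarrow> real) \<Rightarrow> 'a"

text \<open>The face of \<open>\<sigma>\<close> with vertex set \<open>J\<close>, in terms of barycentric coordinates.\<close>

definition face :: "'a triangulation \<Rightarrow> 'a set \<Rightarrow> nat set \<Rightarrow> 'a set" where
  "face K \<sigma> J =
     char_map K \<sigma> ` {x \<in> standard_simplex (simplex_dim K \<sigma>). \<forall>i. i \<notin> J \<longrightarrow> x i = 0}"

definition faces :: "'a triangulation \<Rightarrow> 'a set \<Rightarrow> 'a set set" where
  "faces K \<sigma> = {face K \<sigma> J | J. J \<subseteq> {..simplex_dim K \<sigma>} \<and> J \<noteq> {}}"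

text \<open>
  A function is linear from \<open>\<sigma>\<close> to \<open>\<tau>\<close> if, in the coordinates given by the characteristic maps, it
  is a map of the standard simplices preserving convex combinations; such maps are the
  \<^const>\<open>simplicial_simplex\<close> maps of the homology library.
\<close>

definition linear_between ::
  "'b triangulation \<Rightarrow> 'b set \<Rightarrow> 'a triangulation \<Rightarrow> 'a set \<Rightarrow> ('b \<Rightarrow> 'a) \<Rightarrow> bool" where
  "linear_between L \<sigma> K \<tau> f \<longleftrightarrow>
     (\<exists>a. simplicial_simplex (simplex_dim L \<sigma>) (standard_simplex (simplex_dim K \<tau>)) a \<and>
          (\<forall>x \<in> standard_simplex (simplex_dim L \<sigma>).
             f (char_map L \<sigma> x) = char_map K \<tau> (a x)))"

text \<open>
  The conjuncts say: the simplices cover the space; the characteristic maps are homeomorphisms; a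
  face of a simplex is a simplex; two simplices that meet do so in a common face; the
  characteristic maps of a simplex and of its faces are linearly compatible; the space has the weak
  topology.
\<close>

definition triangulates :: "'a triangulation \<Rightarrow> 'a topology \<Rightarrow> bool" where
  "triangulates K X \<longleftrightarrow>
     \<Union>(simplices K) = topspace X \<and>
     (\<forall>\<sigma> \<in> simplices K.
        homeomorphic_map
          (subtopology (powertop_real UNIV) (standard_simplex (simplex_dim K \<sigma>)))
          (subtopology X \<sigma>) (char_map K \<sigma>)) \<and>
     (\<forall>\<sigma> \<in> simplices K. faces K \<sigma> \<subseteq> simplices K) \<and>
     (\<forall>\<sigma> \<in> simplices K. \<forall>\<tau> \<in> simplices K.
        \<sigma> \<inter> \<tau> \<noteq> {} \<longrightarrow> \<sigma> \<inter> \<tau> \<in> faces K \<sigma> \<inter> faces K \<tau>) \<and>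
     (\<forall>\<sigma> \<in> simplices K. \<forall>\<tau> \<in> faces K \<sigma>. linear_between K \<tau> K \<sigma> id) \<and>
     (\<forall>U. U \<subseteq> topspace X \<longrightarrow>
        (openin X U \<longleftrightarrow> (\<forall>\<sigma> \<in> simplices K. openin (subtopology X \<sigma>) (U \<inter> \<sigma>))))"

definition subcomplex :: "'a triangulation \<Rightarrow> 'a set \<Rightarrow> bool" where
  "subcomplex K Y \<longleftrightarrow> (\<exists>C \<subseteq> simplices K. Y = \<Union>C)"

definition induced_triangulation :: "'a triangulation \<Rightarrow> 'a set \<Rightarrow> 'a triangulation" where
  "induced_triangulation K Y = K\<lparr>simplices := {\<sigma> \<in> simplices K. \<sigma> \<subseteq> Y}\<rparr>"

definition simplicial_map ::
  "'b triangulation \<Rightarrow> 'a triangulation \<Rightarrow> ('b \<Rightarrow> 'a) \<Rightarrow> bool" where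
  "simplicial_map L K f \<longleftrightarrow>
     (\<forall>\<sigma> \<in> simplices L. \<exists>\<tau> \<in> simplices K. f ` \<sigma> = \<tau> \<and> linear_between L \<sigma> K \<tau> f)"

section \<open>Homotopy groups\<close>

text \<open>
  \<open>cbox 0 One\<close> is the unit cube of the Euclidean space \<open>'c\<close>, that is \<open>{0..1}\<close> for \<open>'c = real\<close> and the
  unit square for \<open>'c = real \<times> real\<close>. Values of the maps outside the cube are irrelevant: maps
  agreeing on the cube lie in the same class.
\<close>

definition based_cubes :: "'a topology \<Rightarrow> 'a \<Rightarrow> ('c::euclidean_space \<Rightarrow> 'a) set" where
  "based_cubes X x =
     {g. continuous_map (top_of_set (cbox 0 One)) X g \<and> (\<forall>t \<in> frontier (cbox 0 One). g t = x)}"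

definition cube_class ::
  "'a topology \<Rightarrow> 'a \<Rightarrow> ('c::euclidean_space \<Rightarrow> 'a) \<Rightarrow> ('c \<Rightarrow> 'a) set" where
  "cube_class X x g =
     {g'. homotopic_with (\<lambda>k. \<forall>t \<in> frontier (cbox 0 One). k t = x)
            (top_of_set (cbox 0 One)) X g g'}"

definition concat_path :: "(real \<Rightarrow> 'a) \<Rightarrow> (real \<Rightarrow> 'a) \<Rightarrow> real \<Rightarrow> 'a" where
  "concat_path g g' = (\<lambda>t. if t \<le> 1/2 then g (2 * t) else g' (2 * t - 1))"

definition pi1 :: "'a topology \<Rightarrow> 'a \<Rightarrow> (real \<Rightarrow> 'a) set monoid" where
  "pi1 X x =
     \<lparr>carrier = cube_class X x ` based_cubes X x,
      mult = (\<lambda>c d. \<Union>g \<in> c. \<Union>g' \<in> d. cube_class X x (concat_path g g')),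
      one = cube_class X x (\<lambda>_. x)\<rparr>"

text \<open>Squares are multiplied by concatenation in the first coordinate.\<close>

definition pi2 :: "'a topology \<Rightarrow> 'a \<Rightarrow> (real \<times> real \<Rightarrow> 'a) set monoid" where
  "pi2 X x =
     \<lparr>carrier = cube_class X x ` based_cubes X x,
      mult = (\<lambda>c d. \<Union>g \<in> c. \<Union>g' \<in> d.
                cube_class X x (\<lambda>(s, t). concat_path (\<lambda>r. g (r, t)) (\<lambda>r. g' (r, t)) s)),
      one = cube_class X x (\<lambda>_. x)\<rparr>"

text \<open>The map induced by \<open>f\<close> into the first homotopy group of \<open>X\<close> at \<open>f x\<close>.\<close>

definition pi1_map ::
  "'b \<Rightarrow> 'a topology \<Rightarrow> ('b \<Rightarrow> 'a) \<Rightarrow> (real \<Rightarrow> 'b) set \<Rightarrow> (real \<Rightarrow> 'a) set" where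
  "pi1_map x X f c = (\<Union>g \<in> c. cube_class X (f x) (f \<circ> g))"

section \<open>Manifolds with boundary\<close>

definition half_space :: "nat \<Rightarrow> (nat \<Rightarrow> real) topology" where
  "half_space n = subtopology (Euclidean_space n) {x. 0 \<le> x 0}"

definition locally_modelled_at :: "'m topology \<Rightarrow> 'a topology \<Rightarrow> 'a \<Rightarrow> bool" where
  "locally_modelled_at M S p \<longleftrightarrow>
     (\<exists>U W. openin S U \<and> p \<in> U \<and> openin M W \<and>
            subtopology S U homeomorphic_space subtopology M W)"

text \<open>
  For \<open>n = 0\<close> the half-space is a point, so a 0-manifold is a discrete space and has empty boundary.
\<close>

definition manifold_with_boundary :: "nat \<Rightarrow> 'a topology \<Rightarrow> bool" where
  "manifold_with_boundary n S \<longleftrightarrow>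
     Hausdorff_space S \<and> second_countable S \<and>
     (\<forall>p \<in> topspace S. locally_modelled_at (half_space n) S p)"

definition manifold_boundary :: "nat \<Rightarrow> 'a topology \<Rightarrow> 'a set" where
  "manifold_boundary n S =
     {p \<in> topspace S. \<not> locally_modelled_at (Euclidean_space n) S p}"

end

theory Submission
  imports Defs
begin

text \<open>
  The map \<open>f\<close> is pushed off \<open>Y\<close> one simplex of \<open>S\<close> at a time, each simplex after its faces, relative to
  \<open>S'\<close>. When the boundary of a simplex is already off \<open>Y\<close>, two things are needed: the motion of the
  boundary must extend over the simplex, which is the homotopy extension property, and the simplex must
  then be pushed off \<open>Y\<close> relative to its boundary. The lemma \<open>cleared_on_insert_cell\<close> combines both, and
  \<open>cleared_on_simplices\<close> runs the induction. Two facts about \<open>S\<close> make it work: compactness leaves only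
  finitely many simplices (\<open>finite_simplices_if_compact\<close>), and invariance of dimension bounds their
  dimension by 2 (\<open>simplex_dim_le_2\<close>).

  It remains to push a point, a path and a disk off \<open>Y\<close> relative to the boundary. This is a local
  matter: the interval and the square are subdivided finely, and the same induction over cells is
  applied to the subdivision, with each cell confined to a prescribed open set.

    \<^item> A point \<open>y\<close> of \<open>Y\<close> lies in a simplex that is not contained in \<open>Y\<close>, because the complement of \<open>Y\<close> is
      dense; the segment towards the barycenter of this simplex leaves \<open>Y\<close> at once
      (\<open>path_off_subcomplex\<close>).

    \<^item> A short path runs in a set \<open>V\<close> with \<open>V - Y\<close> path connected, and \<open>V\<close> lies in a set that contracts
      inside a given neighbourhood (\<open>locally_contractible\<close>). So the path can be replaced by one off \<open>Y\<close>,
      and the two are homotopic in the neighbourhood (\<open>clearable_interval_if_contractible\<close>). Hence paths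
      can be pushed off \<open>Y\<close> inside any given open set (\<open>clearable_interval\<close>).

    \<^item> A small disk lies in a set \<open>V\<close> with trivial second homotopy group such that \<open>V - Y\<close> injects on
      fundamental groups. Its boundary loop is null-homotopic in \<open>V\<close>, hence in \<open>V - Y\<close>, so it bounds
      another disk off \<open>Y\<close>, and the sphere formed by the two disks bounds a ball in \<open>V\<close>
      (\<open>clearable_disk\<close>). The confinement of vertices and edges during the earlier stages ensures that
      each small disk is still in its \<open>V\<close> when its boundary has been pushed off (\<open>clearable_square\<close>).
\<close>

section \<open>Extending a homotopy off a subset over one more cell\<close>

abbreviation cylinder :: "'m topology \<Rightarrow> (real \<times> 'm) topology" where
  "cylinder M \<equiv> prod_topology (top_of_set {0..1}) M"

text \<open>
  The homotopy extension property of the pair \<open>(M, B)\<close>, in its universal form: the cylinder on \<open>M\<close>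
  retracts onto its bottom together with the cylinder on \<open>B\<close>.
\<close>

definition cylinder_retracts :: "'m topology \<Rightarrow> 'm set \<Rightarrow> bool" where
  "cylinder_retracts M B \<longleftrightarrow>
     (\<exists>r. continuous_map (cylinder M) (cylinder M) r \<and>
          (\<forall>x \<in> topspace M. r (0, x) = (0, x)) \<and>
          (\<forall>t \<in> {0..1}. \<forall>x \<in> B. r (t, x) = (t, x)) \<and>
          (\<forall>t \<in> {0..1}. \<forall>x \<in> topspace M. fst (r (t, x)) = 0 \<or> snd (r (t, x)) \<in> B))"

abbreviation clearing ::
  "'m topology \<Rightarrow> 'm set \<Rightarrow> 'a topology \<Rightarrow> 'a set \<Rightarrow> 'a set \<Rightarrow> ('m \<Rightarrow> 'a) \<Rightarrow> (real \<times> 'm \<Rightarrow> 'a) \<Rightarrow> bool" where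
  "clearing M B X Y Q g G \<equiv>
     continuous_map (cylinder M) X G \<and>
     (\<forall>x \<in> topspace M. G (0, x) = g x \<and> G (1, x) \<notin> Y) \<and>
     (\<forall>t \<in> {0..1}. \<forall>x \<in> topspace M. G (t, x) \<in> Q) \<and>
     (\<forall>t \<in> {0..1}. \<forall>x \<in> B. G (t, x) = g x)"

text \<open>
  Every map from \<open>M\<close> into \<open>P\<close> that is off \<open>Y\<close> on \<open>B\<close> can be moved off \<open>Y\<close> by a homotopy in \<open>Q\<close> that
  is constant on \<open>B\<close>. The sets \<open>P \<subseteq> Q\<close> record how much room the motion needs: a path is short enough to
  be moved inside \<open>Q\<close> when it runs in a much smaller set \<open>P\<close>.
\<close>

definition clearable ::
  "'m topology \<Rightarrow> 'm set \<Rightarrow> 'a topology \<Rightarrow> 'a set \<Rightarrow> 'a set \<Rightarrow> 'a set \<Rightarrow> bool" where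
  "clearable M B X Y P Q \<longleftrightarrow>
     (\<forall>g. continuous_map M X g \<and> (\<forall>x \<in> topspace M. g x \<in> P) \<and> (\<forall>x \<in> B. g x \<notin> Y) \<longrightarrow>
        (\<exists>G. clearing M B X Y Q g G))"

text \<open>
  The set \<open>D x\<close> confines the motion of the point \<open>x\<close>; the value \<open>D x = {f x}\<close> says that the homotopy is
  constant at \<open>x\<close>, so that one function expresses both local control and relative homotopies.
\<close>

definition cleared_on ::
  "'m topology \<Rightarrow> 'a topology \<Rightarrow> 'a set \<Rightarrow> ('m \<Rightarrow> 'a) \<Rightarrow> ('m \<Rightarrow> 'a set) \<Rightarrow> 'm set \<Rightarrow> bool" where
  "cleared_on Z X Y f D A \<longleftrightarrow>
     (\<exists>H. continuous_map (cylinder (subtopology Z A)) X H \<and>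
          (\<forall>x \<in> A. H (0, x) = f x \<and> H (1, x) \<notin> Y) \<and>
          (\<forall>t \<in> {0..1}. \<forall>x \<in> A. H (t, x) \<in> D x))"

lemma continuous_map_glue_closed:
  assumes "closedin X A" "closedin X B" "topspace X \<subseteq> A \<union> B"
    and "continuous_map (subtopology X A) Y f" "continuous_map (subtopology X B) Y g"
    and "\<And>x. x \<in> A \<inter> B \<Longrightarrow> f x = g x"
  shows "continuous_map X Y (\<lambda>x. if x \<in> A then f x else g x)"
proof (rule pasting_lemma_closed[where I = UNIV and T = "\<lambda>b. if b then A else B"
      and f = "\<lambda>b. if b then f else g"])
  show "\<exists>j. j \<in> UNIV \<and> x \<in> (if j then A else B) \<and> (if x \<in> A then f x else g x) = (if j then f else g) x"
    if "x \<in> topspace X" for x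
  proof (cases "x \<in> A")
    case True then show ?thesis by (intro exI[of _ True]) auto
  next
    case False then show ?thesis using that assms(3) by (intro exI[of _ False]) auto
  qed
qed (use assms in \<open>auto split: if_splits\<close>)

lemma subtopology_cylinder:
  "subtopology (cylinder M) (T \<times> A) = prod_topology (top_of_set ({0..1} \<inter> T)) (subtopology M A)"
  by (simp add: subtopology_Times subtopology_subtopology)

lemma continuous_map_double_time:
  assumes "continuous_map (cylinder M) X H" "continuous_map (cylinder M) X G"
    and "\<And>x. x \<in> topspace M \<Longrightarrow> G (0, x) = H (1, x)"
  shows "continuous_map (cylinder M) X
           (\<lambda>(t, x). if t \<le> 1/2 then H (2 * t, x) else G (2 * t - 1, x))"
proof -
  have "continuous_map (cylinder M) X
      (\<lambda>z. if fst z \<le> 1/2 then (H \<circ> (\<lambda>z. (2 * fst z, snd z))) z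
           else (G \<circ> (\<lambda>z. (2 * fst z - 1, snd z))) z)"
  proof (rule continuous_map_cases_le)
    have *: "continuous_map (subtopology (cylinder M) {z \<in> topspace (cylinder M). P z}) (cylinder M)
        (\<lambda>z. (k (fst z), snd z))"
      if "continuous_on UNIV k" "\<And>z. P z \<Longrightarrow> fst z \<in> {0..1} \<Longrightarrow> k (fst z) \<in> {0..1}" for P k
    proof (rule continuous_map_pairedI)
      have "continuous_map (cylinder M) euclideanreal (k \<circ> fst)"
        using that(1) continuous_map_compose[OF continuous_map_fst]
        by (metis continuous_map_compose continuous_map_from_subtopology continuous_map_iff_continuous2 continuous_map_fst_of continuous_map_subtopology_fst)
      then show "continuous_map (subtopology (cylinder M) {z \<in> topspace (cylinder M). P z}) (top_of_set {0..1})
        (\<lambda>z. k (fst z))"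
        using that(2) by (auto simp: continuous_map_in_subtopology o_def intro!: continuous_map_from_subtopology)
      show "continuous_map (subtopology (cylinder M) {z \<in> topspace (cylinder M). P z}) M snd"
        by (simp add: continuous_map_from_subtopology continuous_map_snd)
    qed
    show "continuous_map (cylinder M) euclideanreal fst"
      by (metis continuous_map_fst continuous_map_in_subtopology)
    show "continuous_map (subtopology (cylinder M) {x \<in> topspace (cylinder M). fst x \<le> 1/2}) X
            (H \<circ> (\<lambda>z. (2 * fst z, snd z)))"
      by (rule continuous_map_compose[OF *[where k = "\<lambda>t. 2 * t"] assms(1)]) (auto intro!: continuous_intros)
    show "continuous_map (subtopology (cylinder M) {x \<in> topspace (cylinder M). 1/2 \<le> fst x}) X
            (G \<circ> (\<lambda>z. (2 * fst z - 1, snd z)))"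
      by (rule continuous_map_compose[OF *[where k = "\<lambda>t. 2 * t - 1"] assms(2)]) (auto intro!: continuous_intros)
    show "(H \<circ> (\<lambda>z. (2 * fst z, snd z))) z = (G \<circ> (\<lambda>z. (2 * fst z - 1, snd z))) z"
      if "z \<in> topspace (cylinder M)" "fst z = 1/2" for z
    proof -
      have "\<exists>y. z = (1/2, y)" using that(2) by (metis prod.collapse)
      then obtain y where "z = (1/2, y)" ..
      then show ?thesis using that(1) assms(3)[of y] by simp
    qed
  qed auto
  then show ?thesis unfolding case_prod_unfold o_def by simp
qed

text \<open>
  This is the step of the skeletal induction. The motion on the boundary of the cell first drags the
  whole cell along, by the homotopy extension property; this takes the first half of the time, and the
  boundary ends up off \<open>Y\<close>. The second half moves the interior of the cell off \<open>Y\<close> relative to its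
  boundary, while \<open>A\<close> rests. Running the old homotopy at double speed does not change the set of points
  that it visits, so the constraints \<open>D\<close> on \<open>A\<close> survive.
\<close>

lemma cleared_on_insert_cell:
  assumes f: "continuous_map Z X f" and A: "closedin Z A" and c: "closedin Z c"
    and clr: "cleared_on Z X Y f D A"
    and ret: "cylinder_retracts (subtopology Z c) (c \<inter> A)"
    and cell: "clearable (subtopology Z c) (c \<inter> A) X Y P Q"
    and PQ: "P \<subseteq> Q" and fP: "f ` c \<subseteq> P"
    and DP: "\<And>x. x \<in> c \<inter> A \<Longrightarrow> D x \<subseteq> P" and QD: "\<And>x. x \<in> c - A \<Longrightarrow> Q \<subseteq> D x"
  shows "cleared_on Z X Y f D (A \<union> c)"
proof -
  let ?C = "subtopology Z c"
  have AZ: "A \<subseteq> topspace Z" and cZ: "c \<subseteq> topspace Z"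
    using A c closedin_subset by auto
  obtain H where H: "continuous_map (cylinder (subtopology Z A)) X H"
    and H01: "\<And>x. x \<in> A \<Longrightarrow> H (0, x) = f x \<and> H (1, x) \<notin> Y"
    and HD: "\<And>t x. t \<in> {0..1} \<Longrightarrow> x \<in> A \<Longrightarrow> H (t, x) \<in> D x"
    using clr unfolding cleared_on_def by blast
  obtain r where r: "continuous_map (cylinder ?C) (cylinder ?C) r"
    and r0: "\<And>x. x \<in> c \<Longrightarrow> r (0, x) = (0, x)"
    and rB: "\<And>t x. t \<in> {0..1} \<Longrightarrow> x \<in> c \<inter> A \<Longrightarrow> r (t, x) = (t, x)"
    and rim: "\<And>t x. t \<in> {0..1} \<Longrightarrow> x \<in> c \<Longrightarrow> fst (r (t, x)) = 0 \<or> snd (r (t, x)) \<in> c \<inter> A"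
    using ret cZ unfolding cylinder_retracts_def by (auto simp: inf.absorb2)
  have rin: "fst (r (t, x)) \<in> {0..1} \<and> snd (r (t, x)) \<in> c" if "t \<in> {0..1}" "x \<in> c" for t x
    using continuous_map_image_subset_topspace[OF r] that cZ
    by (force simp: image_subset_iff mem_Times_iff)
  \<comment> \<open>On the part of the cylinder that \<open>r\<close> retracts onto, the old homotopy and \<open>f\<close> fit together.\<close>
  let ?T = "{0} \<times> c \<union> {0..1} \<times> (c \<inter> A)"
  let ?CT = "subtopology (cylinder ?C) ?T"
  define \<Phi> where "\<Phi> = (\<lambda>z. if z \<in> {0..1} \<times> (c \<inter> A) then H z else f (snd z))"
  have clA: "closedin ?C (c \<inter> A)"
    by (rule closedin_subset_topspace) (use A c in auto)
  have cyl1: "closedin (cylinder ?C) ({0..1} \<times> (c \<inter> A))" "closedin (cylinder ?C) ({0} \<times> c)"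
    using clA c cZ by (auto simp: closedin_prod_Times_iff closedin_subset_topspace)
  have \<Phi>: "continuous_map ?CT X \<Phi>"
    unfolding \<Phi>_def
  proof (rule continuous_map_glue_closed)
    show "closedin ?CT ({0..1} \<times> (c \<inter> A))"
      by (rule closedin_subset_topspace[OF cyl1(1)]) auto
    show "closedin ?CT ({0} \<times> c)"
      by (rule closedin_subset_topspace[OF cyl1(2)]) auto
    have "continuous_map (prod_topology (top_of_set {0..1}) (subtopology Z (c \<inter> A))) X H"
      by (rule continuous_map_from_subtopology_mono[where S = "{0..1} \<times> (c \<inter> A)" and T = "UNIV \<times> A" and X = "cylinder Z", simplified subtopology_cylinder, simplified])
        (use H in auto)
    then show "continuous_map (subtopology ?CT ({0..1} \<times> (c \<inter> A))) X H"
      by (simp add: subtopology_subtopology inf.absorb2 subtopology_cylinder Int_assoc[symmetric])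
    have "continuous_map (cylinder Z) X (f \<circ> snd)"
      by (rule continuous_map_compose[OF continuous_map_snd f])
    then show "continuous_map (subtopology ?CT ({0} \<times> c)) X (\<lambda>z. f (snd z))"
      by (auto simp: o_def subtopology_subtopology subtopology_cylinder intro: continuous_map_compose[OF continuous_map_snd, unfolded o_def] continuous_map_from_subtopology f)
  qed (use H01 in auto)
  define E where "E = \<Phi> \<circ> r"
  have "continuous_map (cylinder ?C) ?CT r"
    unfolding continuous_map_in_subtopology
  proof (intro conjI r Pi_I)
    fix w assume "w \<in> topspace (cylinder ?C)"
    then obtain t x where w: "w = (t, x)" "t \<in> {0..1}" "x \<in> c"
      by auto
    then show "r w \<in> ?T"
      using rim[of t x] rin[of t x] by (cases "r (t, x)") auto
  qed
  then have E: "continuous_map (cylinder ?C) X E"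
    unfolding E_def by (rule continuous_map_compose[OF _ \<Phi>])
  have E0: "E (0, x) = f x" if "x \<in> c" for x
    using that r0 H01 by (auto simp: E_def \<Phi>_def)
  have EB: "E (t, x) = H (t, x)" if "t \<in> {0..1}" "x \<in> c \<inter> A" for t x
    using that rB by (auto simp: E_def \<Phi>_def)
  have EP: "E (t, x) \<in> P" if tx: "t \<in> {0..1}" "x \<in> c" for t x
  proof -
    obtain s y where sy: "r (t, x) = (s, y)" by (cases "r (t, x)")
    have "s \<in> {0..1}" "y \<in> c" using rin[OF tx] sy by auto
    then show ?thesis
      using sy HD[of s y] DP[of y] fP by (auto simp: E_def \<Phi>_def)
  qed
  have "continuous_map ?C X (\<lambda>x. E (1, x))"
    using continuous_map_compose[OF _ E, of ?C "\<lambda>x. (1, x)"]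
    by (simp add: o_def continuous_map_pairedI)
  moreover have "\<forall>x \<in> topspace ?C. E (1, x) \<in> P" using EP by auto
  moreover have "\<forall>x \<in> c \<inter> A. E (1, x) \<notin> Y" using EB[of 1] H01 by simp
  ultimately obtain G where G: "continuous_map (cylinder ?C) X G"
    and G01: "\<And>x. x \<in> c \<Longrightarrow> G (0, x) = E (1, x) \<and> G (1, x) \<notin> Y"
    and GQ: "\<And>t x. t \<in> {0..1} \<Longrightarrow> x \<in> c \<Longrightarrow> G (t, x) \<in> Q"
    and GB: "\<And>t x. t \<in> {0..1} \<Longrightarrow> x \<in> c \<inter> A \<Longrightarrow> G (t, x) = E (1, x)"
    using cell[unfolded clearable_def, rule_format, of "\<lambda>x. E (1, x)"] cZ
    by (auto simp: inf.absorb2)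
  \<comment> \<open>The old homotopy takes the first half of the time, so that \<open>A\<close> waits while the cell is cleared.\<close>
  define HA where "HA = (\<lambda>(t, x). if t \<le> 1/2 then H (2 * t, x) else H (1, x))"
  define Hc where "Hc = (\<lambda>(t, x). if t \<le> 1/2 then E (2 * t, x) else G (2 * t - 1, x))"
  let ?Z = "subtopology Z (A \<union> c)"
  have "continuous_map (cylinder (subtopology Z A)) X (\<lambda>(t,x). H (1, x))"
    using continuous_map_compose[OF _ H, of _ "\<lambda>z. (1, snd z)"]
    unfolding o_def case_prod_unfold
    by (rule meta_mp) (auto intro!: continuous_map_pairedI continuous_map_snd)
  from continuous_map_double_time[OF H this]
  have HA: "continuous_map (cylinder (subtopology Z A)) X HA"
    unfolding HA_def case_prod_unfold fst_conv snd_conv by simp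
  have Hc: "continuous_map (cylinder ?C) X Hc"
    unfolding Hc_def by (rule continuous_map_double_time[OF E G]) (use G01 in auto)
  have agree: "HA (t, x) = Hc (t, x)" if "t \<in> {0..1}" "x \<in> c \<inter> A" for t x
    using that EB[of "2 * t" x] EB[of 1 x] GB[of "2 * t - 1" x] by (auto simp: HA_def Hc_def)
  have closed: "closedin (cylinder ?Z) ({0..1} \<times> A)" "closedin (cylinder ?Z) ({0..1} \<times> c)"
    using A c by (auto simp: closedin_prod_Times_iff closedin_subset_topspace)
  have "continuous_map (cylinder ?Z) X (\<lambda>z. if z \<in> {0..1} \<times> A then HA z else Hc z)"
  proof (rule continuous_map_glue_closed[OF closed])
    show "continuous_map (subtopology (cylinder ?Z) ({0..1} \<times> A)) X HA"
      using HA by (simp add: subtopology_cylinder subtopology_subtopology Int_absorb1)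
    show "continuous_map (subtopology (cylinder ?Z) ({0..1} \<times> c)) X Hc"
      using Hc by (simp add: subtopology_cylinder subtopology_subtopology Int_absorb1)
  qed (use agree in auto)
  moreover have "Hc (t, x) \<in> Q" if "t \<in> {0..1}" "x \<in> c" for t x
    using that EP[of "2 * t" x] GQ[of "2 * t - 1" x] PQ by (auto simp: Hc_def)
  ultimately show ?thesis
    unfolding cleared_on_def
    apply (intro exI[of _ "\<lambda>z. if z \<in> {0..1} \<times> A then HA z else Hc z"] conjI ballI)
    subgoal by assumption
    subgoal for x using H01[of x] E0[of x] by (auto simp: HA_def Hc_def)
    subgoal for x using H01[of x] G01[of x] by (auto simp: HA_def Hc_def)
    subgoal for t x using HD[of "2*t" x] HD[of 1 x] QD[of x] by (auto simp: HA_def)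
    done
qed

text \<open>
  Cells that meet each other only in \<open>A\<close> do not interact and can be added one after another; this is
  how all cells of one dimension are treated at once.
\<close>

lemma cleared_on_insert_cells:
  assumes f: "continuous_map Z X f" and A: "closedin Z A" and "finite I"
    and clr: "cleared_on Z X Y f D A"
    and closed: "\<And>i. i \<in> I \<Longrightarrow> closedin Z (c i)"
    and disj: "\<And>i j. i \<in> I \<Longrightarrow> j \<in> I \<Longrightarrow> i \<noteq> j \<Longrightarrow> c i \<inter> c j \<subseteq> A"
    and ret: "\<And>i. i \<in> I \<Longrightarrow> cylinder_retracts (subtopology Z (c i)) (c i \<inter> A)"
    and cell: "\<And>i. i \<in> I \<Longrightarrow> clearable (subtopology Z (c i)) (c i \<inter> A) X Y (P i) (Q i)"
    and PQ: "\<And>i. i \<in> I \<Longrightarrow> P i \<subseteq> Q i" and fP: "\<And>i. i \<in> I \<Longrightarrow> f ` c i \<subseteq> P i"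
    and DP: "\<And>i x. i \<in> I \<Longrightarrow> x \<in> c i \<inter> A \<Longrightarrow> D x \<subseteq> P i"
    and QD: "\<And>i x. i \<in> I \<Longrightarrow> x \<in> c i - A \<Longrightarrow> Q i \<subseteq> D x"
  shows "cleared_on Z X Y f D (A \<union> (\<Union>i\<in>I. c i))"
proof -
  have "cleared_on Z X Y f D (A \<union> (\<Union>i\<in>I'. c i))" if "I' \<subseteq> I" for I'
    using finite_subset[OF that \<open>finite I\<close>] that
  proof (induction I')
    case empty
    then show ?case using clr by simp
  next
    case (insert i I')
    have i: "i \<in> I" using insert by simp
    let ?A = "A \<union> (\<Union>i\<in>I'. c i)"
    have eq: "c i \<inter> ?A = c i \<inter> A"
      using disj[OF i] insert by blast
    have "cleared_on Z X Y f D (?A \<union> c i)"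
    proof (rule cleared_on_insert_cell[OF f _ closed[OF i] _ _ _ PQ[OF i] fP[OF i]])
      show "closedin Z ?A"
      proof (intro closedin_Un A closedin_Union)
        show "finite (c ` I')" using insert.hyps(1) by simp
        show "closedin Z T" if "T \<in> c ` I'" for T
          using that closed insert.prems by blast
      qed
      show "cleared_on Z X Y f D ?A" using insert.IH insert.prems by blast
      show "cylinder_retracts (subtopology Z (c i)) (c i \<inter> ?A)"
        unfolding eq by (rule ret[OF i])
      show "clearable (subtopology Z (c i)) (c i \<inter> ?A) X Y (P i) (Q i)"
        unfolding eq by (rule cell[OF i])
      show "D x \<subseteq> P i" if "x \<in> c i \<inter> ?A" for x
        using DP[OF i] that unfolding eq by blast
      show "Q i \<subseteq> D x" if "x \<in> c i - ?A" for x
        using QD[OF i] that by blast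
    qed
    moreover have "A \<union> (\<Union>j\<in>insert i I'. c j) = ?A \<union> c i" by blast
    ultimately show ?case by simp
  qed
  then show ?thesis by blast
qed

section \<open>Convex bodies as model cells\<close>

text \<open>
  By invariance of domain any homeomorphism between two convex bodies of the same Euclidean space
  matches interior with interior, so it is a homeomorphism of pairs.
\<close>

lemma convex_compact_homeomorphic_frontier:
  fixes C D :: "'c::euclidean_space set"
  assumes "convex C" "compact C" "interior C \<noteq> {}" "convex D" "compact D" "interior D \<noteq> {}"
  obtains p q where "homeomorphic_maps (top_of_set C) (top_of_set D) p q" "p ` frontier C = frontier D"
proof -
  obtain p q where pq: "homeomorphism C D p q"
    using homeomorphic_convex_compact[OF assms] homeomorphic_def by blast
  have closed: "closed C" "closed D" using assms compact_imp_closed by auto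
  have inj: "inj_on p C" "inj_on q D"
    using pq by (auto simp: homeomorphism_def intro: inj_on_inverseI)
  have sub: "p ` interior C \<subseteq> interior D" "q ` interior D \<subseteq> interior C"
    using continuous_image_subset_interior[OF _ inj(1)] continuous_image_subset_interior[OF _ inj(2)] pq
    by (auto simp: homeomorphism_def)
  have "p ` frontier C = frontier D"
  proof -
    have "p x \<in> frontier D" if "x \<in> frontier C" for x
      using that sub pq closed unfolding frontier_def homeomorphism_def by (auto simp: image_subset_iff)
    moreover have "q x \<in> frontier C" if "x \<in> frontier D" for x
      using that sub pq closed unfolding frontier_def homeomorphism_def by (auto simp: image_subset_iff)
    moreover have "p (q x) = x" if "x \<in> frontier D" for x
      using that pq closed unfolding frontier_def homeomorphism_def by auto
    ultimately show ?thesis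
    proof (intro subset_antisym image_subsetI subsetI)
      fix x assume "x \<in> frontier D"
      with \<open>\<And>x. x \<in> frontier D \<Longrightarrow> q x \<in> frontier C\<close> \<open>\<And>x. x \<in> frontier D \<Longrightarrow> p (q x) = x\<close>
      show "x \<in> p ` frontier C" by (metis imageI)
    qed
  qed
  moreover have "homeomorphic_maps (top_of_set C) (top_of_set D) p q"
    using pq by (auto simp: homeomorphic_maps_def homeomorphism_def)
  ultimately show ?thesis using that by blast
qed

lemma cylinder_map:
  assumes "continuous_map M N p"
  shows "continuous_map (cylinder M) (cylinder N) (\<lambda>z. (fst z, p (snd z)))"
  using assms by (auto intro!: continuous_map_pairedI continuous_map_fst continuous_map_compose[OF continuous_map_snd, unfolded o_def])

lemma clearable_homeomorphic:
  assumes pq: "homeomorphic_maps M N p q" and B: "B \<subseteq> topspace M" "p ` B = B'"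
    and "clearable N B' X Y P Q"
  shows "clearable M B X Y P Q"
  unfolding clearable_def
proof (intro allI impI, elim conjE)
  fix g assume g: "continuous_map M X g" "\<forall>x \<in> topspace M. g x \<in> P" "\<forall>x \<in> B. g x \<notin> Y"
  have p: "continuous_map M N p" and q: "continuous_map N M q"
    and qp: "\<And>x. x \<in> topspace M \<Longrightarrow> q (p x) = x"
    using pq by (auto simp: homeomorphic_maps_def)
  have im: "\<And>x. x \<in> topspace M \<Longrightarrow> p x \<in> topspace N" "\<And>x. x \<in> topspace N \<Longrightarrow> q x \<in> topspace M"
    using p q by (auto simp: continuous_map_def)
  have qB: "q y \<in> B" if "y \<in> B'" for y using that B qp by auto
  obtain G where G: "continuous_map (cylinder N) X G"
    "\<forall>x \<in> topspace N. G (0, x) = (g \<circ> q) x \<and> G (1, x) \<notin> Y"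
    "\<forall>t \<in> {0..1}. \<forall>x \<in> topspace N. G (t, x) \<in> Q"
    "\<forall>t \<in> {0..1}. \<forall>x \<in> B'. G (t, x) = (g \<circ> q) x"
    using assms(4)[unfolded clearable_def, rule_format, of "g \<circ> q"] continuous_map_compose[OF q g(1)]
      g(2,3) im qB by auto
  have pB: "p x \<in> B'" "x \<in> topspace M" if "x \<in> B" for x using that B by auto
  show "\<exists>G. clearing M B X Y Q g G"
    by (rule exI[of _ "G \<circ> (\<lambda>z. (fst z, p (snd z)))"])
      (use G pB qp im in \<open>auto intro!: continuous_map_compose[OF cylinder_map[OF p]]\<close>)
qed

lemma cylinder_retracts_homeomorphic:
  assumes pq: "homeomorphic_maps M N p q" and B: "B \<subseteq> topspace M" "p ` B = B'"
    and "cylinder_retracts N B'"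
  shows "cylinder_retracts M B"
proof -
  have p: "continuous_map M N p" and q: "continuous_map N M q"
    and qp: "\<And>x. x \<in> topspace M \<Longrightarrow> q (p x) = x"
    using pq by (auto simp: homeomorphic_maps_def)
  have im: "\<And>x. x \<in> topspace M \<Longrightarrow> p x \<in> topspace N"
    using p by (auto simp: continuous_map_def)
  have qB: "q y \<in> B" if "y \<in> B'" for y using that B qp by auto
  have pB: "p x \<in> B'" "x \<in> topspace M" if "x \<in> B" for x using that B by auto
  obtain r where r: "continuous_map (cylinder N) (cylinder N) r"
    "\<And>x. x \<in> topspace N \<Longrightarrow> r (0, x) = (0, x)"
    "\<And>t x. t \<in> {0..1} \<Longrightarrow> x \<in> B' \<Longrightarrow> r (t, x) = (t, x)"
    "\<And>t x. t \<in> {0..1} \<Longrightarrow> x \<in> topspace N \<Longrightarrow> fst (r (t, x)) = 0 \<or> snd (r (t, x)) \<in> B'"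
    using assms(4) unfolding cylinder_retracts_def by blast
  let ?r = "(\<lambda>z. (fst z, q (snd z))) \<circ> (r \<circ> (\<lambda>z. (fst z, p (snd z))))"
  have "continuous_map (cylinder M) (cylinder M) ?r"
    by (intro continuous_map_compose[OF continuous_map_compose[OF cylinder_map[OF p] r(1)] cylinder_map[OF q]])
  moreover have "fst (?r (t, x)) = 0 \<or> snd (?r (t, x)) \<in> B" if "t \<in> {0..1}" "x \<in> topspace M" for t x
    using r(4)[OF that(1) im[OF that(2)]] qB by auto
  ultimately show ?thesis
    unfolding cylinder_retracts_def
    by (intro exI[of _ ?r]) (use r(2,3) im qp pB in auto)
qed

text \<open>
  The cylinder over the ball is projected from the point at height 2 above the centre. A ray leaves
  the cylinder through the bottom if \<open>2 * norm x + t \<le> 2\<close>, and through the side otherwise.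
\<close>

lemma cylinder_retracts_ball:
  "cylinder_retracts (top_of_set (cball (0::'c::euclidean_space) 1)) (sphere 0 1)"
proof -
  let ?S = "{0..1} \<times> cball (0::'c) 1"
  define r :: "real \<times> 'c \<Rightarrow> real \<times> 'c" where
    "r = (\<lambda>z. if 2 * norm (snd z) + fst z \<le> 2 then (0, (2 / (2 - fst z)) *\<^sub>R snd z)
              else (2 - (2 - fst z) / norm (snd z), (1 / norm (snd z)) *\<^sub>R snd z))"
  have cont: "continuous_on ?S r"
    unfolding r_def
  proof (rule continuous_on_cases_le)
    show "continuous_on {z \<in> ?S. 2 * norm (snd z) + fst z \<le> 2} (\<lambda>z. (0, (2 / (2 - fst z)) *\<^sub>R snd z))"
      by (intro continuous_intros) auto
    show "continuous_on {z \<in> ?S. 2 \<le> 2 * norm (snd z) + fst z}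
       (\<lambda>z. (2 - (2 - fst z) / norm (snd z), (1 / norm (snd z)) *\<^sub>R snd z))"
      by (intro continuous_intros) auto
    show "continuous_on ?S (\<lambda>z. 2 * norm (snd z) + fst z)"
      by (intro continuous_intros)
    fix z assume "z \<in> ?S" and eq: "2 * norm (snd z) + fst z = 2"
    then have n: "norm (snd z) \<noteq> 0" and n2: "2 - fst z = 2 * norm (snd z)" by auto
    show "(0, (2 / (2 - fst z)) *\<^sub>R snd z) = (2 - (2 - fst z) / norm (snd z), (1 / norm (snd z)) *\<^sub>R snd z)"
      unfolding n2 using n by simp
  qed
  have im: "r z \<in> ?S \<and> (fst (r z) = 0 \<or> snd (r z) \<in> sphere 0 1)" if "z \<in> ?S" for z
  proof -
    obtain t x where z: "z = (t, x)" and t: "0 \<le> t" "t \<le> 1" and x: "norm x \<le> 1"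
      using \<open>z \<in> ?S\<close> by auto
    show ?thesis
    proof (cases "2 * norm x + t \<le> 2")
      case True
      then show ?thesis using t by (auto simp: z r_def field_simps)
    next
      case False
      then have n: "norm x > 0" using t by auto
      have "(2 - t) / norm x \<le> 2" using False n by (simp add: field_simps)
      moreover have "1 \<le> (2 - t) / norm x" using x n t by (simp add: field_simps)
      ultimately show ?thesis using False n by (auto simp: z r_def)
    qed
  qed
  have "continuous_map (cylinder (top_of_set (cball (0::'c) 1))) (cylinder (top_of_set (cball 0 1))) r"
    using cont im by (auto simp: prod_topology_subtopology_eu)
  then show ?thesis
    unfolding cylinder_retracts_def
    using im by (intro exI[of _ r]) (auto simp: r_def)
qed

lemma cylinder_retracts_convex:
  fixes C :: "'c::euclidean_space set"
  assumes "convex C" "compact C" "interior C \<noteq> {}"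
  shows "cylinder_retracts (top_of_set C) (frontier C)"
proof -
  have ball: "convex (cball (0::'c) 1)" "compact (cball (0::'c) 1)" "interior (cball (0::'c) 1) \<noteq> {}"
    by simp_all
  obtain p q where pq: "homeomorphic_maps (top_of_set C) (top_of_set (cball (0::'c) 1)) p q"
     "p ` frontier C = frontier (cball 0 1)"
    by (rule convex_compact_homeomorphic_frontier[OF assms ball])
  show ?thesis
  proof (rule cylinder_retracts_homeomorphic[OF pq(1) _ pq(2)])
    show "frontier C \<subseteq> topspace (top_of_set C)"
      using compact_imp_closed[OF assms(2)] by (simp add: frontier_subset_closed)
    show "cylinder_retracts (top_of_set (cball (0::'c) 1)) (frontier (cball 0 1))"
      using cylinder_retracts_ball[where 'c = 'c] by simp
  qed
qed

lemma cylinder_retracts_empty: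
  "cylinder_retracts M {}"
proof -
  have "continuous_map (cylinder M) (cylinder M) (\<lambda>z. (0, snd z))"
    by (auto intro!: continuous_map_pairedI continuous_map_snd)
  then show ?thesis
    unfolding cylinder_retracts_def by (intro exI[of _ "\<lambda>z. (0, snd z)"]) auto
qed

section \<open>Extending maps from a sphere over the ball\<close>

text \<open>
  The body \<open>C\<close> is the cone on its frontier, and the frontier is a quotient of \<open>T\<close>; hence \<open>C\<close> is a
  quotient of the cylinder on \<open>T\<close>, with time as the radial coordinate. A homotopy that respects the
  identifications of \<open>\<kappa>\<close> and is constant at time 1 factors through this quotient.
\<close>

lemma cone_extension:
  fixes \<kappa> :: "'e::topological_space \<Rightarrow> 'd::euclidean_space"
  assumes C: "convex C" "compact C" "interior C \<noteq> {}"
    and T: "compact T" and \<kappa>: "continuous_on T \<kappa>" "\<kappa> ` T = frontier C"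
    and h: "continuous_map (cylinder (top_of_set T)) Z h"
    and const: "\<And>x. x \<in> T \<Longrightarrow> h (1, x) = z"
    and compat: "\<And>t x y. t \<in> {0..1} \<Longrightarrow> x \<in> T \<Longrightarrow> y \<in> T \<Longrightarrow> \<kappa> x = \<kappa> y \<Longrightarrow> h (t, x) = h (t, y)"
  shows "\<exists>E. continuous_map (top_of_set C) Z E \<and> (\<forall>x \<in> T. E (\<kappa> x) = h (0, x)) \<and>
    E ` C = h ` ({0..1} \<times> T)"
proof -
  have ball: "convex (cball (0::'d) 1)" "compact (cball (0::'d) 1)" "interior (cball (0::'d) 1) \<noteq> {}"
    by simp_all
  obtain p q where pq: "homeomorphic_maps (top_of_set (cball (0::'d) 1)) (top_of_set C) p q"
    "p ` frontier (cball 0 1) = frontier C"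
    by (rule convex_compact_homeomorphic_frontier[OF ball C])
  then have p: "continuous_on (cball 0 1) p" and pC: "\<And>x. x \<in> cball 0 1 \<Longrightarrow> p x \<in> C"
    and q: "continuous_on C q" and qC: "\<And>x. x \<in> C \<Longrightarrow> q x \<in> cball 0 1"
    and qp: "\<And>x. x \<in> cball 0 1 \<Longrightarrow> q (p x) = x" "\<And>x. x \<in> C \<Longrightarrow> p (q x) = x"
    unfolding homeomorphic_maps_def continuous_map_subtopology_eu topspace_euclidean_subtopology
    by blast+
  have pfr: "p ` sphere 0 1 = frontier C" using pq(2) by simp
  have frC: "frontier C \<subseteq> C" using C(2) by (simp add: compact_imp_closed frontier_subset_closed)
  have \<kappa>C: "\<kappa> x \<in> C" if "x \<in> T" for x using that \<kappa>(2) frC by auto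
  have q\<kappa>: "norm (q (\<kappa> x)) = 1" if "x \<in> T" for x
  proof -
    have "\<kappa> x \<in> p ` sphere 0 1" unfolding pfr using that \<kappa>(2) by blast
    then obtain y where "y \<in> sphere 0 1" "\<kappa> x = p y" by blast
    then show ?thesis using qp(1)[of y] by simp
  qed
  define Q where "Q = (\<lambda>z. p ((1 - fst z) *\<^sub>R q (\<kappa> (snd z))))"
  have Qball: "(1 - fst z) *\<^sub>R q (\<kappa> (snd z)) \<in> cball 0 1" if "z \<in> {0..1} \<times> T" for z
    using that q\<kappa>[of "snd z"] by auto
  have "continuous_on ({0..1} \<times> T) Q"
    unfolding Q_def
  proof (rule continuous_on_compose2[OF p])
    show "continuous_on ({0..1} \<times> T) (\<lambda>z. (1 - fst z) *\<^sub>R q (\<kappa> (snd z)))"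
      by (intro continuous_intros continuous_on_compose2[OF q] continuous_on_compose2[OF \<kappa>(1)])
        (use \<kappa>C in auto)
    show "(\<lambda>z. (1 - fst z) *\<^sub>R q (\<kappa> (snd z))) ` ({0..1} \<times> T) \<subseteq> cball 0 1"
      using Qball by blast
  qed
  moreover have Qim: "Q ` ({0..1} \<times> T) = C"
  proof
    show "Q ` ({0..1} \<times> T) \<subseteq> C" using Qball pC unfolding Q_def by blast
    show "C \<subseteq> Q ` ({0..1} \<times> T)"
    proof
      fix v assume v: "v \<in> C"
      obtain u where u: "u \<in> sphere (0::'d) 1" "q v = norm (q v) *\<^sub>R u"
      proof (cases "q v = 0")
        case True
        \<comment> \<open>Every direction leads to the apex of the cone, so any unit vector serves.\<close>
        obtain u :: 'd where "u \<in> Basis" using nonempty_Basis by blast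
        then show ?thesis using that[of u] True by simp
      next
        case False
        then show ?thesis using that[of "(1 / norm (q v)) *\<^sub>R q v"] by auto
      qed
      then obtain x where x: "x \<in> T" "\<kappa> x = p u"
        using pfr \<kappa>(2) by (metis imageE imageI)
      have "q (\<kappa> x) = u" using x u qp(1) by auto
      then have "Q (1 - norm (q v), x) = v" using u(2) qp(2)[OF v] by (simp add: Q_def)
      moreover have "(1 - norm (q v), x) \<in> {0..1} \<times> T" using x qC[OF v] by auto
      ultimately show "v \<in> Q ` ({0..1} \<times> T)" by (metis imageI)
    qed
  qed
  moreover have "Q \<in> {0..1} \<times> T \<rightarrow> C" using Qim by blast
  moreover have cyl: "cylinder (top_of_set T) = top_of_set ({0..1} \<times> T)"
    by (rule prod_topology_subtopology_eu)
  ultimately have "quotient_map (cylinder (top_of_set T)) (top_of_set C) Q"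
    unfolding cyl
    by (intro T1_Spaces.continuous_imp_quotient_map)
      (simp_all add: compact_space_subtopology compact_Times T Hausdorff_space_subtopology)
  moreover have "h w = h w'"
    if ww: "w \<in> topspace (cylinder (top_of_set T))" "w' \<in> topspace (cylinder (top_of_set T))" "Q w = Q w'" for w w'
  proof -
    have wT: "w \<in> {0..1} \<times> T" "w' \<in> {0..1} \<times> T" using ww by simp_all
    define t x t' x' where "t = fst w" and "x = snd w" and "t' = fst w'" and "x' = snd w'"
    then have tx: "w = (t, x)" "w' = (t', x')" by simp_all
    have mem: "t \<in> {0..1}" "x \<in> T" "t' \<in> {0..1}" "x' \<in> T" using wT unfolding tx by simp_all
    have eq: "(1 - t) *\<^sub>R q (\<kappa> x) = (1 - t') *\<^sub>R q (\<kappa> x')"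
      using qp(1)[OF Qball[OF wT(1)]] qp(1)[OF Qball[OF wT(2)]] ww(3) unfolding tx Q_def fst_conv snd_conv
      by (metis (no_types))
    then have "norm ((1 - t) *\<^sub>R q (\<kappa> x)) = norm ((1 - t') *\<^sub>R q (\<kappa> x'))"
      by (rule arg_cong)
    then have "\<bar>1 - t\<bar> = \<bar>1 - t'\<bar>"
      unfolding norm_scaleR q\<kappa>[OF mem(2)] q\<kappa>[OF mem(4)] mult_1_right .
    moreover have "t \<le> 1" "t' \<le> 1" using mem(1,3) by simp_all
    ultimately have tt: "t = t'" by linarith
    have "t = 1 \<and> t' = 1 \<or> t = t' \<and> q (\<kappa> x) = q (\<kappa> x')"
    proof (cases "t = 1")
      case False
      then have "q (\<kappa> x) = q (\<kappa> x')"
        using eq unfolding tt[symmetric] by (metis right_minus_eq scaleR_cancel_left)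
      then show ?thesis using tt by blast
    qed (use tt in blast)
    then show "h w = h w'"
    proof
      assume "t = 1 \<and> t' = 1"
      then show ?thesis unfolding tx using const[OF mem(2)] const[OF mem(4)] by metis
    next
      assume eq: "t = t' \<and> q (\<kappa> x) = q (\<kappa> x')"
      then have "\<kappa> x = \<kappa> x'" using qp(2)[OF \<kappa>C[OF mem(2)]] qp(2)[OF \<kappa>C[OF mem(4)]] by metis
      then show ?thesis unfolding tx using compat[OF mem(1,2,4)] eq by metis
    qed
  qed
  ultimately have "\<exists>E. continuous_map (top_of_set C) Z E \<and>
      E ` topspace (top_of_set C) = h ` topspace (cylinder (top_of_set T)) \<and>
      (\<forall>w \<in> topspace (cylinder (top_of_set T)). E (Q w) = h w)"
    by (metis (no_types, lifting) quotient_map_lift_exists[OF _ h])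
  then obtain E where E: "continuous_map (top_of_set C) Z E" "E ` C = h ` ({0..1} \<times> T)"
    "\<And>w. w \<in> {0..1} \<times> T \<Longrightarrow> E (Q w) = h w"
    by auto
  have "E (\<kappa> x) = h (0, x)" if "x \<in> T" for x
    using E(3)[of "(0, x)"] that qp(2)[OF \<kappa>C[OF that]] by (simp add: Q_def)
  then show ?thesis using E(1,2) by blast
qed

text \<open>
  The ball of radius 1 is wrapped around the sphere of one dimension more by
  \<open>z \<mapsto> (2 * sqrt (1 - r\<^sup>2) * z, 1 - 2 * r\<^sup>2)\<close> with \<open>r = norm z\<close>: the centre goes to one pole, and all of the
  frontier to the other.
\<close>

lemma ball_collapse:
  "\<exists>\<psi> :: 'c::euclidean_space \<Rightarrow> 'c \<times> real.
     continuous_on (cball 0 1) \<psi> \<and> \<psi> ` cball 0 1 = sphere 0 1 \<and>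
     (\<forall>x \<in> sphere 0 1. \<psi> x = (0, -1)) \<and>
     (\<forall>x \<in> cball 0 1. \<forall>y \<in> cball 0 1. \<psi> x = \<psi> y \<longrightarrow> x = y \<or> x \<in> sphere 0 1 \<and> y \<in> sphere 0 1)"
proof -
  define \<psi> :: "'c \<Rightarrow> 'c \<times> real" where
    "\<psi> = (\<lambda>x. ((2 * sqrt (1 - (norm x)\<^sup>2)) *\<^sub>R x, 1 - 2 * (norm x)\<^sup>2))"
  have cont: "continuous_on (cball 0 1) \<psi>"
    unfolding \<psi>_def by (intro continuous_intros)
  have sq: "(norm x)\<^sup>2 \<le> 1" if "x \<in> cball 0 1" for x :: 'c
    using that by (simp add: power_le_one)
  have norm: "(norm (\<psi> x))\<^sup>2 = 1" if "x \<in> cball 0 1" for x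
  proof -
    have "(norm (\<psi> x))\<^sup>2 = (2 * sqrt (1 - (norm x)\<^sup>2) * norm x)\<^sup>2 + (1 - 2 * (norm x)\<^sup>2)\<^sup>2"
      using sq[OF that] by (simp add: \<psi>_def norm_Pair)
    also have "\<dots> = 4 * (1 - (norm x)\<^sup>2) * (norm x)\<^sup>2 + (1 - 2 * (norm x)\<^sup>2)\<^sup>2"
      using sq[OF that] by (simp add: power_mult_distrib)
    also have "\<dots> = 1" by (simp add: power2_eq_square algebra_simps)
    finally show ?thesis .
  qed
  have bd: "\<psi> x = (0, -1)" if "x \<in> sphere 0 1" for x
    using that by (simp add: \<psi>_def)
  have im: "\<psi> ` cball 0 1 = sphere 0 1"
  proof
    show "\<psi> ` cball 0 1 \<subseteq> sphere 0 1"
    proof (rule image_subsetI)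
      fix x :: 'c assume "x \<in> cball 0 1"
      from norm[OF this] show "\<psi> x \<in> sphere 0 1"
        by (simp add: power2_eq_1_iff) (smt (verit) norm_ge_zero)
    qed
    show "sphere 0 1 \<subseteq> \<psi> ` cball 0 1"
    proof
      fix z :: "'c \<times> real" assume z: "z \<in> sphere 0 1"
      obtain w u where wu: "z = (w, u)" by (cases z)
      have eq: "(norm w)\<^sup>2 + u\<^sup>2 = 1" using z wu by (simp add: norm_Pair)
      then have "u\<^sup>2 \<le> 1" by (smt (verit) zero_le_power2)
      then have u: "\<bar>u\<bar> \<le> 1" by (simp add: abs_square_le_1)
      show "z \<in> \<psi> ` cball 0 1"
      proof (cases "u = -1")
        case True
        \<comment> \<open>The lower pole comes from any point of the unit sphere.\<close>
        obtain b :: 'c where "b \<in> Basis" using nonempty_Basis by blast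
        moreover have "w = 0" using eq True by simp
        ultimately show ?thesis using wu True by (intro image_eqI[of _ _ b]) (auto simp: \<psi>_def)
      next
        case False
        \<comment> \<open>The last coordinate is \<open>u = 1 - 2 * r\<^sup>2\<close>, so the scaling factor \<open>2 * sqrt (1 - r\<^sup>2)\<close> must be \<open>a\<close>.\<close>
        define a where "a = 2 * sqrt ((1 + u) / 2)"
        have a: "a > 0" "a\<^sup>2 = 2 * (1 + u)" using False u by (auto simp: a_def power_mult_distrib)
        define x where "x = (1 / a) *\<^sub>R w"
        have "(norm x)\<^sup>2 = (norm w)\<^sup>2 / a\<^sup>2" using a by (simp add: x_def power_divide)
        also have "\<dots> = ((1 - u) * (1 + u)) / (2 * (1 + u))" using eq a by (simp add: power2_eq_square algebra_simps)
        also have "\<dots> = (1 - u) / 2" using False u by (simp add: field_simps)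
        finally have n: "(norm x)\<^sup>2 = (1 - u) / 2" .
        have "(norm x)\<^sup>2 \<le> 1" using n u by auto
        then have "x \<in> cball 0 1" by (simp add: abs_square_le_1)
        have "1 - (norm x)\<^sup>2 = (1 + u) / 2" using n by (simp add: field_simps)
        then have "2 * sqrt (1 - (norm x)\<^sup>2) = a" by (simp add: a_def)
        then have "\<psi> x = (a *\<^sub>R x, 1 - 2 * ((1 - u) / 2))" unfolding \<psi>_def n by simp
        moreover have "1 - 2 * ((1 - u) / 2) = u" by (simp add: field_simps)
        ultimately have "\<psi> x = z" using a(1) by (simp add: x_def wu)
        with \<open>x \<in> cball 0 1\<close> show ?thesis by blast
      qed
    qed
  qed
  have inj: "x = y \<or> x \<in> sphere 0 1 \<and> y \<in> sphere 0 1"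
    if "x \<in> cball 0 1" "y \<in> cball 0 1" "\<psi> x = \<psi> y" for x y
  proof -
    have n: "(norm x)\<^sup>2 = (norm y)\<^sup>2" "norm x = norm y" using that(3) by (auto simp: \<psi>_def)
    have s: "(2 * sqrt (1 - (norm x)\<^sup>2)) *\<^sub>R x = (2 * sqrt (1 - (norm x)\<^sup>2)) *\<^sub>R y"
      using that(3) n by (simp add: \<psi>_def)
    show ?thesis
    proof (cases "norm x = 1")
      case True then show ?thesis using n by simp
    next
      case False
      then have "norm x < 1" using that(1) by simp
      then have "(norm x)\<^sup>2 < 1" by (simp add: abs_square_less_1)
      then show ?thesis using s by simp
    qed
  qed
  show ?thesis
    by (rule exI[of _ \<psi>]) (use cont bd im inj in blast)
qed

text \<open>
  The map \<open>\<psi>\<close> identifies the cube with its frontier collapsed to one point with \<open>F\<close>. This is what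
  translates cubes, in which homotopy groups are expressed, into spheres.
\<close>

definition collapses_cube :: "('c::euclidean_space \<Rightarrow> 'd::topological_space) \<Rightarrow> 'd \<Rightarrow> 'd set \<Rightarrow> bool" where
  "collapses_cube \<psi> p F \<longleftrightarrow>
     continuous_on (cbox 0 One) \<psi> \<and> \<psi> ` cbox 0 One = F \<and> p \<in> F \<and>
     (\<forall>x \<in> frontier (cbox 0 One). \<psi> x = p) \<and>
     (\<forall>x \<in> cbox 0 One. \<forall>y \<in> cbox 0 One. \<psi> x = \<psi> y \<longrightarrow>
        x = y \<or> x \<in> frontier (cbox 0 One) \<and> y \<in> frontier (cbox 0 One))"

lemma cube_collapse:
  fixes C :: "('c::euclidean_space \<times> real) set"
  assumes C: "convex C" "compact C" "interior C \<noteq> {}"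
  shows "\<exists>(\<psi> :: 'c \<Rightarrow> 'c \<times> real) p. collapses_cube \<psi> p (frontier C)"
proof -
  let ?Q = "cbox 0 One :: 'c set"
  let ?B = "cball 0 1 :: 'c set" and ?B' = "cball 0 1 :: ('c \<times> real) set"
  have Q: "convex ?Q" "compact ?Q" "interior ?Q \<noteq> {}"
    by (simp_all add: interior_cbox box_ne_empty)
  have B: "convex ?B" "compact ?B" "interior ?B \<noteq> {}" "convex ?B'" "compact ?B'" "interior ?B' \<noteq> {}"
    by simp_all
  obtain p q where pq: "homeomorphic_maps (top_of_set ?Q) (top_of_set ?B) p q" "p ` frontier ?Q = frontier ?B"
    by (rule convex_compact_homeomorphic_frontier[OF Q B(1-3)])
  obtain p' q' where pq': "homeomorphic_maps (top_of_set ?B') (top_of_set C) p' q'" "p' ` frontier ?B' = frontier C"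
    by (rule convex_compact_homeomorphic_frontier[OF B(4-6) C])
  have p: "continuous_on ?Q p" "\<And>x. x \<in> ?Q \<Longrightarrow> p x \<in> ?B" "\<And>x. x \<in> ?Q \<Longrightarrow> q (p x) = x"
      "\<And>x. x \<in> ?B \<Longrightarrow> p (q x) = x" "\<And>x. x \<in> ?B \<Longrightarrow> q x \<in> ?Q"
    and p': "continuous_on ?B' p'" "\<And>x. x \<in> ?B' \<Longrightarrow> q' (p' x) = x"
    using pq(1) pq'(1) unfolding homeomorphic_maps_def continuous_map_subtopology_eu topspace_euclidean_subtopology
    by blast+
  from ball_collapse obtain \<psi> :: "'c \<Rightarrow> 'c \<times> real" where
    \<psi>_props: "continuous_on ?B \<psi> \<and> \<psi> ` ?B = sphere 0 1 \<and> (\<forall>x \<in> sphere 0 1. \<psi> x = (0, -1)) \<and>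
      (\<forall>x \<in> ?B. \<forall>y \<in> ?B. \<psi> x = \<psi> y \<longrightarrow> x = y \<or> x \<in> sphere 0 1 \<and> y \<in> sphere 0 1)" ..
  note \<psi> = conjunct1[OF \<psi>_props] conjunct1[OF conjunct2[OF \<psi>_props]]
    bspec[OF conjunct1[OF conjunct2[OF conjunct2[OF \<psi>_props]]]]
    mp[OF bspec[OF bspec[OF conjunct2[OF conjunct2[OF conjunct2[OF \<psi>_props]]]]]]
  have im: "\<psi> x \<in> ?B'" if "x \<in> ?B" for x
    using imageI[OF that, of \<psi>] unfolding \<psi>(2) by simp
  have pB: "p ` ?Q = ?B"
  proof (intro subset_antisym image_subsetI subsetI)
    show "x \<in> p ` ?Q" if "x \<in> ?B" for x using imageI[OF p(5)[OF that], of p] p(4)[OF that] by simp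
  qed (rule p(2))
  have p'S: "p' ` sphere 0 1 = frontier C" using pq'(2) by simp
  have fr: "x \<in> frontier ?Q" if "x \<in> ?Q" "p x \<in> sphere 0 1" for x
  proof -
    have "p x \<in> p ` frontier ?Q" using that(2) pq(2) by simp
    then obtain y where "y \<in> frontier ?Q" "p x = p y" by blast
    moreover have "frontier ?Q \<subseteq> ?Q" by (intro frontier_subset_closed closed_cbox)
    ultimately show ?thesis using p(3)[OF that(1)] p(3)[of y] by auto
  qed
  have "collapses_cube (p' \<circ> \<psi> \<circ> p) (p' (0, -1)) (frontier C)"
    unfolding collapses_cube_def
  proof (intro conjI ballI impI)
    show "continuous_on ?Q (p' \<circ> \<psi> \<circ> p)"
    proof (intro continuous_on_compose)
      show "continuous_on (p ` ?Q) \<psi>" unfolding pB by (rule \<psi>(1))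
      have "sphere 0 1 \<subseteq> ?B'" by (rule sphere_cball)
      then show "continuous_on (\<psi> ` p ` ?Q) p'"
        unfolding pB \<psi>(2) by (rule continuous_on_subset[OF p'(1)])
    qed (rule p(1))
    have "(p' \<circ> \<psi> \<circ> p) ` ?Q = p' ` \<psi> ` p ` ?Q"
      by (simp only: image_comp comp_assoc)
    also have "\<dots> = frontier C" unfolding pB \<psi>(2) p'S ..
    finally show "(p' \<circ> \<psi> \<circ> p) ` ?Q = frontier C" .
    show "p' (0, -1) \<in> frontier C"
      unfolding p'S[symmetric] by (rule imageI) (simp add: norm_Pair)
    show "(p' \<circ> \<psi> \<circ> p) x = p' (0, -1)" if "x \<in> frontier ?Q" for x
    proof -
      have "p x \<in> frontier ?B" unfolding pq(2)[symmetric] using that by (rule imageI)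
      then have "p x \<in> sphere 0 1" by simp
      from \<psi>(3)[OF this] show ?thesis by simp
    qed
    show "x = y \<or> x \<in> frontier ?Q \<and> y \<in> frontier ?Q"
      if xy: "x \<in> ?Q" "y \<in> ?Q" "(p' \<circ> \<psi> \<circ> p) x = (p' \<circ> \<psi> \<circ> p) y" for x y
    proof -
      have "\<psi> (p x) = \<psi> (p y)"
        using xy(3) p'(2)[OF im[OF p(2)[OF xy(1)]]] p'(2)[OF im[OF p(2)[OF xy(2)]]]
        unfolding comp_apply by metis
      from \<psi>(4)[OF p(2)[OF xy(1)] p(2)[OF xy(2)] this] show ?thesis
        using fr[OF xy(1)] fr[OF xy(2)] p(3)[OF xy(1)] p(3)[OF xy(2)] by metis
    qed
  qed
  then show ?thesis by blast
qed

text \<open>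
  A sphere that is trivial as an element of the homotopy group bounds a ball: the homotopy to the
  constant cube, which is constant on the frontier of the cube, is a map on the cone on the sphere.
\<close>

lemma extend_if_null_homotopic:
  fixes C :: "('c::euclidean_space \<times> real) set" and \<psi> :: "'c \<Rightarrow> 'c \<times> real"
  assumes C: "convex C" "compact C" "interior C \<noteq> {}"
    and \<psi>: "collapses_cube \<psi> p (frontier C)"
    and null: "homotopic_with (\<lambda>k. \<forall>t \<in> frontier (cbox 0 One). k t = v) (top_of_set (cbox 0 One)) Z
       (F \<circ> \<psi>) (\<lambda>_. v)"
  shows "\<exists>E. continuous_map (top_of_set C) Z E \<and> (\<forall>x \<in> frontier C. E x = F x)"
proof -
  obtain h where h: "continuous_map (cylinder (top_of_set (cbox 0 One))) Z h"
    "\<And>x. h (0, x) = F (\<psi> x)" "\<And>x. h (1, x) = v"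
    "\<And>t x. t \<in> {0..1} \<Longrightarrow> x \<in> frontier (cbox 0 One) \<Longrightarrow> h (t, x) = v"
    using null unfolding homotopic_with_def by auto
  have cont: "continuous_on (cbox 0 One) \<psi>" and im: "\<psi> ` cbox 0 One = frontier C"
    using \<psi> unfolding collapses_cube_def by blast+
  have "h (t, x) = h (t, y)"
    if "t \<in> {0..1}" "x \<in> cbox 0 One" "y \<in> cbox 0 One" "\<psi> x = \<psi> y" for t x y
    using \<psi> h(4)[of t x] h(4)[of t y] that unfolding collapses_cube_def by metis
  from cone_extension[OF C compact_cbox cont im h(1,3) this]
  obtain E where E: "continuous_map (top_of_set C) Z E"
    "\<And>x. x \<in> cbox 0 One \<Longrightarrow> E (\<psi> x) = h (0, x)"
    by blast
  show ?thesis
  proof (intro exI[of _ E] conjI E(1) ballI)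
    fix x assume "x \<in> frontier C"
    then obtain w where "w \<in> cbox 0 One" "x = \<psi> w" unfolding im[symmetric] by blast
    then show "E x = F x" using E(2) h(2) by simp
  qed
qed

text \<open>
  A sphere that bounds a ball is contracted inside the ball to its base point \<open>p\<close> along straight
  lines; these keep \<open>p\<close> fixed, so the contraction is one of based cubes.
\<close>

lemma null_homotopic_if_extends:
  fixes C :: "('c::euclidean_space \<times> real) set" and \<psi> :: "'c \<Rightarrow> 'c \<times> real"
  assumes C: "convex C" "compact C"
    and collapse: "collapses_cube \<psi> p (frontier C)"
    and E: "continuous_map (top_of_set C) Z E"
  shows "homotopic_with (\<lambda>k. \<forall>t \<in> frontier (cbox 0 One). k t = E p) (top_of_set (cbox 0 One)) Z
       (E \<circ> \<psi>) (\<lambda>_. E p)"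
proof -
  have \<psi>: "continuous_on (cbox 0 One) \<psi>" "\<psi> ` cbox 0 One = frontier C"
    and p: "\<And>x. x \<in> frontier (cbox 0 One) \<Longrightarrow> \<psi> x = p" "p \<in> frontier C"
    using collapse unfolding collapses_cube_def by blast+
  \<comment> \<open>The straight-line contraction to \<open>p\<close>, applied to the collapsed cube.\<close>
  let ?k = "\<lambda>z. (1 - fst z) *\<^sub>R \<psi> (snd z) + fst z *\<^sub>R p"
  have fr: "frontier C \<subseteq> C" using C(2) by (simp add: compact_imp_closed frontier_subset_closed)
  have "continuous_map (cylinder (top_of_set (cbox 0 One))) (top_of_set C) ?k"
  proof -
    have "continuous_on ({0..1} \<times> cbox 0 One) ?k"
      by (intro continuous_intros continuous_on_compose2[OF \<psi>(1)]) auto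
    moreover have "?k z \<in> C" if "z \<in> {0..1} \<times> cbox 0 One" for z
      by (rule convexD_alt[OF C(1)]) (use that \<psi>(2) fr p(2) in auto)
    ultimately show ?thesis by (auto simp: prod_topology_subtopology_eu)
  qed
  from continuous_map_compose[OF this E]
  show ?thesis
    unfolding homotopic_with_def
    by (intro exI[of _ "E \<circ> ?k"]) (auto simp: p(1) scaleR_left_distrib[symmetric])
qed

text \<open>
  The cone on the frontier is filled in by the contraction of \<open>W\<close>, whose points may move in all of \<open>U\<close>;
  contractions of this kind exist near each point of a triangulated space.
\<close>

lemma extend_if_contractible:
  fixes C :: "'c::euclidean_space set"
  assumes C: "convex C" "compact C" "interior C \<noteq> {}"
    and c: "continuous_map (cylinder (subtopology X W)) X c" "\<And>x. x \<in> W \<Longrightarrow> c (0, x) = x"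
      "\<And>x. x \<in> W \<Longrightarrow> c (1, x) = y" "\<And>t x. t \<in> {0..1} \<Longrightarrow> x \<in> W \<Longrightarrow> c (t, x) \<in> U"
    and F: "continuous_map (top_of_set (frontier C)) X F" "F ` frontier C \<subseteq> W"
  shows "\<exists>E. continuous_map (top_of_set C) X E \<and> (\<forall>x \<in> frontier C. E x = F x) \<and> E ` C \<subseteq> U"
proof -
  have "continuous_map (top_of_set (frontier C)) (subtopology X W) F"
    using F by (auto simp: continuous_map_in_subtopology)
  from continuous_map_compose[OF cylinder_map[OF this] c(1)]
  have h: "continuous_map (cylinder (top_of_set (frontier C))) X (c \<circ> (\<lambda>z. (fst z, F (snd z))))" .
  let ?h = "c \<circ> (\<lambda>z. (fst z, F (snd z)))"
  have FW: "F x \<in> W" if "x \<in> frontier C" for x using that F(2) by blast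
  have const: "?h (1, x) = y" if "x \<in> frontier C" for x using c(3)[OF FW[OF that]] by simp
  have "?h (t, x) = ?h (t, x')" if "x = x'" for t x x' using that by simp
  from cone_extension[OF C compact_frontier[OF C(2)] continuous_on_id _ h const this]
  obtain E where E: "continuous_map (top_of_set C) X E"
    "\<And>x. x \<in> frontier C \<Longrightarrow> E x = ?h (0, x)" "E ` C = ?h ` ({0..1} \<times> frontier C)"
    by auto
  show ?thesis
  proof (intro exI[of _ E] conjI E(1) ballI)
    show "E x = F x" if "x \<in> frontier C" for x
      using E(2)[OF that] c(2)[OF FW[OF that]] by simp
    show "E ` C \<subseteq> U"
      unfolding E(3) using c(4) FW by auto
  qed
qed

section \<open>Moving points and short paths off a subset\<close>

text \<open>
  It suffices to clear one convex body of each dimension.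
\<close>

lemma clearable_convex:
  fixes C D :: "'c::euclidean_space set"
  assumes C: "convex C" "compact C" "interior C \<noteq> {}" and D: "convex D" "compact D" "interior D \<noteq> {}"
    and "clearable (top_of_set D) (frontier D) X Y P Q"
  shows "clearable (top_of_set C) (frontier C) X Y P Q"
proof -
  obtain p q where pq: "homeomorphic_maps (top_of_set C) (top_of_set D) p q" "p ` frontier C = frontier D"
    by (rule convex_compact_homeomorphic_frontier[OF C D])
  show ?thesis
  proof (rule clearable_homeomorphic[OF pq(1) _ pq(2) assms(7)])
    show "frontier C \<subseteq> topspace (top_of_set C)"
      using C(2) by (simp add: compact_imp_closed frontier_subset_closed)
  qed
qed

lemma clearable_trivial:
  assumes "P \<subseteq> Q" "P \<inter> Y = {}"
  shows "clearable M B X Y P Q"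
  unfolding clearable_def
proof (intro allI impI, elim conjE)
  fix g assume g: "continuous_map M X g" "\<forall>x \<in> topspace M. g x \<in> P"
  show "\<exists>G. clearing M B X Y Q g G"
    by (rule exI[of _ "g \<circ> snd"])
      (use g assms in \<open>auto intro: continuous_map_compose[OF continuous_map_snd]\<close>)
qed

lemma clearable_point:
  assumes tail: "\<And>y. y \<in> Y \<inter> U \<Longrightarrow> \<exists>\<gamma>. continuous_map (top_of_set {0..1::real}) X \<gamma> \<and> \<gamma> 0 = y \<and>
      \<gamma> ` {0..1} \<subseteq> U \<and> \<gamma> 1 \<notin> Y"
    and M: "topspace M = {p}"
  shows "clearable M {} X Y U U"
  unfolding clearable_def
proof (intro allI impI, elim conjE)
  fix g assume g: "continuous_map M X g" "\<forall>x \<in> topspace M. g x \<in> U"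
  have "\<exists>\<gamma>. continuous_map (top_of_set {0..1::real}) X \<gamma> \<and> \<gamma> 0 = g p \<and> \<gamma> ` {0..1} \<subseteq> U \<and> \<gamma> (1::real) \<notin> Y"
  proof (cases "g p \<in> Y")
    case True
    then show ?thesis using tail g(2) M by auto
  next
    case False
    moreover have "g p \<in> topspace X" using g(1) M by (auto simp: continuous_map_def)
    ultimately show ?thesis using g(2) M by (intro exI[of _ "\<lambda>_. g p"]) auto
  qed
  then obtain \<gamma> where \<gamma>: "continuous_map (top_of_set {0..1}) X \<gamma>" "\<gamma> 0 = g p" "\<gamma> ` {0..1} \<subseteq> U" "\<gamma> (1::real) \<notin> Y"
    by blast
  show "\<exists>G. clearing M {} X Y U g G"
    by (rule exI[of _ "\<gamma> \<circ> fst"])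
      (use \<gamma> M in \<open>auto intro: continuous_map_compose[OF continuous_map_fst]\<close>)
qed

lemma frontier_prism:
  fixes D :: "'c::euclidean_space set"
  assumes "compact D"
  shows "frontier (D \<times> {0..1::real}) = D \<times> {0, 1} \<union> frontier D \<times> {0..1}"
proof -
  have "closed D" using assms by (rule compact_imp_closed)
  then have "frontier (D \<times> {0..1::real}) = D \<times> {0..1} - interior D \<times> {0<..<1}"
    by (simp add: frontier_def closed_Times interior_Times)
  moreover have "interior D \<subseteq> D" by (rule interior_subset)
  ultimately show ?thesis using \<open>closed D\<close> by (auto simp: frontier_def)
qed

text \<open>
  Two maps that agree on the frontier of \<open>D\<close> form a map on the frontier of the prism over \<open>D\<close>. An
  extension of it over the prism is a homotopy relative to the frontier; this turns relative homotopies
  into extension problems for spheres.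
\<close>

lemma continuous_map_prism_boundary:
  fixes D :: "'c::euclidean_space set"
  assumes D: "compact D"
    and g: "continuous_map (top_of_set D) Z g" and g': "continuous_map (top_of_set D) Z g'"
    and eq: "\<And>x. x \<in> frontier D \<Longrightarrow> g' x = g x"
  shows "continuous_map (top_of_set (frontier (D \<times> {0..1::real}))) Z
           (\<lambda>z. if z \<in> D \<times> {1} then g' (fst z) else g (fst z))"
proof (rule continuous_map_glue_closed)
  let ?F = "frontier (D \<times> {0..1::real})"
  have sub: "frontier D \<subseteq> D" using D by (simp add: compact_imp_closed frontier_subset_closed)
  have fst: "continuous_map (top_of_set T) (top_of_set D) fst" if "T \<subseteq> D \<times> UNIV" for T :: "('c \<times> real) set"
    using that by (auto intro!: continuous_intros)
  have cl: "closed (D \<times> {1::real})" "closed (D \<times> {0} \<union> frontier D \<times> {0..1::real})"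
    using compact_imp_closed[OF D] by (simp_all add: closed_Times closed_Un)
  show "closedin (top_of_set ?F) (D \<times> {1})"
    by (rule closed_subset[OF _ cl(1)]) (auto simp: frontier_prism[OF D])
  show "closedin (top_of_set ?F) (D \<times> {0} \<union> frontier D \<times> {0..1})"
    by (rule closed_subset[OF _ cl(2)]) (auto simp: frontier_prism[OF D])
  show "topspace (top_of_set ?F) \<subseteq> D \<times> {1} \<union> (D \<times> {0} \<union> frontier D \<times> {0..1})"
    by (auto simp: frontier_prism[OF D])
  show "continuous_map (subtopology (top_of_set ?F) (D \<times> {1})) Z (\<lambda>z. g' (fst z))"
    unfolding subtopology_subtopology
    by (rule continuous_map_compose[OF fst g', unfolded o_def]) blast
  show "continuous_map (subtopology (top_of_set ?F) (D \<times> {0} \<union> frontier D \<times> {0..1})) Z (\<lambda>z. g (fst z))"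
    unfolding subtopology_subtopology
    by (rule continuous_map_compose[OF fst g, unfolded o_def]) (use sub in blast)
qed (use eq in auto)

lemma clearing_from_prism:
  fixes D :: "'c::euclidean_space set"
  assumes D: "compact D" and E: "continuous_map (top_of_set (D \<times> {0..1::real})) X E" "E ` (D \<times> {0..1}) \<subseteq> Q"
    and eq: "\<And>x. x \<in> frontier D \<Longrightarrow> g' x = g x"
    and g': "\<And>x. x \<in> D \<Longrightarrow> g' x \<notin> Y"
    and EF: "\<And>z. z \<in> frontier (D \<times> {0..1}) \<Longrightarrow> E z = (if z \<in> D \<times> {1} then g' (fst z) else g (fst z))"
  shows "\<exists>G. clearing (top_of_set D) (frontier D) X Y Q g G"
proof (intro exI[of _ "E \<circ> prod.swap"] conjI ballI)
  have sub: "frontier D \<subseteq> D" using D by (simp add: compact_imp_closed frontier_subset_closed)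
  have "continuous_map (cylinder (top_of_set D)) (top_of_set (D \<times> {0..1::real})) prod.swap"
    by (auto intro!: continuous_on_swap)
  then show "continuous_map (cylinder (top_of_set D)) X (E \<circ> prod.swap)"
    by (rule continuous_map_compose[OF _ E(1)])
  show "(E \<circ> prod.swap) (0, x) = g x" "(E \<circ> prod.swap) (1, x) \<notin> Y" if "x \<in> topspace (top_of_set D)" for x
    using that g' EF[of "(x, 0)"] EF[of "(x, 1)"] by (auto simp: frontier_prism[OF D])
  show "(E \<circ> prod.swap) (t, x) \<in> Q" if "t \<in> {0..1}" "x \<in> topspace (top_of_set D)" for t x
    using that E(2) by auto
  show "(E \<circ> prod.swap) (t, x) = g x" if "t \<in> {0..1}" "x \<in> frontier D" for t x
    using that EF[of "(x, t)"] eq[of x] sub by (auto simp: frontier_prism[OF D])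
qed

lemma prism_convex:
  fixes D :: "'c::euclidean_space set"
  assumes "convex D" "compact D" "interior D \<noteq> {}"
  shows "convex (D \<times> {0..1::real})" "compact (D \<times> {0..1::real})" "interior (D \<times> {0..1::real}) \<noteq> {}"
  using assms by (auto simp: convex_Times compact_Times interior_Times)

lemma frontier_unit_interval: "frontier {0..1::real} = {0, 1}"
  by (auto simp: frontier_def)

text \<open>
  The path is replaced by one off \<open>Y\<close> with the same ends, which exists because \<open>V - Y\<close> is path
  connected. Together they form a circle in \<open>W\<close>, and it bounds because \<open>W\<close> contracts inside \<open>U\<close>.
\<close>

lemma clearable_interval_if_contractible:
  assumes c: "continuous_map (cylinder (subtopology X W)) X c" "\<And>x. x \<in> W \<Longrightarrow> c (0, x) = x"
      "\<And>x. x \<in> W \<Longrightarrow> c (1, x) = y" "\<And>t x. t \<in> {0..1} \<Longrightarrow> x \<in> W \<Longrightarrow> c (t, x) \<in> U"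
    and V: "V \<subseteq> W" "path_connectedin X (V - Y)"
  shows "clearable (top_of_set {0..1::real}) (frontier {0..1}) X Y V U"
  unfolding clearable_def
proof (intro allI impI, elim conjE)
  fix g :: "real \<Rightarrow> 'a"
  assume g: "continuous_map (top_of_set {0..1}) X g"
    "\<forall>x \<in> topspace (top_of_set {0..1}). g x \<in> V" "\<forall>x \<in> frontier {0..1}. g x \<notin> Y"
  have "g 0 \<in> V - Y" "g 1 \<in> V - Y" using g by (auto simp: frontier_unit_interval)
  then obtain k where k: "pathin X k" "k ` {0..1} \<subseteq> V - Y" "k 0 = g 0" "k 1 = g 1"
    using V(2) unfolding path_connectedin by blast
  let ?I = "{0..1::real}"
  have kV: "k x \<in> V - Y" if "x \<in> ?I" for x using k(2) that by blast
  have I: "convex ?I" "compact ?I" "interior ?I \<noteq> {}" by auto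
  have eq: "k x = g x" if "x \<in> frontier ?I" for x
    using that k by (auto simp: frontier_unit_interval)
  let ?F = "\<lambda>z. if z \<in> ?I \<times> {1} then k (fst z) else g (fst z)"
  have F: "continuous_map (top_of_set (frontier (?I \<times> ?I))) X ?F"
    by (rule continuous_map_prism_boundary[OF I(2) g(1) _ eq]) (use k in \<open>simp add: pathin_def\<close>)
  have FW: "?F ` frontier (?I \<times> ?I) \<subseteq> W"
  proof (rule image_subsetI)
    fix z assume "z \<in> frontier (?I \<times> ?I)"
    then have "fst z \<in> ?I" by (auto simp: frontier_prism[OF I(2)] frontier_unit_interval)
    then have "g (fst z) \<in> W" "k (fst z) \<in> W" using g(2) kV V(1) by auto
    then show "?F z \<in> W" by simp
  qed
  from extend_if_contractible[OF prism_convex[OF I] c F FW]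
  obtain E where E: "continuous_map (top_of_set (?I \<times> ?I)) X E"
    "\<And>z. z \<in> frontier (?I \<times> ?I) \<Longrightarrow> E z = ?F z" "E ` (?I \<times> ?I) \<subseteq> U"
    by blast
  show "\<exists>G. clearing (top_of_set ?I) (frontier ?I) X Y U g G"
  proof (rule clearing_from_prism[OF I(2) E(1,3) eq _ E(2)])
    show "k x \<notin> Y" if "x \<in> ?I" for x using kV[OF that] by blast
  qed
qed

section \<open>Homotopy classes of cubes\<close>

lemma cube_class_refl:
  assumes "g \<in> based_cubes X v"
  shows "g \<in> cube_class X v g"
  using assms unfolding based_cubes_def cube_class_def by (simp add: homotopic_with_refl)

text \<open>
  Homotopy relative to the frontier is an equivalence relation on based cubes.
\<close>

lemma cube_class_eq_iff:
  fixes g g' :: "'c::euclidean_space \<Rightarrow> 'a"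
  assumes "g' \<in> based_cubes X v"
  shows "cube_class X v g = cube_class X v g' \<longleftrightarrow> g' \<in> cube_class X v g"
proof
  assume "cube_class X v g = cube_class X v g'"
  then show "g' \<in> cube_class X v g" using cube_class_refl[OF assms] by simp
next
  assume "g' \<in> cube_class X v g"
  then have h: "homotopic_with (\<lambda>k. \<forall>t \<in> frontier (cbox 0 One). k t = v) (top_of_set (cbox 0 One)) X g g'"
    by (simp add: cube_class_def)
  then show "cube_class X v g = cube_class X v g'"
    unfolding cube_class_def by (auto intro: homotopic_with_trans homotopic_with_symD)
qed

lemma const_based_cube: "v \<in> topspace X \<Longrightarrow> (\<lambda>_. v) \<in> based_cubes X v"
  by (simp add: based_cubes_def)

lemma cube_class_subtopology_mono:
  assumes "A \<subseteq> B" "g \<in> cube_class (subtopology X A) v f"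
  shows "g \<in> cube_class (subtopology X B) v f"
proof -
  have "continuous_map M (subtopology X A) k \<Longrightarrow> continuous_map M (subtopology X B) k" for M k
    using \<open>A \<subseteq> B\<close> by (simp add: continuous_map_in_subtopology) blast
  then show ?thesis
    using assms(2) unfolding cube_class_def homotopic_with_def mem_Collect_eq by blast
qed

lemma pi2_trivialD:
  fixes g :: "real \<times> real \<Rightarrow> 'a"
  assumes "carrier (pi2 X v) = {\<one>\<^bsub>pi2 X v\<^esub>}" "g \<in> based_cubes X v" "v \<in> topspace X"
  shows "(\<lambda>_. v) \<in> cube_class X v g"
proof -
  have "cube_class X v g = cube_class X v (\<lambda>_. v)"
  proof -
    have "cube_class X v g \<in> carrier (pi2 X v)"
      using assms(2) by (simp add: pi2_def)
    then have "cube_class X v g = \<one>\<^bsub>pi2 X v\<^esub>" unfolding assms(1) by simp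
    then show ?thesis by (simp add: pi2_def)
  qed
  then show ?thesis
    using cube_class_eq_iff[OF const_based_cube[OF assms(3)]] by blast
qed

text \<open>
  The induced map sends the class of a loop to the class of the same loop in the larger space, so
  injectivity applied to the loop and to the constant loop gives the claim.
\<close>

lemma pi1_injectiveD:
  fixes g :: "real \<Rightarrow> 'a"
  assumes inj: "inj_on (pi1_map v (subtopology X B) id) (carrier (pi1 (subtopology X A) v))"
    and "A \<subseteq> B" "v \<in> topspace (subtopology X A)" and g: "g \<in> based_cubes (subtopology X A) v"
    and null: "(\<lambda>_. v) \<in> cube_class (subtopology X B) v g"
  shows "(\<lambda>_. v) \<in> cube_class (subtopology X A) v g"
proof -
  let ?A = "subtopology X A" and ?B = "subtopology X B"
  have sub: "based_cubes ?A v \<subseteq> (based_cubes ?B v :: (real \<Rightarrow> 'a) set)"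
    using \<open>A \<subseteq> B\<close> unfolding based_cubes_def by (auto simp: continuous_map_in_subtopology)
  have map: "pi1_map v ?B id (cube_class ?A v k) = cube_class ?B v k"
    if k: "k \<in> based_cubes ?A v" for k :: "real \<Rightarrow> 'a"
  proof -
    have "cube_class ?B v k' = cube_class ?B v k" if "k' \<in> cube_class ?A v k" for k'
    proof -
      have "k' \<in> cube_class ?B v k" using cube_class_subtopology_mono[OF \<open>A \<subseteq> B\<close> that] .
      then have "k \<in> cube_class ?B v k'" by (simp add: cube_class_def homotopic_with_symD)
      then show ?thesis using cube_class_eq_iff[of k ?B v k'] k sub by blast
    qed
    moreover have "k \<in> cube_class ?A v k" by (rule cube_class_refl[OF k])
    ultimately show ?thesis unfolding pi1_map_def id_apply id_comp by blast
  qed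
  have const: "(\<lambda>_. v) \<in> based_cubes ?A v" using assms(3) by (rule const_based_cube)
  have "cube_class ?B v g = cube_class ?B v (\<lambda>_. v)"
    using cube_class_eq_iff[of "\<lambda>_. v" ?B v g] null const sub by blast
  then have "pi1_map v ?B id (cube_class ?A v g) = pi1_map v ?B id (cube_class ?A v (\<lambda>_. v))"
    using map[OF g] map[OF const] by simp
  then have "cube_class ?A v g = cube_class ?A v (\<lambda>_. v)"
    by (rule inj_onD[OF inj]) (use g const in \<open>auto simp: pi1_def\<close>)
  then show ?thesis using cube_class_eq_iff[OF const] by blast
qed

section \<open>Moving disks off a subset\<close>

text \<open>
  This is where the hypotheses on homotopy groups enter. The boundary of the disk is a loop in \<open>V - Y\<close>
  that bounds a disk in \<open>V\<close>. By injectivity on fundamental groups it also bounds a disk \<open>g'\<close> in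
  \<open>V - Y\<close>. The two disks form a 2-sphere in \<open>V\<close>, which bounds because the second homotopy group
  vanishes; a filling of the sphere is a homotopy from \<open>g\<close> to \<open>g'\<close> relative to the boundary.
\<close>

lemma clearable_disk:
  fixes D :: "(real \<times> real) set"
  assumes D: "convex D" "compact D" "interior D \<noteq> {}"
    and pi2: "\<And>v. v \<in> V \<Longrightarrow> carrier (pi2 (subtopology X V) v) = {\<one>\<^bsub>pi2 (subtopology X V) v\<^esub>}"
    and pi1: "\<And>v. v \<in> V - Y \<Longrightarrow>
      inj_on (pi1_map v (subtopology X V) id) (carrier (pi1 (subtopology X (V - Y)) v))"
    and V: "V \<subseteq> topspace X"
  shows "clearable (top_of_set D) (frontier D) X Y V V"
  unfolding clearable_def
proof (intro allI impI, elim conjE)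
  fix g :: "real \<times> real \<Rightarrow> 'a"
  assume g: "continuous_map (top_of_set D) X g"
    "\<forall>x \<in> topspace (top_of_set D). g x \<in> V" "\<forall>x \<in> frontier D. g x \<notin> Y"
  let ?V = "subtopology X V" and ?W = "subtopology X (V - Y)"
  have sub: "frontier D \<subseteq> D" using D by (simp add: compact_imp_closed frontier_subset_closed)
  have gV: "continuous_map (top_of_set D) ?V g"
    using g by (auto simp: continuous_map_in_subtopology)
  from cube_collapse[OF D] obtain \<psi> :: "real \<Rightarrow> real \<times> real" and p
    where collapse: "collapses_cube \<psi> p (frontier D)" by blast
  then have \<psi>: "continuous_on (cbox 0 One) \<psi>" "\<psi> ` cbox 0 One = frontier D"
    "\<And>x. x \<in> frontier (cbox 0 One) \<Longrightarrow> \<psi> x = p" and p: "p \<in> frontier D"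
    unfolding collapses_cube_def by blast+
  have v: "g p \<in> V - Y" using p g sub by auto
  have "(\<lambda>_. g p) \<in> cube_class ?V (g p) (g \<circ> \<psi>)"
    using null_homotopic_if_extends[OF D(1,2) collapse gV] by (simp add: cube_class_def)
  moreover have "g \<circ> \<psi> \<in> based_cubes ?W (g p)"
  proof -
    have "continuous_map (top_of_set (cbox 0 One)) (top_of_set (frontier D)) \<psi>"
      using \<psi>(1,2) by auto
    moreover have "continuous_map (top_of_set (frontier D)) ?W g"
      using g sub continuous_map_from_subtopology_mono[OF g(1) sub] by (auto simp: continuous_map_in_subtopology)
    ultimately have "continuous_map (top_of_set (cbox 0 One)) ?W (g \<circ> \<psi>)"
      by (rule continuous_map_compose)
    then show ?thesis using \<psi>(3) by (simp add: based_cubes_def)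
  qed
  ultimately have "(\<lambda>_. g p) \<in> cube_class ?W (g p) (g \<circ> \<psi>)"
    using v V by (intro pi1_injectiveD[OF pi1[OF v]]) auto
  then have "homotopic_with (\<lambda>k. \<forall>t \<in> frontier (cbox 0 One). k t = g p) (top_of_set (cbox 0 One)) ?W (g \<circ> \<psi>) (\<lambda>_. g p)"
    by (simp add: cube_class_def)
  from extend_if_null_homotopic[OF D collapse this]
  obtain g' where g': "continuous_map (top_of_set D) ?W g'" and eq: "\<And>x. x \<in> frontier D \<Longrightarrow> g' x = g x"
    by blast
  let ?C = "D \<times> {0..1::real}"
  let ?F = "\<lambda>z. if z \<in> D \<times> {1} then g' (fst z) else g (fst z)"
  have "continuous_map (top_of_set D) ?V g'"
    using g' by (auto simp: continuous_map_in_subtopology)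
  from continuous_map_prism_boundary[OF D(2) gV this eq]
  have F: "continuous_map (top_of_set (frontier ?C)) ?V ?F" .
  from cube_collapse[OF prism_convex[OF D]] obtain \<phi> :: "real \<times> real \<Rightarrow> (real \<times> real) \<times> real" and q
    where collapse': "collapses_cube \<phi> q (frontier ?C)" by blast
  then have \<phi>: "continuous_on (cbox 0 One) \<phi>" "\<phi> ` cbox 0 One = frontier ?C"
    "\<And>x. x \<in> frontier (cbox 0 One) \<Longrightarrow> \<phi> x = q" and q: "q \<in> frontier ?C"
    unfolding collapses_cube_def by blast+
  have "continuous_map (top_of_set (cbox 0 One)) (top_of_set (frontier ?C)) \<phi>"
    using \<phi>(1,2) by auto
  from continuous_map_compose[OF this F] \<phi>(3)
  have "?F \<circ> \<phi> \<in> based_cubes ?V (?F q)"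
    by (simp add: based_cubes_def)
  moreover have Fq: "?F q \<in> topspace ?V"
    by (rule funcset_mem[OF continuous_map_funspace[OF F]]) (use q in simp)
  moreover have "carrier (pi2 ?V (?F q)) = {\<one>\<^bsub>pi2 ?V (?F q)\<^esub>}"
    by (rule pi2) (use Fq in simp)
  ultimately have "(\<lambda>_. ?F q) \<in> cube_class ?V (?F q) (?F \<circ> \<phi>)"
    by (intro pi2_trivialD)
  then have "homotopic_with (\<lambda>k. \<forall>t \<in> frontier (cbox 0 One). k t = ?F q) (top_of_set (cbox 0 One)) ?V
      (?F \<circ> \<phi>) (\<lambda>_. ?F q)"
    unfolding cube_class_def by blast
  from extend_if_null_homotopic[OF prism_convex[OF D] collapse' this]
  obtain E where E: "continuous_map (top_of_set ?C) ?V E" "\<And>z. z \<in> frontier ?C \<Longrightarrow> E z = ?F z"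
    by blast
  show "\<exists>G. clearing (top_of_set D) (frontier D) X Y V g G"
  proof (rule clearing_from_prism[OF D(2) _ _ eq _ E(2)])
    show "continuous_map (top_of_set ?C) X E" "E ` ?C \<subseteq> V"
      using E(1) by (auto simp: continuous_map_in_subtopology)
    show "g' x \<notin> Y" if "x \<in> D" for x
      using g' that by (auto simp: continuous_map_in_subtopology)
  qed
qed

section \<open>Subdividing intervals and squares\<close>

text \<open>
  This is the Lebesgue number of the cover of the compact set \<open>S\<close> by preimages of suitable open sets.
\<close>

lemma fine_pieces:
  fixes g :: "'c::euclidean_space \<Rightarrow> 'a"
  assumes g: "continuous_map (top_of_set S) X g" and S: "compact S"
    and ex: "\<And>x. x \<in> topspace X \<Longrightarrow> \<exists>V. openin X V \<and> x \<in> V \<and> R V"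
  shows "\<exists>\<delta>>0. \<forall>T. T \<subseteq> S \<longrightarrow> T \<noteq> {} \<longrightarrow> diameter T < \<delta> \<longrightarrow> (\<exists>V. openin X V \<and> R V \<and> g ` T \<subseteq> V)"
proof (cases "S = {}")
  case True
  then show ?thesis by (intro exI[of _ 1]) auto
next
  case False
  let ?C = "{B. open B \<and> (\<exists>V. openin X V \<and> R V \<and> g ` (S \<inter> B) \<subseteq> V)}"
  have cov: "\<exists>B \<in> ?C. x \<in> B" if "x \<in> S" for x
  proof -
    have "g x \<in> topspace X" using g that by (auto simp: continuous_map_def)
    then obtain V where V: "openin X V" "g x \<in> V" "R V" using ex by blast
    have "openin (top_of_set S) {y \<in> topspace (top_of_set S). g y \<in> V}"
      using g V(1) by (rule openin_continuous_map_preimage)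
    then obtain B where "open B" "{y \<in> topspace (top_of_set S). g y \<in> V} = S \<inter> B"
      unfolding openin_open by blast
    then have "open B" "x \<in> B" "g ` (S \<inter> B) \<subseteq> V" using that V(2) by auto
    then show ?thesis using V by blast
  qed
  obtain \<delta> where \<delta>: "0 < \<delta>" "\<And>T. T \<subseteq> S \<Longrightarrow> diameter T < \<delta> \<Longrightarrow> \<exists>B \<in> ?C. T \<subseteq> B"
  proof (rule Lebesgue_number_lemma[OF S, of ?C])
    from False obtain x where "x \<in> S" by blast
    from cov[OF this] show "?C \<noteq> {}" by blast
    show "S \<subseteq> \<Union>?C"
    proof
      fix x assume "x \<in> S"
      from cov[OF this] show "x \<in> \<Union>?C" by blast
    qed
  qed blast+
  show ?thesis
  proof (intro exI[of _ \<delta>] conjI \<delta>(1) allI impI)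
    fix T assume "T \<subseteq> S" "diameter T < \<delta>"
    then obtain B V where "T \<subseteq> B" "openin X V" "R V" "g ` (S \<inter> B) \<subseteq> V" using \<delta>(2)[of T] by blast
    then show "\<exists>V. openin X V \<and> R V \<and> g ` T \<subseteq> V" using \<open>T \<subseteq> S\<close> by blast
  qed
qed

definition grid :: "nat \<Rightarrow> real set" where
  "grid N = (\<lambda>i. real i / real N) ` {..N}"

definition grid_interval :: "nat \<Rightarrow> nat \<Rightarrow> real set" where
  "grid_interval N i = {real i / real N..real (Suc i) / real N}"

lemma grid_interval_facts:
  assumes "i < N"
  shows "real i / real N < real (Suc i) / real N" "0 \<le> real i / real N" "real (Suc i) / real N \<le> 1"
    "real i / real N \<in> grid N" "real (Suc i) / real N \<in> grid N"
  using assms by (auto simp: grid_def divide_strict_right_mono simp del: of_nat_Suc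
      intro: image_eqI[of _ _ i] image_eqI[of _ _ "Suc i"])

lemma grid_interval_Int_grid:
  assumes "i < N"
  shows "grid_interval N i \<inter> grid N = {real i / real N, real (Suc i) / real N}"
proof -
  have "j = i \<or> j = Suc i" if "real j / real N \<in> grid_interval N i" for j
  proof -
    have "real i \<le> real j" "real j \<le> real (Suc i)"
      using that assms by (auto simp: grid_interval_def divide_le_cancel)
    then show ?thesis by auto
  qed
  then have "grid_interval N i \<inter> grid N \<subseteq> {real i / real N, real (Suc i) / real N}"
    unfolding grid_def by blast
  moreover have "real i / real N \<in> grid_interval N i" "real (Suc i) / real N \<in> grid_interval N i"
    using grid_interval_facts(1)[OF assms] by (simp_all add: grid_interval_def)
  ultimately show ?thesis
    using grid_interval_facts(4,5)[OF assms] by blast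
qed

text \<open>
  A point off the grid lies in just one grid interval. Through this lemma the constraint imposed at an
  interior point of a cell is exactly the constraint of that cell.
\<close>

lemma grid_interval_disjoint:
  assumes "i < N" "j < N" "x \<in> grid_interval N i" "x \<in> grid_interval N j" "x \<notin> grid N"
  shows "i = j"
proof -
  have False if ij: "i < j" "i < N" "j < N" "x \<in> grid_interval N i" "x \<in> grid_interval N j" for i j
  proof -
    have "real (Suc i) / real N \<le> real j / real N" using ij by (simp add: divide_right_mono)
    then have "x = real j / real N" using ij unfolding grid_interval_def by auto
    then show False using assms(5) grid_interval_facts(4)[OF ij(3)] by simp
  qed
  then show ?thesis using assms by (metis linorder_neqE_nat)
qed

lemma grid_interval_cover:
  assumes "N > 0" "x \<in> {0..1}"
  shows "\<exists>i<N. x \<in> grid_interval N i"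
proof (cases "x = 1")
  case True
  then show ?thesis using assms by (intro exI[of _ "N - 1"]) (auto simp: grid_interval_def)
next
  case False
  define i where "i = nat \<lfloor>x * N\<rfloor>"
  have i: "real i \<le> x * N" "x * N < real i + 1"
    using assms by (auto simp: i_def)
  moreover have "x * N < N" using assms False by simp
  ultimately have "real i < real N" by linarith
  then have "i < N" "real i / N \<le> x" "x \<le> real (Suc i) / N" using i assms by (auto simp: field_simps)
  then show ?thesis unfolding grid_interval_def by (intro exI[of _ i]) auto
qed

lemma grid_interval_subset: "i < N \<Longrightarrow> grid_interval N i \<subseteq> {0..1}"
  using grid_interval_facts[of i N] unfolding grid_interval_def by auto

lemma grid_subset: "grid N \<subseteq> {0..1}"
  by (auto simp: grid_def divide_le_eq_1)

lemma grid_interval_convex: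
  assumes "i < N"
  shows "convex (grid_interval N i)" "compact (grid_interval N i)" "interior (grid_interval N i) \<noteq> {}"
    "frontier (grid_interval N i) = {real i / real N, real (Suc i) / real N}"
  using grid_interval_facts(1)[OF assms] by (auto simp: grid_interval_def frontier_def)

lemma grid_interval_dist:
  assumes "i < N" "x \<in> grid_interval N i" "y \<in> grid_interval N i"
  shows "\<bar>x - y\<bar> \<le> 1 / N"
proof -
  have "real (Suc i) / N = real i / N + 1 / N" by (simp add: add_divide_distrib)
  then show ?thesis using assms unfolding grid_interval_def by auto
qed

lemma zero_one_in_grid: "N > 0 \<Longrightarrow> 0 \<in> grid N" "N > 0 \<Longrightarrow> 1 \<in> grid N"
  unfolding grid_def by (auto intro: image_eqI[of _ _ 0] image_eqI[of _ _ N])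

lemma cleared_on_boundary:
  assumes f: "continuous_map Z X f" and A: "A \<subseteq> topspace Z" and "\<And>x. x \<in> A \<Longrightarrow> f x \<notin> Y"
    and "\<And>x. x \<in> A \<Longrightarrow> f x \<in> D x"
  shows "cleared_on Z X Y f D A"
  unfolding cleared_on_def
  by (rule exI[of _ "f \<circ> snd"])
    (use assms in \<open>auto intro: continuous_map_compose[OF continuous_map_snd] continuous_map_from_subtopology\<close>)

lemma clearable_from_cleared_on:
  assumes "\<And>g. continuous_map M X g \<Longrightarrow> (\<And>x. x \<in> topspace M \<Longrightarrow> g x \<in> P) \<Longrightarrow> (\<And>x. x \<in> B \<Longrightarrow> g x \<notin> Y) \<Longrightarrow>
    \<exists>D. cleared_on M X Y g D (topspace M) \<and> (\<forall>x \<in> topspace M. D x \<subseteq> Q) \<and> (\<forall>x \<in> B. D x \<subseteq> {g x})"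
    and B: "B \<subseteq> topspace M"
  shows "clearable M B X Y P Q"
  unfolding clearable_def
proof (intro allI impI, elim conjE)
  fix g assume g: "continuous_map M X g" and gP: "\<forall>x \<in> topspace M. g x \<in> P" and gY: "\<forall>x \<in> B. g x \<notin> Y"
  have "\<exists>D. cleared_on M X Y g D (topspace M) \<and> (\<forall>x \<in> topspace M. D x \<subseteq> Q) \<and> (\<forall>x \<in> B. D x \<subseteq> {g x})"
    by (rule assms(1)[OF g]) (use gP gY in blast)+
  then obtain D where "cleared_on M X Y g D (topspace M)"
    and D: "\<And>x. x \<in> topspace M \<Longrightarrow> D x \<subseteq> Q" "\<And>x. x \<in> B \<Longrightarrow> D x \<subseteq> {g x}"
    by blast
  then obtain H where H: "continuous_map (cylinder M) X H"
    "\<forall>x \<in> topspace M. H (0, x) = g x \<and> H (1, x) \<notin> Y"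
    and HD: "\<And>t x. t \<in> {0..1} \<Longrightarrow> x \<in> topspace M \<Longrightarrow> H (t, x) \<in> D x"
    unfolding cleared_on_def subtopology_topspace by blast
  have "H (t, x) = g x" if "t \<in> {0..1}" "x \<in> B" for t x
    using HD[OF that(1)] D(2)[OF that(2)] that(2) B by blast
  moreover have "H (t, x) \<in> Q" if "t \<in> {0..1}" "x \<in> topspace M" for t x
    using HD[OF that] D(1)[OF that(2)] by blast
  ultimately show "\<exists>G. clearing M B X Y Q g G"
    using H by (intro exI[of _ H]) blast
qed

lemma openin_Inter_finite_family:
  assumes "finite K" "\<And>k. k \<in> K \<Longrightarrow> openin X (V k)"
  shows "openin X (topspace X \<inter> (\<Inter>k\<in>K. V k))"
  using assms
proof (induction K)
  case (insert k K)
  have "topspace X \<inter> (\<Inter>j\<in>insert k K. V j) = V k \<inter> (topspace X \<inter> (\<Inter>j\<in>K. V j))" by auto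
  then show ?case using insert by (simp add: openin_Int)
qed simp

text \<open>
  The interval is cut into pieces so short that each runs in a set \<open>V i\<close> in which paths can be moved off
  \<open>Y\<close> inside \<open>U\<close>. The inner division points are moved first. Each must stay in \<open>V i\<close> for both
  adjacent pieces, so that these pieces, dragged along, still run in \<open>V i\<close> when their turn comes.
\<close>

lemma clearable_interval:
  assumes point: "\<And>U (M :: real topology) p. openin X U \<Longrightarrow> topspace M = {p} \<Longrightarrow> clearable M {} X Y U U"
    and small: "\<And>U y. openin X U \<Longrightarrow> y \<in> U \<Longrightarrow>
      \<exists>V. openin X V \<and> y \<in> V \<and> V \<subseteq> U \<and> clearable (top_of_set {0..1::real}) (frontier {0..1}) X Y V U"
    and U: "openin X U"
  shows "clearable (top_of_set {0..1::real}) (frontier {0..1}) X Y U U"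
proof (rule clearable_from_cleared_on)
  let ?I = "{0..1::real}"
  let ?Z = "top_of_set ?I"
  show "frontier ?I \<subseteq> topspace ?Z" by (simp add: frontier_unit_interval)
  fix g :: "real \<Rightarrow> 'a"
  assume g: "continuous_map ?Z X g" and gU: "\<And>x. x \<in> topspace ?Z \<Longrightarrow> g x \<in> U"
    and gY: "\<And>x. x \<in> frontier ?I \<Longrightarrow> g x \<notin> Y"
  have gU': "continuous_map ?Z (subtopology X U) g"
    using g gU by (auto simp: continuous_map_in_subtopology)
  let ?R = "\<lambda>V. openin X V \<and> V \<subseteq> U \<and> clearable ?Z (frontier ?I) X Y V U"
  have cover: "\<exists>V. openin (subtopology X U) V \<and> y \<in> V \<and> ?R V" if "y \<in> topspace (subtopology X U)" for y
  proof -
    have "y \<in> U" using that by simp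
    from small[OF U this] show ?thesis
      by (elim exE conjE) (intro exI conjI; simp add: openin_open_subtopology[OF U])
  qed
  have "\<exists>\<delta>>0. \<forall>T. T \<subseteq> ?I \<longrightarrow> T \<noteq> {} \<longrightarrow> diameter T < \<delta> \<longrightarrow>
      (\<exists>V. openin (subtopology X U) V \<and> ?R V \<and> g ` T \<subseteq> V)"
    by (rule fine_pieces[OF gU' compact_Icc cover])
  then obtain \<delta> where \<delta>: "\<delta> > 0" and pieces: "\<forall>T. T \<subseteq> ?I \<longrightarrow> T \<noteq> {} \<longrightarrow> diameter T < \<delta> \<longrightarrow>
      (\<exists>V. openin (subtopology X U) V \<and> ?R V \<and> g ` T \<subseteq> V)"
    by (elim exE conjE) (rule that)
  obtain N :: nat where N: "N > 0" "1 / N < \<delta>"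
    using \<delta> by (metis inverse_eq_divide reals_Archimedean zero_less_Suc)
  let ?J = "grid_interval N"
  have "\<exists>V. ?R V \<and> g ` ?J i \<subseteq> V" if "i < N" for i
  proof -
    have "?J i \<subseteq> ?I" by (rule grid_interval_subset[OF that])
    moreover have "?J i \<noteq> {}" using grid_interval_convex(3)[OF that] by auto
    moreover have "diameter (?J i) \<le> 1 / N"
      using grid_interval_dist[OF that] by (intro diameter_le) auto
    then have "diameter (?J i) < \<delta>" using N(2) by linarith
    ultimately show ?thesis using pieces by meson
  qed
  then obtain V where V: "\<And>i. i < N \<Longrightarrow> ?R (V i)" and gV: "\<And>i. i < N \<Longrightarrow> g ` ?J i \<subseteq> V i"
    by metis
  define W where "W = (\<lambda>x. topspace X \<inter> (\<Inter>i\<in>{i. i < N \<and> x \<in> ?J i}. V i))"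
  have openO: "openin X (W x)" for x
    unfolding W_def by (rule openin_Inter_finite_family) (use V in auto)
  have gO: "g x \<in> W x" if "x \<in> ?I" for x
    using gV that g unfolding W_def by (auto simp: continuous_map_def)
  have OV: "W x \<subseteq> V i" if "i < N" "x \<in> ?J i" for x i
    using that unfolding W_def by blast
  \<comment> \<open>The ends rest, an inner division point stays in \<open>V i\<close> for both adjacent pieces, all other points stay in \<open>U\<close>.\<close>
  define D where "D = (\<lambda>x. if x \<in> {0,1} then {g x} else if x \<in> grid N then W x else U)"
  have DV: "D x \<subseteq> V i" if "i < N" "x \<in> ?J i" "x \<in> grid N" for x i
    using OV[OF that(1,2)] gV[OF that(1)] that(2,3) unfolding D_def by auto
  have DU: "D x \<subseteq> U" if "x \<in> ?I" for x
  proof -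
    from grid_interval_cover[OF N(1) that] obtain i where "i < N" "x \<in> ?J i" by blast
    then show ?thesis using V[of i] OV[of i x] gU[of x] that unfolding D_def by auto
  qed
  have 0: "cleared_on ?Z X Y g D {0,1}"
    by (rule cleared_on_boundary[OF g]) (use gY in \<open>auto simp: D_def frontier_unit_interval\<close>)
  have "cleared_on ?Z X Y g D ({0,1} \<union> (\<Union>x\<in>grid N - {0,1}. {x}))"
  proof (rule cleared_on_insert_cells[OF g _ _ 0, where P = W and Q = W])
    show "closedin ?Z {0,1}" by (intro closed_subset) auto
    show "finite (grid N - {0,1})" by (simp add: grid_def)
    fix x assume x: "x \<in> grid N - {0,1}"
    then have xI: "x \<in> ?I" using grid_subset by blast
    have e: "{x} \<inter> {0,1} = {}" using x by auto
    show "closedin ?Z {x}" using xI by (intro closed_subset) auto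
    show "cylinder_retracts (subtopology ?Z {x}) ({x} \<inter> {0,1})"
      unfolding e by (rule cylinder_retracts_empty)
    show "clearable (subtopology ?Z {x}) ({x} \<inter> {0,1}) X Y (W x) (W x)"
      unfolding e by (rule point[OF openO]) (use xI in auto)
    show "g ` {x} \<subseteq> W x" using gO[OF xI] by simp
    show "W x \<subseteq> D z" if "z \<in> {x} - {0,1}" for z
      using that x by (simp add: D_def)
  qed auto
  moreover have "{0,1} \<union> (\<Union>x\<in>grid N - {0,1}. {x}) = grid N"
    using zero_one_in_grid[OF N(1)] by auto
  ultimately have 1: "cleared_on ?Z X Y g D (grid N)" by simp
  have "cleared_on ?Z X Y g D (grid N \<union> (\<Union>i\<in>{..<N}. ?J i))"
  proof (rule cleared_on_insert_cells[OF g _ _ 1, where P = V and Q = "\<lambda>_. U"])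
    show "closedin ?Z (grid N)"
      by (intro closed_subset grid_subset) (simp add: grid_def finite_imp_closed)
    show "?J i \<inter> ?J j \<subseteq> grid N" if "i \<in> {..<N}" "j \<in> {..<N}" "i \<noteq> j" for i j
      using grid_interval_disjoint that by blast
    fix i assume "i \<in> {..<N}"
    then have i: "i < N" by simp
    note J = grid_interval_convex[OF i]
    have e: "?J i \<inter> grid N = frontier (?J i)" using J(4) grid_interval_Int_grid[OF i] by simp
    have s: "subtopology ?Z (?J i) = top_of_set (?J i)"
      using grid_interval_subset[OF i] by (simp add: subtopology_subtopology Int_absorb1)
    show "closedin ?Z (?J i)"
      by (intro closed_subset grid_interval_subset[OF i] compact_imp_closed J(2))
    show "cylinder_retracts (subtopology ?Z (?J i)) (?J i \<inter> grid N)"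
      unfolding e s by (rule cylinder_retracts_convex[OF J(1-3)])
    show "clearable (subtopology ?Z (?J i)) (?J i \<inter> grid N) X Y (V i) U"
      unfolding e s by (rule clearable_convex[OF J(1-3), of ?I]) (use V[OF i] in auto)
    show "V i \<subseteq> U" using V[OF i] by blast
    show "g ` ?J i \<subseteq> V i" by (rule gV[OF i])
    show "D x \<subseteq> V i" if "x \<in> ?J i \<inter> grid N" for x
      using DV[OF i] that by blast
    show "U \<subseteq> D x" if "x \<in> ?J i - grid N" for x
      using that zero_one_in_grid[OF N(1)] by (auto simp: D_def)
  qed simp
  moreover have "grid N \<union> (\<Union>i\<in>{..<N}. ?J i) = ?I"
    using grid_interval_cover[OF N(1)] grid_interval_subset[of _ N] grid_subset[of N] by blast
  ultimately have "cleared_on ?Z X Y g D ?I" by simp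
  moreover have "\<forall>x \<in> frontier ?I. D x \<subseteq> {g x}" by (auto simp: D_def frontier_unit_interval)
  ultimately show "\<exists>D. cleared_on ?Z X Y g D (topspace ?Z) \<and> (\<forall>x \<in> topspace ?Z. D x \<subseteq> U) \<and>
      (\<forall>x \<in> frontier ?I. D x \<subseteq> {g x})"
    using DU by (intro exI[of _ D]) auto
qed

abbreviation unit_square :: "(real \<times> real) set" where
  "unit_square \<equiv> {0..1} \<times> {0..1}"

lemma frontier_unit_square:
  "frontier unit_square = {0..1} \<times> {0,1} \<union> {0,1} \<times> {0..1}"
  using frontier_prism[of "{0..1::real}"] by (simp add: frontier_unit_interval)

text \<open>
  Edges of a grid in the plane inherit the cell structure of the interval that they project to.
\<close>

lemma clearable_edges:
  assumes "clearable (top_of_set {0..1::real}) (frontier {0..1}) X Y P Q" and i: "i < N"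
  shows "clearable (top_of_set (grid_interval N i \<times> {b::real}))
           ({real i / real N, real (Suc i) / real N} \<times> {b}) X Y P Q"
    and "clearable (top_of_set ({b::real} \<times> grid_interval N i))
           ({b} \<times> {real i / real N, real (Suc i) / real N}) X Y P Q"
    and "cylinder_retracts (top_of_set (grid_interval N i \<times> {b::real}))
           ({real i / real N, real (Suc i) / real N} \<times> {b})"
    and "cylinder_retracts (top_of_set ({b::real} \<times> grid_interval N i))
           ({b} \<times> {real i / real N, real (Suc i) / real N})"
proof -
  let ?J = "grid_interval N i" and ?E = "{real i / real N, real (Suc i) / real N}"
  note J = grid_interval_convex[OF i]
  have sub: "?E \<subseteq> ?J" using grid_interval_facts(1)[OF i] by (auto simp: grid_interval_def)
  have c: "clearable (top_of_set ?J) ?E X Y P Q"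
    using clearable_convex[OF J(1-3) _ _ _ assms(1)] J(4) by auto
  have r: "cylinder_retracts (top_of_set ?J) ?E"
    using cylinder_retracts_convex[OF J(1-3)] J(4) by simp
  have h: "homeomorphic_maps (top_of_set (?J \<times> {b})) (top_of_set ?J) fst (\<lambda>x. (x, b))"
    and h': "homeomorphic_maps (top_of_set ({b} \<times> ?J)) (top_of_set ?J) snd (\<lambda>x. (b, x))"
    by (auto simp: homeomorphic_maps_def intro!: continuous_intros)
  show "clearable (top_of_set (?J \<times> {b})) (?E \<times> {b}) X Y P Q"
    by (rule clearable_homeomorphic[OF h _ _ c]) (use sub in auto)
  show "clearable (top_of_set ({b} \<times> ?J)) ({b} \<times> ?E) X Y P Q"
    by (rule clearable_homeomorphic[OF h' _ _ c]) (use sub in auto)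
  show "cylinder_retracts (top_of_set (?J \<times> {b})) (?E \<times> {b})"
    by (rule cylinder_retracts_homeomorphic[OF h _ _ r]) (use sub in auto)
  show "cylinder_retracts (top_of_set ({b} \<times> ?J)) ({b} \<times> ?E)"
    by (rule cylinder_retracts_homeomorphic[OF h' _ _ r]) (use sub in auto)
qed

text \<open>
  The square is cut into a grid so fine that each small square maps into a set \<open>V i j\<close> in which disks can
  be moved off \<open>Y\<close>. Vertices, horizontal edges, vertical edges and small squares in the interior are
  moved in this order, while the frontier of the square rests. A cell \<open>E\<close> of dimension 0 or 1 moves
  inside \<open>W E\<close>, the intersection of the \<open>V i j\<close> over all small squares that contain \<open>E\<close>; hence all small
  squares still map into their \<open>V i j\<close> at the last stage.
\<close>

lemma clearable_square:
  assumes point: "\<And>U (M :: (real \<times> real) topology) p. openin X U \<Longrightarrow> topspace M = {p} \<Longrightarrow> clearable M {} X Y U U"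
    and interval: "\<And>U. openin X U \<Longrightarrow> clearable (top_of_set {0..1::real}) (frontier {0..1}) X Y U U"
    and piece: "\<And>y. y \<in> topspace X \<Longrightarrow> \<exists>V. openin X V \<and> y \<in> V \<and>
       clearable (top_of_set unit_square) (frontier unit_square) X Y V V"
  shows "clearable (top_of_set unit_square) (frontier unit_square) X Y (topspace X) (topspace X)"
proof (rule clearable_from_cleared_on)
  let ?I = "{0..1::real}"
  let ?S = "?I \<times> ?I"
  let ?Z = "top_of_set ?S"
  have S: "convex ?S" "compact ?S" "interior ?S \<noteq> {}"
    using prism_convex[of ?I] by auto
  show sub: "frontier ?S \<subseteq> topspace ?Z" by (auto simp: frontier_unit_square)
  fix g :: "real \<times> real \<Rightarrow> 'a"
  assume g: "continuous_map ?Z X g" and gY: "\<And>x. x \<in> frontier ?S \<Longrightarrow> g x \<notin> Y"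
  have gX: "g x \<in> topspace X" if "x \<in> ?S" for x using g that by (auto simp: continuous_map_def)
  let ?R = "\<lambda>V. clearable ?Z (frontier ?S) X Y V V"
  have "\<exists>\<delta>>0. \<forall>T. T \<subseteq> ?S \<longrightarrow> T \<noteq> {} \<longrightarrow> diameter T < \<delta> \<longrightarrow>
      (\<exists>V. openin X V \<and> ?R V \<and> g ` T \<subseteq> V)"
    by (rule fine_pieces[OF g S(2) piece])
  then obtain \<delta> where \<delta>: "\<delta> > 0" and pieces: "\<forall>T. T \<subseteq> ?S \<longrightarrow> T \<noteq> {} \<longrightarrow> diameter T < \<delta> \<longrightarrow>
      (\<exists>V. openin X V \<and> ?R V \<and> g ` T \<subseteq> V)"
    by (elim exE conjE) (rule that)
  \<comment> \<open>The diameter of a small square is bounded by the sum of its two side lengths, that is by \<open>2 / N\<close>.\<close>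
  have "\<delta> / 2 > 0" using \<delta> by simp
  then obtain N :: nat where "N > 0" and "1 / N < \<delta> / 2"
    by (metis inverse_eq_divide reals_Archimedean zero_less_Suc)
  then have N: "N > 0" "2 / N < \<delta>" by auto
  let ?J = "grid_interval N" and ?G = "grid N"
  have "\<exists>V. openin X V \<and> ?R V \<and> g ` (?J i \<times> ?J j) \<subseteq> V" if ij: "i < N" "j < N" for i j
  proof -
    have "?J i \<times> ?J j \<subseteq> ?S" using grid_interval_subset ij by blast
    moreover have "?J i \<times> ?J j \<noteq> {}" using grid_interval_convex(3)[OF ij(1)] grid_interval_convex(3)[OF ij(2)] by auto
    moreover have "diameter (?J i \<times> ?J j) \<le> 2 / N"
    proof (rule diameter_le)
      fix p q assume pq: "p \<in> ?J i \<times> ?J j" "q \<in> ?J i \<times> ?J j"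
      have "norm (p - q) \<le> norm (fst (p - q)) + norm (snd (p - q))"
        using norm_Pair_le[of "fst (p - q)" "snd (p - q)"] by (simp only: prod.collapse)
      also have "\<dots> \<le> 1 / N + 1 / N"
        using grid_interval_dist[OF ij(1), of "fst p" "fst q"] grid_interval_dist[OF ij(2), of "snd p" "snd q"] pq
        by (intro add_mono) auto
      finally show "norm (p - q) \<le> 2 / N" by simp
    qed simp
    then have "diameter (?J i \<times> ?J j) < \<delta>" using N(2) by linarith
    ultimately show ?thesis using pieces by meson
  qed
  then obtain V where V: "\<And>i j. i < N \<Longrightarrow> j < N \<Longrightarrow> openin X (V i j) \<and> ?R (V i j)"
    and gV: "\<And>i j. i < N \<Longrightarrow> j < N \<Longrightarrow> g ` (?J i \<times> ?J j) \<subseteq> V i j"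
    by metis
  define W where "W = (\<lambda>E. topspace X \<inter> (\<Inter>k\<in>{k \<in> {..<N} \<times> {..<N}. E \<subseteq> ?J (fst k) \<times> ?J (snd k)}. V (fst k) (snd k)))"
  have openO: "openin X (W E)" for E
    unfolding W_def by (rule openin_Inter_finite_family) (use V in auto)
  have gO: "g ` E \<subseteq> W E" if "E \<subseteq> ?S" for E
  proof
    fix y assume "y \<in> g ` E"
    then obtain x where x: "x \<in> E" "y = g x" by blast
    have "y \<in> V i j" if "i < N" "j < N" "E \<subseteq> ?J i \<times> ?J j" for i j
      using gV[OF that(1,2)] x that(3) by blast
    then show "y \<in> W E" using gX[of x] x that unfolding W_def by auto
  qed
  have O_mono: "W E \<subseteq> W E'" if "\<And>i j. i < N \<Longrightarrow> j < N \<Longrightarrow> E' \<subseteq> ?J i \<times> ?J j \<Longrightarrow> E \<subseteq> ?J i \<times> ?J j" for E E'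
    unfolding W_def using that by auto
  have OV: "W E \<subseteq> V i j" if "i < N" "j < N" "E \<subseteq> ?J i \<times> ?J j" for E i j
    using that unfolding W_def by auto
  \<comment> \<open>A point may move within \<open>V i j\<close> for all small squares that contain it.\<close>
  define D where "D = (\<lambda>p. if p \<in> frontier ?S then {g p} else W {p})"
  have D_O: "D p \<subseteq> W E" if "p \<in> E" "E \<subseteq> ?S" for p E
  proof (cases "p \<in> frontier ?S")
    case True
    then show ?thesis using gO[OF that(2)] that(1) by (auto simp: D_def)
  next
    case False
    moreover have "W {p} \<subseteq> W E" by (rule O_mono) (use that(1) in blast)
    ultimately show ?thesis by (simp add: D_def)
  qed
  note G01 = zero_one_in_grid[OF N(1)]
  have Gx: "g x \<in> D x" if "x \<in> frontier ?S" for x using that by (simp add: D_def)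
  let ?A1 = "frontier ?S \<union> ?G \<times> ?G"
  let ?A2 = "?I \<times> ?G \<union> {0,1} \<times> ?I"
  let ?A3 = "?I \<times> ?G \<union> ?G \<times> ?I"
  have finG: "finite ?G" by (simp add: grid_def)
  have clG: "closed ?G" using finG by (rule finite_imp_closed)
  have closedA: "closedin ?Z ?A1" "closedin ?Z ?A2" "closedin ?Z ?A3"
    using clG grid_subset[of N] by (auto intro!: closed_subset closed_Un closed_Times simp: frontier_unit_square)
  have 0: "cleared_on ?Z X Y g D (frontier ?S)"
    by (rule cleared_on_boundary[OF g sub gY Gx])
  have "cleared_on ?Z X Y g D (frontier ?S \<union> (\<Union>p\<in>?G \<times> ?G - frontier ?S. {p}))"
  proof (rule cleared_on_insert_cells[OF g _ _ 0, where P = "\<lambda>p. W {p}" and Q = "\<lambda>p. W {p}"])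
    show "closedin ?Z (frontier ?S)" using sub by (intro closed_subset) auto
    show "finite (?G \<times> ?G - frontier ?S)" using finG by simp
    fix p assume p: "p \<in> ?G \<times> ?G - frontier ?S"
    then have pS: "p \<in> ?S" using grid_subset by blast
    have e: "{p} \<inter> frontier ?S = {}" using p by auto
    show "closedin ?Z {p}" using pS by (intro closed_subset) auto
    show "cylinder_retracts (subtopology ?Z {p}) ({p} \<inter> frontier ?S)"
      unfolding e by (rule cylinder_retracts_empty)
    show "clearable (subtopology ?Z {p}) ({p} \<inter> frontier ?S) X Y (W {p}) (W {p})"
      unfolding e by (rule point[OF openO]) (use pS in auto)
    show "g ` {p} \<subseteq> W {p}" by (rule gO) (use pS in simp)
    show "W {p} \<subseteq> D z" if "z \<in> {p} - frontier ?S" for z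
    proof -
      have "z = p" "p \<notin> frontier ?S" using that by auto
      then show ?thesis by (simp add: D_def)
    qed
  qed auto
  moreover have "frontier ?S \<union> (\<Union>p\<in>?G \<times> ?G - frontier ?S. {p}) = ?A1" by blast
  ultimately have 1: "cleared_on ?Z X Y g D ?A1" by simp
  have sub_prod: "subtopology ?Z E = top_of_set E" if "E \<subseteq> ?S" for E
    using that by (simp add: subtopology_subtopology Int_absorb1)
  let ?e = "\<lambda>(i, b). ?J i \<times> {b}"
  have "cleared_on ?Z X Y g D (?A1 \<union> (\<Union>k\<in>{..<N} \<times> (?G - {0,1}). ?e k))"
  proof (rule cleared_on_insert_cells[OF g closedA(1) _ 1, where P = "\<lambda>k. W (?e k)" and Q = "\<lambda>k. W (?e k)"])
    show "finite ({..<N} \<times> (?G - {0,1}))" using finG by simp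
    show "?e k \<inter> ?e l \<subseteq> ?A1" if "k \<in> {..<N} \<times> (?G - {0,1})" "l \<in> {..<N} \<times> (?G - {0,1})" "k \<noteq> l" for k l
    proof
      obtain i b j c where kl: "k = (i, b)" "l = (j, c)" by (cases k, cases l)
      then have lt: "i < N" "j < N" "b \<in> ?G" "i \<noteq> j \<or> b \<noteq> c" using that by auto
      fix x assume x: "x \<in> ?e k \<inter> ?e l"
      then have "i \<noteq> j" using kl lt(4) by auto
      moreover have "fst x \<in> ?J i" "fst x \<in> ?J j" using x kl by auto
      ultimately have "fst x \<in> ?G"
        using grid_interval_disjoint[OF lt(1,2)] by blast
      then show "x \<in> ?A1" using x kl lt(3) by (cases x) auto
    qed
    fix k assume k: "k \<in> {..<N} \<times> (?G - {0,1})"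
    obtain i b where kib: "k = (i, b)" by (cases k)
    then have i: "i < N" and b: "b \<in> ?G" "b \<noteq> 0" "b \<noteq> 1" using k by auto
    have bI: "b \<in> ?I" using b grid_subset by blast
    have ek: "?e k = ?J i \<times> {b}" using kib by simp
    have eS: "?J i \<times> {b} \<subseteq> ?S" using grid_interval_subset[OF i] bI by blast
    have e: "?J i \<times> {b} \<inter> ?A1 = {real i / real N, real (Suc i) / real N} \<times> {b}"
      unfolding grid_interval_Int_grid[OF i, symmetric] frontier_unit_square using b G01 by auto
    note edge = clearable_edges[OF interval[OF openO[of "?J i \<times> {b}"]] i, where b = b]
    show "closedin ?Z (?e k)"
      unfolding ek using grid_interval_convex(2)[OF i] eS by (intro closed_subset closed_Times) (auto intro: compact_imp_closed)
    show "cylinder_retracts (subtopology ?Z (?e k)) (?e k \<inter> ?A1)"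
      unfolding ek e sub_prod[OF eS] by (rule edge(3))
    show "clearable (subtopology ?Z (?e k)) (?e k \<inter> ?A1) X Y (W (?e k)) (W (?e k))"
      unfolding ek e sub_prod[OF eS] by (rule edge(1))
    show "g ` ?e k \<subseteq> W (?e k)" unfolding ek by (rule gO[OF eS])
    show "D x \<subseteq> W (?e k)" if "x \<in> ?e k \<inter> ?A1" for x
      using that D_O[OF _ eS, of x] unfolding ek by blast
    show "W (?e k) \<subseteq> D x" if "x \<in> ?e k - ?A1" for x
    proof -
      have x: "x \<in> ?J i \<times> {b}" "x \<notin> frontier ?S" "fst x \<notin> ?G" using that b unfolding ek by auto
      have "W (?J i \<times> {b}) \<subseteq> W {x}"
      proof (rule O_mono)
        fix i' j' assume "i' < N" "j' < N" "{x} \<subseteq> ?J i' \<times> ?J j'"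
        moreover from this have "i' = i" using grid_interval_disjoint[OF _ i, of i' "fst x"] x by auto
        ultimately show "?J i \<times> {b} \<subseteq> ?J i' \<times> ?J j'" using x(1) by auto
      qed
      then show ?thesis unfolding ek using x by (simp add: D_def)
    qed
  qed simp
  moreover have "?A1 \<union> (\<Union>k\<in>{..<N} \<times> (?G - {0,1}). ?e k) = ?A2"
  proof -
    have "(\<Union>i\<in>{..<N}. ?J i) = ?I" using grid_interval_cover[OF N(1)] grid_interval_subset[of _ N] by blast
    then have "(\<Union>k\<in>{..<N} \<times> (?G - {0,1}). ?e k) = ?I \<times> (?G - {0,1})" by auto
    then show ?thesis using G01 grid_subset[of N] unfolding frontier_unit_square by auto
  qed
  ultimately have 2: "cleared_on ?Z X Y g D ?A2" by simp
  let ?f = "\<lambda>(i, b). {b} \<times> ?J i"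
  have "cleared_on ?Z X Y g D (?A2 \<union> (\<Union>k\<in>{..<N} \<times> (?G - {0,1}). ?f k))"
  proof (rule cleared_on_insert_cells[OF g closedA(2) _ 2, where P = "\<lambda>k. W (?f k)" and Q = "\<lambda>k. W (?f k)"])
    show "finite ({..<N} \<times> (?G - {0,1}))" using finG by simp
    show "?f k \<inter> ?f l \<subseteq> ?A2" if "k \<in> {..<N} \<times> (?G - {0,1})" "l \<in> {..<N} \<times> (?G - {0,1})" "k \<noteq> l" for k l
    proof
      obtain i b j c where kl: "k = (i, b)" "l = (j, c)" by (cases k, cases l)
      then have lt: "i < N" "j < N" "b \<in> ?G" "i \<noteq> j \<or> b \<noteq> c" using that by auto
      fix x assume x: "x \<in> ?f k \<inter> ?f l"
      then have "i \<noteq> j" using kl lt(4) by auto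
      moreover have "snd x \<in> ?J i" "snd x \<in> ?J j" using x kl by auto
      ultimately have "snd x \<in> ?G"
        using grid_interval_disjoint[OF lt(1,2)] by blast
      then show "x \<in> ?A2" using x kl lt(3) grid_subset[of N] by (cases x) auto
    qed
    fix k assume k: "k \<in> {..<N} \<times> (?G - {0,1})"
    obtain i b where kib: "k = (i, b)" by (cases k)
    then have i: "i < N" and b: "b \<in> ?G" "b \<noteq> 0" "b \<noteq> 1" using k by auto
    have bI: "b \<in> ?I" using b grid_subset by blast
    have ek: "?f k = {b} \<times> ?J i" using kib by simp
    have eS: "{b} \<times> ?J i \<subseteq> ?S" using grid_interval_subset[OF i] bI by blast
    have e: "{b} \<times> ?J i \<inter> ?A2 = {b} \<times> {real i / real N, real (Suc i) / real N}"
      unfolding grid_interval_Int_grid[OF i, symmetric] using b bI by auto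
    note edge = clearable_edges[OF interval[OF openO[of "{b} \<times> ?J i"]] i, where b = b]
    show "closedin ?Z (?f k)"
      unfolding ek using grid_interval_convex(2)[OF i] eS by (intro closed_subset closed_Times) (auto intro: compact_imp_closed)
    show "cylinder_retracts (subtopology ?Z (?f k)) (?f k \<inter> ?A2)"
      unfolding ek e sub_prod[OF eS] by (rule edge(4))
    show "clearable (subtopology ?Z (?f k)) (?f k \<inter> ?A2) X Y (W (?f k)) (W (?f k))"
      unfolding ek e sub_prod[OF eS] by (rule edge(2))
    show "g ` ?f k \<subseteq> W (?f k)" unfolding ek by (rule gO[OF eS])
    show "D x \<subseteq> W (?f k)" if "x \<in> ?f k \<inter> ?A2" for x
      using that D_O[OF _ eS, of x] unfolding ek by blast
    show "W (?f k) \<subseteq> D x" if "x \<in> ?f k - ?A2" for x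
    proof -
      have x: "x \<in> {b} \<times> ?J i" "snd x \<notin> ?G" using that bI unfolding ek by auto
      then have "x \<notin> frontier ?S" using b G01 by (auto simp: frontier_unit_square)
      moreover have "W ({b} \<times> ?J i) \<subseteq> W {x}"
      proof (rule O_mono)
        fix i' j' assume "i' < N" "j' < N" "{x} \<subseteq> ?J i' \<times> ?J j'"
        moreover from this have "j' = i" using grid_interval_disjoint[OF _ i, of j' "snd x"] x by auto
        ultimately show "{b} \<times> ?J i \<subseteq> ?J i' \<times> ?J j'" using x(1) by auto
      qed
      ultimately show ?thesis unfolding ek by (simp add: D_def)
    qed
  qed simp
  moreover have "?A2 \<union> (\<Union>k\<in>{..<N} \<times> (?G - {0,1}). ?f k) = ?A3"
  proof -
    have "(\<Union>i\<in>{..<N}. ?J i) = ?I" using grid_interval_cover[OF N(1)] grid_interval_subset[of _ N] by blast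
    then have "(\<Union>k\<in>{..<N} \<times> (?G - {0,1}). ?f k) = (?G - {0,1}) \<times> ?I" by auto
    then show ?thesis using G01 by auto
  qed
  ultimately have 3: "cleared_on ?Z X Y g D ?A3" by simp
  let ?q = "\<lambda>(i, j). ?J i \<times> ?J j"
  have "cleared_on ?Z X Y g D (?A3 \<union> (\<Union>k\<in>{..<N} \<times> {..<N}. ?q k))"
  proof (rule cleared_on_insert_cells[OF g closedA(3) _ 3, where P = "\<lambda>(i, j). V i j" and Q = "\<lambda>(i, j). V i j"])
    show "?q k \<inter> ?q l \<subseteq> ?A3" if "k \<in> {..<N} \<times> {..<N}" "l \<in> {..<N} \<times> {..<N}" "k \<noteq> l" for k l
    proof -
      obtain i j i' j' where kl: "k = (i, j)" "l = (i', j')" by (cases k, cases l)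
      then have lt: "i < N" "j < N" "i' < N" "j' < N" using that by auto
      show ?thesis
      proof
        fix x assume x: "x \<in> ?q k \<inter> ?q l"
        have "fst x \<in> ?G \<or> snd x \<in> ?G"
        proof (rule ccontr)
          assume "\<not> ?thesis"
          then have "i = i'" "j = j'"
            using grid_interval_disjoint[OF lt(1,3), of "fst x"] grid_interval_disjoint[OF lt(2,4), of "snd x"] x kl by auto
          then show False using kl that(3) by simp
        qed
        moreover have "fst x \<in> ?I" "snd x \<in> ?I"
          using x kl grid_interval_subset[OF lt(1)] grid_interval_subset[OF lt(2)] by auto
        ultimately show "x \<in> ?A3" by (cases x) auto
      qed
    qed
    fix k assume k: "k \<in> {..<N} \<times> {..<N}"
    obtain i j where kij: "k = (i, j)" by (cases k)
    then have i: "i < N" and j: "j < N" using k by auto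
    have qk: "?q k = ?J i \<times> ?J j" using kij by simp
    have Vk: "(\<lambda>(i, j). V i j) k = V i j" using kij by simp
    note Ji = grid_interval_convex[OF i] and Jj = grid_interval_convex[OF j]
    have C: "convex (?J i \<times> ?J j)" "compact (?J i \<times> ?J j)" "interior (?J i \<times> ?J j) \<noteq> {}"
      using Ji Jj by (auto simp: convex_Times compact_Times interior_Times)
    have qS: "?J i \<times> ?J j \<subseteq> ?S" using grid_interval_subset[OF i] grid_interval_subset[OF j] by blast
    have fr: "frontier (?J i \<times> ?J j) = (?J i \<inter> ?G) \<times> ?J j \<union> ?J i \<times> (?J j \<inter> ?G)"
    proof -
      have cl: "closure (?J i) = ?J i" "closure (?J j) = ?J j" using Ji(2) Jj(2) by (simp_all add: compact_imp_closed)
      have "frontier (?J i \<times> ?J j) = ?J i \<times> ?J j - interior (?J i) \<times> interior (?J j)"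
        by (simp add: frontier_def closure_Times interior_Times cl)
      also have "\<dots> = frontier (?J i) \<times> ?J j \<union> ?J i \<times> frontier (?J j)"
        unfolding frontier_def cl by blast
      finally show ?thesis using Ji(4) Jj(4) grid_interval_Int_grid[OF i] grid_interval_Int_grid[OF j] by simp
    qed
    have e: "?J i \<times> ?J j \<inter> ?A3 = frontier (?J i \<times> ?J j)"
      unfolding fr using grid_interval_subset[OF i] grid_interval_subset[OF j] by blast
    show "closedin ?Z (?q k)"
      unfolding qk by (intro closed_subset qS compact_imp_closed C(2))
    show "cylinder_retracts (subtopology ?Z (?q k)) (?q k \<inter> ?A3)"
      unfolding qk e sub_prod[OF qS] by (rule cylinder_retracts_convex[OF C])
    show "clearable (subtopology ?Z (?q k)) (?q k \<inter> ?A3) X Y ((\<lambda>(i, j). V i j) k) ((\<lambda>(i, j). V i j) k)"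
      unfolding qk e sub_prod[OF qS] Vk by (rule clearable_convex[OF C S]) (use V[OF i j] in blast)
    show "g ` ?q k \<subseteq> (\<lambda>(i, j). V i j) k" unfolding qk Vk by (rule gV[OF i j])
    show "D x \<subseteq> (\<lambda>(i, j). V i j) k" if "x \<in> ?q k \<inter> ?A3" for x
      using that D_O[OF _ qS, of x] OV[OF i j, of "?J i \<times> ?J j"] unfolding qk Vk by blast
    show "(\<lambda>(i, j). V i j) k \<subseteq> D x" if "x \<in> ?q k - ?A3" for x
    proof -
      have x: "x \<in> ?J i \<times> ?J j" "fst x \<notin> ?G" "snd x \<notin> ?G" "x \<notin> frontier ?S"
        using that qS G01 unfolding qk frontier_unit_square by auto
      have "V i j \<subseteq> W {x}"
      proof -
        have "i' = i \<and> j' = j" if "i' < N" "j' < N" "x \<in> ?J i' \<times> ?J j'" for i' j'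
          using grid_interval_disjoint[OF _ i, of i' "fst x"] grid_interval_disjoint[OF _ j, of j' "snd x"] x that by auto
        then show ?thesis using openin_subset[of X "V i j"] V[OF i j] unfolding W_def by auto
      qed
      then show ?thesis unfolding Vk using x by (simp add: D_def)
    qed
  qed auto
  moreover have "?A3 \<union> (\<Union>k\<in>{..<N} \<times> {..<N}. ?q k) = ?S"
  proof -
    have "(\<Union>i\<in>{..<N}. ?J i) = ?I" using grid_interval_cover[OF N(1)] grid_interval_subset[of _ N] by blast
    moreover have "(\<Union>k\<in>{..<N} \<times> {..<N}. ?q k) = (\<Union>i\<in>{..<N}. ?J i) \<times> (\<Union>i\<in>{..<N}. ?J i)" by auto
    ultimately have "(\<Union>k\<in>{..<N} \<times> {..<N}. ?q k) = ?S" by simp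
    then show ?thesis using grid_subset[of N] by blast
  qed
  ultimately have "cleared_on ?Z X Y g D (topspace ?Z)" by simp
  moreover have "D x \<subseteq> topspace X" if "x \<in> ?S" for x
    using gX[OF that] unfolding D_def W_def by auto
  ultimately show "\<exists>D. cleared_on ?Z X Y g D (topspace ?Z) \<and> (\<forall>x \<in> topspace ?Z. D x \<subseteq> topspace X) \<and>
      (\<forall>x \<in> frontier ?S. D x \<subseteq> {g x})"
    by (intro exI[of _ D]) (auto simp: D_def)
qed

section \<open>Triangulated spaces\<close>

locale triangulated_space =
  fixes K :: "'a triangulation" and X :: "'a topology"
  assumes triangulates: "triangulates K X"
begin

abbreviation domain_of :: "'a set \<Rightarrow> (nat \<Rightarrow> real) set" where
  "domain_of \<sigma> \<equiv> standard_simplex (simplex_dim K \<sigma>)"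

text \<open>
  Barycentric coordinates: on \<open>\<sigma>\<close> the inverse of the characteristic map, elsewhere arbitrary.
\<close>

definition coords :: "'a set \<Rightarrow> 'a \<Rightarrow> nat \<Rightarrow> real" where
  "coords \<sigma> = (SOME g. homeomorphic_maps (top_of_set (domain_of \<sigma>)) (subtopology X \<sigma>) (char_map K \<sigma>) g)"

definition simplex_boundary :: "'a set \<Rightarrow> 'a set" where
  "simplex_boundary \<sigma> = char_map K \<sigma> ` {x \<in> domain_of \<sigma>. \<exists>i\<le>simplex_dim K \<sigma>. x i = 0}"

lemmas triangulation_axioms = triangulates[unfolded triangulates_def]

lemma Union_simplices: "\<Union>(simplices K) = topspace X"
  by (rule triangulation_axioms[THEN conjunct1])

lemma simplex_subset: "\<sigma> \<in> simplices K \<Longrightarrow> \<sigma> \<subseteq> topspace X"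
  using Union_simplices by blast

lemma faces_subset: "\<sigma> \<in> simplices K \<Longrightarrow> faces K \<sigma> \<subseteq> simplices K"
  by (rule bspec[OF triangulation_axioms[THEN conjunct2, THEN conjunct2, THEN conjunct1]])

lemma simplex_Int:
  "\<sigma> \<in> simplices K \<Longrightarrow> \<tau> \<in> simplices K \<Longrightarrow> \<sigma> \<inter> \<tau> \<noteq> {} \<Longrightarrow> \<sigma> \<inter> \<tau> \<in> faces K \<sigma> \<and> \<sigma> \<inter> \<tau> \<in> faces K \<tau>"
  using triangulation_axioms[THEN conjunct2, THEN conjunct2, THEN conjunct2, THEN conjunct1] by simp

lemma face_linear: "\<sigma> \<in> simplices K \<Longrightarrow> \<tau> \<in> faces K \<sigma> \<Longrightarrow> linear_between K \<tau> K \<sigma> id"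
  using triangulation_axioms[THEN conjunct2, THEN conjunct2, THEN conjunct2, THEN conjunct2, THEN conjunct1] by simp

lemma weak_topology:
  "U \<subseteq> topspace X \<Longrightarrow> (\<And>\<sigma>. \<sigma> \<in> simplices K \<Longrightarrow> openin (subtopology X \<sigma>) (U \<inter> \<sigma>)) \<Longrightarrow> openin X U"
  using triangulation_axioms[THEN conjunct2, THEN conjunct2, THEN conjunct2, THEN conjunct2, THEN conjunct2] by simp

lemma closedin_weak_topology:
  assumes "A \<subseteq> topspace X" "\<And>\<sigma>. \<sigma> \<in> simplices K \<Longrightarrow> closedin (subtopology X \<sigma>) (A \<inter> \<sigma>)"
  shows "closedin X A"
  unfolding closedin_def
proof (intro conjI assms(1) weak_topology)
  fix \<sigma> assume s: "\<sigma> \<in> simplices K"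
  have "topspace (subtopology X \<sigma>) - A \<inter> \<sigma> = (topspace X - A) \<inter> \<sigma>" by auto
  then show "openin (subtopology X \<sigma>) ((topspace X - A) \<inter> \<sigma>)"
    using assms(2)[OF s] unfolding closedin_def by metis
qed auto

lemma coords:
  assumes "\<sigma> \<in> simplices K"
  shows "homeomorphic_maps (top_of_set (domain_of \<sigma>)) (subtopology X \<sigma>) (char_map K \<sigma>) (coords \<sigma>)"
proof -
  have "homeomorphic_map (top_of_set (domain_of \<sigma>)) (subtopology X \<sigma>) (char_map K \<sigma>)"
    using bspec[OF triangulation_axioms[THEN conjunct2, THEN conjunct1] assms]
    by (simp add: euclidean_product_topology)
  then have "\<exists>g. homeomorphic_maps (top_of_set (domain_of \<sigma>)) (subtopology X \<sigma>) (char_map K \<sigma>) g"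
    by (simp add: homeomorphic_map_maps)
  then show ?thesis unfolding coords_def by (rule someI_ex)
qed

lemma
  assumes "\<sigma> \<in> simplices K"
  shows char_map_coords: "x \<in> \<sigma> \<Longrightarrow> char_map K \<sigma> (coords \<sigma> x) = x"
    and coords_char_map: "u \<in> domain_of \<sigma> \<Longrightarrow> coords \<sigma> (char_map K \<sigma> u) = u"
    and coords_in: "x \<in> \<sigma> \<Longrightarrow> coords \<sigma> x \<in> domain_of \<sigma>"
    and char_map_in: "u \<in> domain_of \<sigma> \<Longrightarrow> char_map K \<sigma> u \<in> \<sigma>"
    and continuous_char_map: "continuous_map (top_of_set (domain_of \<sigma>)) (subtopology X \<sigma>) (char_map K \<sigma>)"
    and continuous_coords: "continuous_map (subtopology X \<sigma>) (top_of_set (domain_of \<sigma>)) (coords \<sigma>)"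
proof -
  note h = coords[OF assms]
  have top: "topspace (subtopology X \<sigma>) = \<sigma>" using simplex_subset[OF assms] by auto
  show c: "continuous_map (top_of_set (domain_of \<sigma>)) (subtopology X \<sigma>) (char_map K \<sigma>)"
    and d: "continuous_map (subtopology X \<sigma>) (top_of_set (domain_of \<sigma>)) (coords \<sigma>)"
    using h unfolding homeomorphic_maps_def by blast+
  show "x \<in> \<sigma> \<Longrightarrow> char_map K \<sigma> (coords \<sigma> x) = x" "u \<in> domain_of \<sigma> \<Longrightarrow> coords \<sigma> (char_map K \<sigma> u) = u"
    using h top unfolding homeomorphic_maps_def by auto
  show "x \<in> \<sigma> \<Longrightarrow> coords \<sigma> x \<in> domain_of \<sigma>"
    using continuous_map_funspace[OF d] unfolding top by auto
  show "u \<in> domain_of \<sigma> \<Longrightarrow> char_map K \<sigma> u \<in> \<sigma>"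
    using continuous_map_funspace[OF c] unfolding top by auto
qed

lemma finite_faces: "finite (faces K \<sigma>)"
proof -
  have "faces K \<sigma> \<subseteq> face K \<sigma> ` Pow {..simplex_dim K \<sigma>}" unfolding faces_def by blast
  then show ?thesis by (rule finite_subset) simp
qed

lemma closedin_simplex_image:
  assumes "\<sigma> \<in> simplices K" "closed C"
  shows "closedin (subtopology X \<sigma>) (char_map K \<sigma> ` (domain_of \<sigma> \<inter> C))"
proof -
  have "homeomorphic_map (top_of_set (domain_of \<sigma>)) (subtopology X \<sigma>) (char_map K \<sigma>)"
    using coords[OF assms(1)] homeomorphic_map_maps by blast
  then have "closed_map (top_of_set (domain_of \<sigma>)) (subtopology X \<sigma>) (char_map K \<sigma>)"
    by (rule homeomorphic_imp_closed_map)
  moreover have "closedin (top_of_set (domain_of \<sigma>)) (domain_of \<sigma> \<inter> C)"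
    using assms(2) by (simp add: closedin_closed_Int)
  ultimately show ?thesis unfolding closed_map_def by blast
qed

lemma closed_coordinate_zero: "closed {x :: nat \<Rightarrow> real. x i = 0}"
  by (intro closed_Collect_eq continuous_intros) auto

lemma closedin_face:
  assumes "\<sigma> \<in> simplices K" "F \<in> faces K \<sigma>"
  shows "closedin (subtopology X \<sigma>) F"
proof -
  obtain J where "F = face K \<sigma> J" using assms(2) unfolding faces_def by blast
  then have "F = char_map K \<sigma> ` (domain_of \<sigma> \<inter> (\<Inter>i\<in>-J. {x. x i = 0}))"
    unfolding face_def by (auto intro!: image_cong)
  then show ?thesis
    using closedin_simplex_image[OF assms(1)] closed_coordinate_zero by (simp add: closed_INT)
qed

text \<open>
  The union meets any simplex in a union of faces, and a simplex has only finitely many.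
\<close>

lemma closedin_Union_simplices:
  assumes "C \<subseteq> simplices K"
  shows "closedin X (\<Union>C)"
proof (rule closedin_weak_topology)
  show "\<Union>C \<subseteq> topspace X" using assms Union_simplices by blast
  fix \<sigma> assume s: "\<sigma> \<in> simplices K"
  let ?F = "{F \<in> faces K \<sigma>. \<exists>c \<in> C. F = \<sigma> \<inter> c}"
  have "\<Union>C \<inter> \<sigma> = \<Union>?F"
    using simplex_Int[OF s] assms by blast
  moreover have "closedin (subtopology X \<sigma>) (\<Union>?F)"
    using finite_faces[of \<sigma>] closedin_face[OF s] by (intro closedin_Union) auto
  ultimately show "closedin (subtopology X \<sigma>) (\<Union>C \<inter> \<sigma>)" by simp
qed

lemma closedin_simplex: "\<sigma> \<in> simplices K \<Longrightarrow> closedin X \<sigma>"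
  using closedin_Union_simplices[of "{\<sigma>}"] by simp

lemma face_cases:
  assumes "F \<in> faces K \<sigma>" "\<sigma> \<in> simplices K"
  shows "F = \<sigma> \<or> F \<subseteq> simplex_boundary \<sigma>"
proof -
  obtain J where J: "F = face K \<sigma> J" "J \<subseteq> {..simplex_dim K \<sigma>}" using assms(1) unfolding faces_def by blast
  show ?thesis
  proof (cases "J = {..simplex_dim K \<sigma>}")
    case True
    have "{x \<in> domain_of \<sigma>. \<forall>i. i \<notin> J \<longrightarrow> x i = 0} = domain_of \<sigma>"
      unfolding True standard_simplex_def by auto
    moreover have "char_map K \<sigma> ` domain_of \<sigma> = \<sigma>"
    proof
      show "char_map K \<sigma> ` domain_of \<sigma> \<subseteq> \<sigma>" using char_map_in[OF assms(2)] by blast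
      show "\<sigma> \<subseteq> char_map K \<sigma> ` domain_of \<sigma>"
        using char_map_coords[OF assms(2)] coords_in[OF assms(2)] by (metis imageI subsetI)
    qed
    ultimately show ?thesis unfolding J(1) face_def by simp
  next
    case False
    then obtain i where "i \<le> simplex_dim K \<sigma>" "i \<notin> J" using J(2) by blast
    then show ?thesis unfolding J(1) face_def simplex_boundary_def by blast
  qed
qed

text \<open>
  The intersection with another simplex is a face; it is a proper one unless it is all of \<open>\<sigma>\<close>.
\<close>

lemma simplex_Int_boundary:
  assumes "\<sigma> \<in> simplices K" "\<tau> \<in> simplices K" "\<not> \<sigma> \<subseteq> \<tau>"
  shows "\<sigma> \<inter> \<tau> \<subseteq> simplex_boundary \<sigma>"
  using simplex_Int[OF assms(1,2)] face_cases[OF _ assms(1), of "\<sigma> \<inter> \<tau>"] assms(3) by blast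

lemma boundary_subset_simplex: "\<sigma> \<in> simplices K \<Longrightarrow> simplex_boundary \<sigma> \<subseteq> \<sigma>"
  unfolding simplex_boundary_def using char_map_in by blast

lemma boundary_in_proper_face:
  assumes s: "\<sigma> \<in> simplices K" and x: "x \<in> simplex_boundary \<sigma>"
  shows "\<exists>\<tau> \<in> simplices K. \<tau> \<subset> \<sigma> \<and> x \<in> \<tau>"
proof -
  let ?k = "simplex_dim K \<sigma>"
  obtain u i where u: "u \<in> domain_of \<sigma>" "i \<le> ?k" "u i = 0" "x = char_map K \<sigma> u"
    using x unfolding simplex_boundary_def by blast
  let ?J = "{..?k} - {i}"
  have "?J \<noteq> {}"
  proof
    assume "?J = {}"
    then have "{..?k} = {i}" using u(2) by auto
    then have "(\<Sum>j\<le>?k. u j) = 0" using u(3) by simp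
    then show False using u(1) by (simp add: standard_simplex_def)
  qed
  then have F: "face K \<sigma> ?J \<in> faces K \<sigma>" unfolding faces_def by blast
  have xF: "x \<in> face K \<sigma> ?J"
    unfolding face_def using u by (auto simp: standard_simplex_def)
  define e :: "nat \<Rightarrow> real" where "e = (\<lambda>j. if j = i then 1 else 0)"
  have e: "e \<in> domain_of \<sigma>" unfolding e_def using u(2) by simp
  have "char_map K \<sigma> e \<notin> face K \<sigma> ?J"
  proof
    assume "char_map K \<sigma> e \<in> face K \<sigma> ?J"
    then obtain w where w: "w \<in> domain_of \<sigma>" "\<forall>j. j \<notin> ?J \<longrightarrow> w j = 0" "char_map K \<sigma> e = char_map K \<sigma> w"
      unfolding face_def by auto
    then have "e = w" using coords_char_map[OF s e] coords_char_map[OF s w(1)] by metis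
    then have "e i = 0" using w(2) by simp
    then show False by (simp add: e_def)
  qed
  moreover have "face K \<sigma> ?J \<subseteq> \<sigma>" unfolding face_def using char_map_in[OF s] by blast
  ultimately have "face K \<sigma> ?J \<subset> \<sigma>" using char_map_in[OF s e] by blast
  then show ?thesis using F xF faces_subset[OF s] by blast
qed

definition barycenter :: "'a set \<Rightarrow> nat \<Rightarrow> real" where
  "barycenter \<sigma> = (\<lambda>i. if i \<le> simplex_dim K \<sigma> then 1 / real (Suc (simplex_dim K \<sigma>)) else 0)"

lemma barycenter_in: "barycenter \<sigma> \<in> domain_of \<sigma>"
  unfolding standard_simplex_def barycenter_def by (auto simp: divide_simps)

lemma positive_not_in_boundary:
  assumes "\<sigma> \<in> simplices K" "u \<in> domain_of \<sigma>" "\<And>i. i \<le> simplex_dim K \<sigma> \<Longrightarrow> u i > 0"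
  shows "char_map K \<sigma> u \<notin> simplex_boundary \<sigma>"
proof
  assume "char_map K \<sigma> u \<in> simplex_boundary \<sigma>"
  then obtain w i where "w \<in> domain_of \<sigma>" "i \<le> simplex_dim K \<sigma>" "w i = 0" "char_map K \<sigma> u = char_map K \<sigma> w"
    unfolding simplex_boundary_def by blast
  moreover from this have "u = w" using coords_char_map[OF assms(1)] assms(2) by metis
  ultimately show False using assms(3) by fastforce
qed

text \<open>
  A simplex contains the barycenters of its own faces only. So every set of barycenters meets every
  simplex in a finite set and is closed, which makes the set of all barycenters closed and discrete; in
  a compact space it is finite.
\<close>

lemma finite_simplices_if_compact:
  assumes "compact_space X" "Hausdorff_space X"
  shows "finite (simplices K)"
proof -
  define b where "b = (\<lambda>\<sigma>. char_map K \<sigma> (barycenter \<sigma>))"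
  have b_in: "b \<sigma> \<in> \<sigma>" if "\<sigma> \<in> simplices K" for \<sigma>
    unfolding b_def by (rule char_map_in[OF that barycenter_in])
  have b_not: "b \<sigma> \<notin> simplex_boundary \<sigma>" if "\<sigma> \<in> simplices K" for \<sigma>
    unfolding b_def by (rule positive_not_in_boundary[OF that barycenter_in]) (simp add: barycenter_def)
  have sub: "\<sigma> \<subseteq> \<tau>" if "\<sigma> \<in> simplices K" "\<tau> \<in> simplices K" "b \<sigma> \<in> \<tau>" for \<sigma> \<tau>
    using simplex_Int_boundary[OF that(1,2)] b_in[OF that(1)] b_not[OF that(1)] that(3) by blast
  have inj: "inj_on b (simplices K)"
  proof (rule inj_onI)
    fix \<sigma> \<tau> assume st: "\<sigma> \<in> simplices K" "\<tau> \<in> simplices K" "b \<sigma> = b \<tau>"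
    then show "\<sigma> = \<tau>" using sub[OF st(1,2)] sub[OF st(2,1)] b_in[OF st(1)] b_in[OF st(2)] by (metis subset_antisym)
  qed
  let ?B = "b ` simplices K"
  have BX: "?B \<subseteq> topspace X" using b_in simplex_subset by blast
  have closed: "closedin X A" if "A \<subseteq> ?B" for A
  proof (rule closedin_weak_topology)
    show "A \<subseteq> topspace X" using that BX by blast
    fix \<tau> assume t: "\<tau> \<in> simplices K"
    have "A \<inter> \<tau> \<subseteq> b ` faces K \<tau>"
    proof
      fix x assume "x \<in> A \<inter> \<tau>"
      then obtain \<sigma> where s: "\<sigma> \<in> simplices K" "x = b \<sigma>" "x \<in> \<tau>" using \<open>A \<subseteq> ?B\<close> by blast
      then have "\<sigma> \<inter> \<tau> = \<sigma>" using sub[OF s(1) t] by blast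
      then have "\<sigma> \<in> faces K \<tau>" using simplex_Int[OF s(1) t] b_in[OF s(1)] by auto
      then show "x \<in> b ` faces K \<tau>" using s(2) by blast
    qed
    then have "finite (A \<inter> \<tau>)" using finite_faces finite_subset by blast
    moreover have "Hausdorff_space (subtopology X \<tau>)" using assms(2) by (rule Hausdorff_space_subtopology)
    moreover have "A \<inter> \<tau> \<subseteq> topspace (subtopology X \<tau>)" using that BX by auto
    ultimately show "closedin (subtopology X \<tau>) (A \<inter> \<tau>)"
      by (intro compactin_imp_closedin finite_imp_compactin)
  qed
  \<comment> \<open>Each set of this open cover contains just one barycenter.\<close>
  let ?U = "\<lambda>p. topspace X - (?B - {p})"
  show ?thesis
  proof (cases "simplices K = {}")
    case False
    have op: "\<forall>W \<in> ?U ` ?B. openin X W"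
      using closed by (auto intro!: openin_diff)
    have cov: "topspace X \<subseteq> \<Union>(?U ` ?B)" using False by blast
    have "\<exists>\<F>. finite \<F> \<and> \<F> \<subseteq> ?U ` ?B \<and> topspace X \<subseteq> \<Union>\<F>"
      using assms(1) op cov unfolding compact_space_alt by meson
    then obtain \<F> where \<F>: "finite \<F>" "\<F> \<subseteq> ?U ` ?B" "topspace X \<subseteq> \<Union>\<F>" by blast
    obtain P where P: "finite P" "P \<subseteq> ?B" "\<F> = ?U ` P"
      using finite_subset_image[OF \<F>(1,2)] by blast
    have "?B \<subseteq> P"
    proof
      fix p assume p: "p \<in> ?B"
      then obtain q where "q \<in> P" "p \<in> ?U q" using \<F>(3) P(3) BX by blast
      then show "p \<in> P" using p by blast
    qed
    then have "finite ?B" using P(1) finite_subset by blast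
    then show ?thesis using inj finite_image_iff by blast
  qed simp
qed

end

context triangulated_space
begin

section \<open>Segments and local contractibility\<close>

definition mix :: "(nat \<Rightarrow> real) \<Rightarrow> (nat \<Rightarrow> real) \<Rightarrow> real \<Rightarrow> nat \<Rightarrow> real" where
  "mix u v t = (\<lambda>i. (1 - t) * u i + t * v i)"

definition segment_in :: "'a set \<Rightarrow> 'a \<Rightarrow> 'a \<Rightarrow> real \<Rightarrow> 'a" where
  "segment_in \<sigma> y x t = char_map K \<sigma> (mix (coords \<sigma> x) (coords \<sigma> y) t)"

text \<open>
  The simplex is chosen arbitrarily among those that contain both ends; the linear compatibility of
  the characteristic maps makes the segment independent of this choice.
\<close>

definition segment_to :: "'a \<Rightarrow> 'a \<Rightarrow> real \<Rightarrow> 'a" where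
  "segment_to y x = segment_in (SOME \<sigma>. \<sigma> \<in> simplices K \<and> x \<in> \<sigma> \<and> y \<in> \<sigma>) y x"

lemma mix_in:
  "u \<in> standard_simplex k \<Longrightarrow> v \<in> standard_simplex k \<Longrightarrow> t \<in> {0..1} \<Longrightarrow> mix u v t \<in> standard_simplex k"
  unfolding mix_def by (rule convex_standard_simplex) auto

text \<open>
  In coordinates, the inclusion of a face is an affine map, and affine maps preserve convex
  combinations.
\<close>

lemma segment_in_face:
  assumes s: "\<sigma> \<in> simplices K" and r: "\<rho> \<in> faces K \<sigma>" and xy: "x \<in> \<rho>" "y \<in> \<rho>" and t: "t \<in> {0..1}"
  shows "segment_in \<sigma> y x t = segment_in \<rho> y x t"
proof -
  have rK: "\<rho> \<in> simplices K" using faces_subset[OF s] r by blast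
  obtain a l where a: "a ` domain_of \<rho> \<subseteq> domain_of \<sigma>" "a = oriented_simplex (simplex_dim K \<rho>) l"
    "\<And>w. w \<in> domain_of \<rho> \<Longrightarrow> char_map K \<rho> w = char_map K \<sigma> (a w)"
    using face_linear[OF s r] unfolding linear_between_def simplicial_simplex id_apply by blast
  have aw: "coords \<sigma> z = a (coords \<rho> z)" if "z \<in> \<rho>" for z
  proof -
    have "coords \<rho> z \<in> domain_of \<rho>" by (rule coords_in[OF rK that])
    then have "char_map K \<sigma> (a (coords \<rho> z)) = z" "a (coords \<rho> z) \<in> domain_of \<sigma>"
      using a(1) a(3)[of "coords \<rho> z"] char_map_coords[OF rK that] by (metis, blast)
    then show ?thesis using coords_char_map[OF s] by metis
  qed
  let ?u = "coords \<rho> x" and ?v = "coords \<rho> y"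
  have uv: "?u \<in> domain_of \<rho>" "?v \<in> domain_of \<rho>" using coords_in[OF rK] xy by blast+
  have m: "mix ?u ?v t \<in> domain_of \<rho>" by (rule mix_in[OF uv t])
  have "a (mix ?u ?v t) = mix (a ?u) (a ?v) t"
    using uv m unfolding a(2) oriented_simplex_def mix_def
    by (auto simp: fun_eq_iff sum_distrib_left sum.distrib[symmetric] algebra_simps)
  then show ?thesis
    unfolding segment_in_def aw[OF xy(1)] aw[OF xy(2)] using a(3)[OF m] by metis
qed

lemma segment_to_eq:
  assumes s: "\<sigma> \<in> simplices K" and xy: "x \<in> \<sigma>" "y \<in> \<sigma>" and t: "t \<in> {0..1}"
  shows "segment_to y x t = segment_in \<sigma> y x t"
proof -
  define \<tau> where "\<tau> = (SOME \<sigma>. \<sigma> \<in> simplices K \<and> x \<in> \<sigma> \<and> y \<in> \<sigma>)"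
  have \<tau>: "\<tau> \<in> simplices K \<and> x \<in> \<tau> \<and> y \<in> \<tau>"
    unfolding \<tau>_def by (rule someI[of _ \<sigma>]) (use s xy in blast)
  then have "\<sigma> \<inter> \<tau> \<in> faces K \<sigma>" "\<sigma> \<inter> \<tau> \<in> faces K \<tau>"
    using simplex_Int[OF s, of \<tau>] xy by blast+
  then show ?thesis
    using segment_in_face[OF s, of "\<sigma> \<inter> \<tau>" x y t] segment_in_face[of \<tau> "\<sigma> \<inter> \<tau>" x y t] \<tau> xy t
    unfolding segment_to_def \<tau>_def[symmetric] by (metis IntI)
qed

lemma continuous_segment_in:
  assumes s: "\<sigma> \<in> simplices K" and y: "y \<in> \<sigma>" and T: "T \<subseteq> {0..1}"
  shows "continuous_map (prod_topology (subtopology X \<sigma>) (top_of_set T)) X (\<lambda>z. segment_in \<sigma> y (fst z) (snd z))"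
proof -
  let ?P = "prod_topology (subtopology X \<sigma>) (top_of_set T)"
  let ?m = "\<lambda>z. mix (coords \<sigma> (fst z)) (coords \<sigma> y) (snd z)"
  have c: "continuous_map ?P (powertop_real UNIV) (\<lambda>z. coords \<sigma> (fst z))"
    using continuous_map_compose[OF continuous_map_fst continuous_coords[OF s], of "top_of_set T"]
    by (auto simp: o_def continuous_map_in_subtopology euclidean_product_topology)
  have snd: "continuous_map ?P euclideanreal snd"
    using continuous_map_snd[of "subtopology X \<sigma>" "top_of_set T"] by (simp add: continuous_map_in_subtopology)
  have "continuous_map ?P euclideanreal (\<lambda>z. coords \<sigma> (fst z) i)" for i
    using c by (simp add: continuous_map_componentwise_UNIV)
  then have "continuous_map ?P (powertop_real UNIV) ?m"
    using snd unfolding continuous_map_componentwise_UNIV mix_def by (intro allI continuous_intros)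
  moreover have "?m z \<in> domain_of \<sigma>" if "z \<in> topspace ?P" for z
    using that T by (intro mix_in coords_in[OF s] y) auto
  ultimately have "continuous_map ?P (top_of_set (domain_of \<sigma>)) ?m"
    by (auto simp: continuous_map_in_subtopology euclidean_product_topology)
  moreover have "continuous_map (top_of_set (domain_of \<sigma>)) X (char_map K \<sigma>)"
    using continuous_char_map[OF s] by (simp add: continuous_map_in_subtopology)
  ultimately show ?thesis
    unfolding segment_in_def by (rule continuous_map_compose[unfolded o_def])
qed

text \<open>
  The open star: the union of the interiors of the simplices that contain \<open>y\<close>.
\<close>

definition star :: "'a \<Rightarrow> 'a set" where
  "star y = {x \<in> topspace X. \<forall>\<sigma> \<in> simplices K. x \<in> \<sigma> \<longrightarrow> y \<in> \<sigma>}"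

lemma in_star: "y \<in> topspace X \<Longrightarrow> y \<in> star y"
  by (simp add: star_def)

text \<open>
  By the weak topology this can be checked in a simplex \<open>\<sigma>\<close>. If \<open>\<sigma>\<close> does not contain \<open>y\<close>, it misses the
  star. Otherwise the star removes finitely many faces from \<open>\<sigma>\<close>, and the condition on segments is open
  by the tube lemma, since \<open>T\<close> is compact.
\<close>

lemma openin_segments_inside:
  assumes T: "closed T" "T \<subseteq> {0..1}" and U: "openin X U"
  shows "openin X {x \<in> star y. \<forall>t \<in> T. segment_to y x t \<in> U}" (is "openin X ?M")
proof (rule weak_topology)
  show "?M \<subseteq> topspace X" by (auto simp: star_def)
  fix \<sigma> assume s: "\<sigma> \<in> simplices K"
  have top: "topspace (subtopology X \<sigma>) = \<sigma>" using simplex_subset[OF s] by auto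
  show "openin (subtopology X \<sigma>) (?M \<inter> \<sigma>)"
  proof (cases "y \<in> \<sigma>")
    case False
    then have "?M \<inter> \<sigma> = {}" using s by (auto simp: star_def)
    then show ?thesis by (metis openin_empty)
  next
    case True
    let ?P = "prod_topology (subtopology X \<sigma>) (top_of_set T)"
    let ?C = "{z \<in> topspace ?P. segment_in \<sigma> y (fst z) (snd z) \<in> topspace X - U}"
    have "compact T" using compact_Int_closed[OF compact_Icc T(1), of 0 1] T(2) by (simp add: Int_absorb1)
    then have "closed_map ?P (subtopology X \<sigma>) fst"
      by (intro Abstract_Topological_Spaces.closed_map_fst) (simp add: compact_space_subtopology)
    moreover have "closedin ?P ?C"
      using continuous_segment_in[OF s True T(2)] U by (intro closedin_continuous_map_preimage) auto
    ultimately have cl1: "closedin (subtopology X \<sigma>) (fst ` ?C)"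
      unfolding closed_map_def by blast
    let ?F = "{F \<in> faces K \<sigma>. y \<notin> F}"
    have cl2: "closedin (subtopology X \<sigma>) (\<Union>?F)"
      using finite_faces[of \<sigma>] closedin_face[OF s] by (intro closedin_Union) auto
    have seg: "segment_in \<sigma> y x t \<in> topspace X" if "x \<in> \<sigma>" "t \<in> T" for x t
      using funcset_mem[OF continuous_map_funspace[OF continuous_segment_in[OF s True T(2)]], of "(x, t)"]
        that top simplex_subset[OF s] by auto
    have star: "x \<in> star y \<longleftrightarrow> x \<notin> \<Union>?F" if x: "x \<in> \<sigma>" for x
    proof
      assume "x \<in> star y"
      then show "x \<notin> \<Union>?F" using faces_subset[OF s] unfolding star_def by blast
    next
      assume nF: "x \<notin> \<Union>?F"
      have "y \<in> \<tau>" if "\<tau> \<in> simplices K" "x \<in> \<tau>" for \<tau>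
        using simplex_Int[OF s that(1)] nF x that(2) by blast
      then show "x \<in> star y" using simplex_subset[OF s] x unfolding star_def by blast
    qed
    have tube: "(\<forall>t \<in> T. segment_to y x t \<in> U) \<longleftrightarrow> x \<notin> fst ` ?C" if x: "x \<in> \<sigma>" for x
    proof -
      have eq: "segment_to y x t = segment_in \<sigma> y x t" if "t \<in> T" for t
        using segment_to_eq[OF s x True] that T(2) by blast
      have "x \<in> fst ` ?C \<longleftrightarrow> (\<exists>t \<in> T. segment_in \<sigma> y x t \<notin> U)"
      proof
        show "\<exists>t \<in> T. segment_in \<sigma> y x t \<notin> U" if "x \<in> fst ` ?C" using that by auto
        assume "\<exists>t \<in> T. segment_in \<sigma> y x t \<notin> U"
        then obtain t where t: "t \<in> T" "segment_in \<sigma> y x t \<notin> U" by blast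
        then have "(x, t) \<in> ?C" using seg[OF x t(1)] x simplex_subset[OF s] by auto
        from imageI[OF this, of fst] show "x \<in> fst ` ?C" by (simp only: fst_conv)
      qed
      then show ?thesis using eq by auto
    qed
    have "?M \<inter> \<sigma> = (topspace (subtopology X \<sigma>) - fst ` ?C) \<inter> (topspace (subtopology X \<sigma>) - \<Union>?F)"
      unfolding top using star tube by blast
    moreover have "openin (subtopology X \<sigma>) ((topspace (subtopology X \<sigma>) - fst ` ?C) \<inter> (topspace (subtopology X \<sigma>) - \<Union>?F))"
      using cl1 cl2 by (intro openin_Int openin_diff openin_topspace)
    ultimately show ?thesis by (simp only:)
  qed
qed

lemma segment_to_ends:
  assumes "x \<in> star y"
  shows "segment_to y x 0 = x" "segment_to y x 1 = y"
proof -
  obtain \<sigma> where s: "\<sigma> \<in> simplices K" "x \<in> \<sigma>" using assms Union_simplices unfolding star_def by blast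
  then have y: "y \<in> \<sigma>" using assms unfolding star_def by blast
  show "segment_to y x 0 = x" "segment_to y x 1 = y"
    using segment_to_eq[OF s y, of 0] segment_to_eq[OF s y, of 1] char_map_coords[OF s(1)] s(2) y
    by (simp_all add: segment_in_def mix_def)
qed

text \<open>
  Points of the star whose segment to \<open>y\<close> runs in \<open>U\<close> are contracted along this segment. Continuity on
  the product with the interval also follows from the openness of sets of segments: segments from all
  points near \<open>x\<close>, restricted to a compact time interval around \<open>t\<close>, stay in a given open set.
\<close>

lemma locally_contractible:
  assumes U: "openin X U" and y: "y \<in> U"
  shows "\<exists>W c. openin X W \<and> y \<in> W \<and> W \<subseteq> U \<and> continuous_map (cylinder (subtopology X W)) X c \<and>
    (\<forall>x \<in> W. c (0, x) = x \<and> c (1, x) = y) \<and> (\<forall>t \<in> {0..1}. \<forall>x \<in> W. c (t, x) \<in> U)"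
proof -
  define W where "W = {x \<in> star y. \<forall>t \<in> {0..1}. segment_to y x t \<in> U}"
  define c where "c = (\<lambda>z. segment_to y (snd z) (fst z))"
  have yX: "y \<in> topspace X" using openin_subset[OF U] y by blast
  have openW: "openin X W" unfolding W_def by (rule openin_segments_inside[OF _ _ U]) auto
  have WX: "W \<subseteq> topspace X" by (rule openin_subset[OF openW])
  have Wstar: "x \<in> star y" if "x \<in> W" for x using that unfolding W_def by blast
  have yW: "y \<in> W"
  proof -
    obtain \<sigma> where s: "\<sigma> \<in> simplices K" "y \<in> \<sigma>" using yX Union_simplices by blast
    have "segment_to y y t = y" if "t \<in> {0..1}" for t
    proof -
      have "mix (coords \<sigma> y) (coords \<sigma> y) t = coords \<sigma> y"
        unfolding mix_def by (simp add: algebra_simps)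
      then show ?thesis using segment_to_eq[OF s s(2) that] char_map_coords[OF s] unfolding segment_in_def by metis
    qed
    then show ?thesis using y in_star[OF yX] unfolding W_def by simp
  qed
  have WU: "W \<subseteq> U"
  proof
    fix x assume x: "x \<in> W"
    then have "segment_to y x 0 \<in> U" unfolding W_def by simp
    then show "x \<in> U" using segment_to_ends(1)[OF Wstar[OF x]] by metis
  qed
  have cU: "c (t, x) \<in> U" if "t \<in> {0..1}" "x \<in> W" for t x
    using that unfolding W_def c_def by simp
  have "continuous_map (cylinder (subtopology X W)) X c"
    unfolding continuous_map_def
  proof (intro conjI allI impI Pi_I)
    fix z assume "z \<in> topspace (cylinder (subtopology X W))"
    then show "c z \<in> topspace X" using cU[of "fst z" "snd z"] openin_subset[OF U] by auto
  next
    fix O' assume O': "openin X O'"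
    let ?pre = "{z \<in> topspace (cylinder (subtopology X W)). c z \<in> O'}"
    show "openin (cylinder (subtopology X W)) ?pre"
    proof (subst openin_subopen, intro ballI)
      fix z assume z: "z \<in> ?pre"
      obtain t x where tx: "z = (t, x)" by (cases z)
      have t: "t \<in> {0..1}" and x: "x \<in> W" and cO: "segment_to y x t \<in> O'" using z tx by (auto simp: c_def)
      obtain \<sigma> where s: "\<sigma> \<in> simplices K" "x \<in> \<sigma>" using x WX Union_simplices by blast
      have y\<sigma>: "y \<in> \<sigma>" using Wstar[OF x] s unfolding star_def by blast
      have "continuous_map (top_of_set {0..1}) (prod_topology (subtopology X \<sigma>) (top_of_set {0..1})) (\<lambda>t. (x, t))"
        using s simplex_subset[OF s(1)] by (auto intro!: continuous_map_pairedI)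
      from continuous_map_compose[OF this continuous_segment_in[OF s(1) y\<sigma> order_refl]]
      have "continuous_map (top_of_set {0..1}) X (\<lambda>t. segment_in \<sigma> y x t)" by (simp add: o_def)
      then have "openin (top_of_set {0..1}) {t \<in> topspace (top_of_set {0..1}). segment_in \<sigma> y x t \<in> O'}"
        using O' by (rule openin_continuous_map_preimage)
      moreover have "{t \<in> topspace (top_of_set {0..1}). segment_in \<sigma> y x t \<in> O'} = {t \<in> {0..1}. segment_to y x t \<in> O'}"
        using segment_to_eq[OF s y\<sigma>] by auto
      ultimately have "openin (top_of_set {0..1}) {t \<in> {0..1}. segment_to y x t \<in> O'}" by metis
      then obtain \<epsilon> where e: "\<epsilon> > 0" "\<And>r. r \<in> {0..1} \<Longrightarrow> dist r t < \<epsilon> \<Longrightarrow> segment_to y x r \<in> O'"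
        using t cO unfolding openin_euclidean_subtopology_iff by blast
      let ?T = "{0..1} \<inter> cball t (\<epsilon> / 2)"
      let ?N = "{x \<in> star y. \<forall>t \<in> ?T. segment_to y x t \<in> O'}"
      have "openin X ?N" by (rule openin_segments_inside[OF _ _ O']) auto
      then have N: "openin (subtopology X W) (W \<inter> ?N)"
        by (simp add: openin_subtopology_Int2)
      have "openin (cylinder (subtopology X W)) (({0..1} \<inter> ball t (\<epsilon> / 2)) \<times> (W \<inter> ?N))"
        using N by (intro openin_prod_Times_iff[THEN iffD2] disjI2 conjI) (auto intro: openin_open_Int)
      moreover have "x \<in> ?N"
      proof -
        have "segment_to y x r \<in> O'" if "r \<in> ?T" for r
          using e(2)[of r] that e(1) by (auto simp: dist_commute)
        then show ?thesis using Wstar[OF x] by blast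
      qed
      then have "z \<in> ({0..1} \<inter> ball t (\<epsilon> / 2)) \<times> (W \<inter> ?N)" using tx t x e(1) by simp
      moreover have "({0..1} \<inter> ball t (\<epsilon> / 2)) \<times> (W \<inter> ?N) \<subseteq> ?pre"
      proof
        fix w assume w: "w \<in> ({0..1} \<inter> ball t (\<epsilon> / 2)) \<times> (W \<inter> ?N)"
        then have "fst w \<in> ?T" "snd w \<in> ?N" by (auto simp: less_imp_le)
        then have "c w \<in> O'" unfolding c_def by blast
        then show "w \<in> ?pre" using w WX by auto
      qed
      ultimately show "\<exists>Q. openin (cylinder (subtopology X W)) Q \<and> z \<in> Q \<and> Q \<subseteq> ?pre" by blast
    qed
  qed
  moreover have "c (0, x) = x \<and> c (1, x) = y" if "x \<in> W" for x
    using segment_to_ends[OF Wstar[OF that]] unfolding c_def by simp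
  ultimately show ?thesis using openW yW WU cU by blast
qed

text \<open>
  By density the open star of \<open>y\<close> is not inside \<open>Y\<close>, so some simplex \<open>\<tau>\<close> containing \<open>y\<close> is not a simplex
  of \<open>Y\<close>, and \<open>Y\<close> meets it in its boundary only. The segment from \<open>y\<close> to the barycenter of \<open>\<tau>\<close> leaves the
  boundary at once, hence leaves \<open>Y\<close> at once, and an initial piece of it lies in \<open>U\<close>.
\<close>

lemma path_off_subcomplex:
  assumes Y: "subcomplex K Y" and dense: "X closure_of (topspace X - Y) = topspace X"
    and U: "openin X U" and y: "y \<in> Y \<inter> U"
  shows "\<exists>\<gamma>. continuous_map (top_of_set {0..1::real}) X \<gamma> \<and> \<gamma> 0 = y \<and> \<gamma> ` {0..1} \<subseteq> U \<and> \<gamma> 1 \<notin> Y"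
proof -
  have yX: "y \<in> topspace X" using openin_subset[OF U] y by blast
  obtain C where C: "C \<subseteq> simplices K" "Y = \<Union>C" using Y unfolding subcomplex_def by blast
  have "\<exists>\<tau> \<in> simplices K. y \<in> \<tau> \<and> \<not> \<tau> \<subseteq> Y"
  proof (rule ccontr)
    assume no: "\<not> ?thesis"
    have "openin X {x \<in> star y. \<forall>t \<in> {}. segment_to y x t \<in> U}"
      by (rule openin_segments_inside[OF _ _ U]) auto
    then have "openin X (star y)" by simp
    moreover have "y \<in> X closure_of (topspace X - Y)" using dense yX by simp
    ultimately obtain x where x: "x \<in> star y" "x \<notin> Y"
      using in_star[OF yX] unfolding in_closure_of by blast
    then obtain \<sigma> where s: "\<sigma> \<in> simplices K" "x \<in> \<sigma>" using Union_simplices unfolding star_def by blast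
    then have "y \<in> \<sigma>" using x(1) unfolding star_def by blast
    then show False using no s x(2) by blast
  qed
  then obtain \<tau> where \<tau>: "\<tau> \<in> simplices K" "y \<in> \<tau>" "\<not> \<tau> \<subseteq> Y" by blast
  have meet: "\<tau> \<inter> Y \<subseteq> simplex_boundary \<tau>"
  proof
    fix x assume "x \<in> \<tau> \<inter> Y"
    then obtain \<sigma> where s: "\<sigma> \<in> C" "x \<in> \<sigma>" "x \<in> \<tau>" using C by blast
    then have "\<not> \<tau> \<subseteq> \<sigma>" using \<tau>(3) C(2) by blast
    then show "x \<in> simplex_boundary \<tau>" using simplex_Int_boundary[OF \<tau>(1), of \<sigma>] s C(1) by blast
  qed
  define b where "b = char_map K \<tau> (barycenter \<tau>)"
  have b: "b \<in> \<tau>" unfolding b_def by (rule char_map_in[OF \<tau>(1) barycenter_in])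
  have cb: "coords \<tau> b = barycenter \<tau>" unfolding b_def by (rule coords_char_map[OF \<tau>(1) barycenter_in])
  define p where "p = segment_in \<tau> b y"
  have "continuous_map (top_of_set {0..1}) (prod_topology (subtopology X \<tau>) (top_of_set {0..1})) (\<lambda>t. (y, t))"
    using \<tau> simplex_subset[OF \<tau>(1)] by (auto intro!: continuous_map_pairedI)
  from continuous_map_compose[OF this continuous_segment_in[OF \<tau>(1) b order_refl]]
  have p: "continuous_map (top_of_set {0..1}) X p" by (simp add: o_def p_def)
  have p0: "p 0 = y" using char_map_coords[OF \<tau>(1,2)] by (simp add: p_def segment_in_def mix_def)
  have off: "p t \<notin> Y" if t: "0 < t" "t \<le> 1" for t
  proof -
    let ?m = "mix (coords \<tau> y) (coords \<tau> b) t"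
    have u: "coords \<tau> y \<in> domain_of \<tau>" by (rule coords_in[OF \<tau>(1,2)])
    have m: "?m \<in> domain_of \<tau>" using t by (intro mix_in u coords_in[OF \<tau>(1) b]) auto
    have "?m i > 0" if "i \<le> simplex_dim K \<tau>" for i
    proof -
      have "(1 - t) * coords \<tau> y i \<ge> 0" using u t by (auto simp: standard_simplex_def)
      moreover have "t * barycenter \<tau> i > 0" using t that by (simp add: barycenter_def)
      ultimately show ?thesis unfolding mix_def cb by linarith
    qed
    from positive_not_in_boundary[OF \<tau>(1) m this]
    have "p t \<notin> simplex_boundary \<tau>" unfolding p_def segment_in_def by blast
    moreover have "p t \<in> \<tau>" unfolding p_def segment_in_def by (rule char_map_in[OF \<tau>(1) m])
    ultimately show ?thesis using meet by blast
  qed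
  have "openin (top_of_set {0..1}) {t \<in> topspace (top_of_set {0..1}). p t \<in> U}"
    using p U by (rule openin_continuous_map_preimage)
  moreover have "0 \<in> {t \<in> topspace (top_of_set {0..1}). p t \<in> U}" using p0 y by simp
  ultimately obtain \<epsilon> where e: "\<epsilon> > 0" "\<And>r. r \<in> {0..1} \<Longrightarrow> dist r 0 < \<epsilon> \<Longrightarrow> p r \<in> U"
    unfolding openin_euclidean_subtopology_iff by blast
  \<comment> \<open>Only the initial piece of the segment of length \<open>d\<close> is used; it lies in \<open>U\<close>.\<close>
  define d where "d = min (\<epsilon> / 2) 1"
  have d: "0 < d" "d \<le> 1" "d < \<epsilon>" using e(1) unfolding d_def by auto
  have dt: "d * t \<in> {0..1} \<and> d * t < \<epsilon>" if "t \<in> {0..1}" for t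
  proof -
    have "0 \<le> d * t" "d * t \<le> d * 1" using d(1) that by (simp_all only: mult_nonneg_nonneg mult_left_mono atLeastAtMost_iff less_imp_le)
    then have "0 \<le> d * t" "d * t \<le> 1" "d * t < \<epsilon>" using d by linarith+
    then show ?thesis by simp
  qed
  have "continuous_map (top_of_set {0..1}) (top_of_set {0..1}) (\<lambda>t. d * t)"
    using dt by (auto intro!: continuous_intros)
  then have "continuous_map (top_of_set {0..1}) X (p \<circ> (\<lambda>t. d * t))"
    by (rule continuous_map_compose[OF _ p])
  moreover have "(p \<circ> (\<lambda>t. d * t)) ` {0..1} \<subseteq> U"
    using e(2) dt by (auto simp: dist_real_def)
  ultimately show ?thesis
    using p0 off[OF d(1,2)] by (intro exI[of _ "p \<circ> (\<lambda>t. d * t)"]) auto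
qed

end

section \<open>Simplices of dimension at most two as model cells\<close>

definition std_boundary :: "nat \<Rightarrow> (nat \<Rightarrow> real) set" where
  "std_boundary k = {x \<in> standard_simplex k. \<exists>i\<le>k. x i = 0}"

lemma std_boundary_0: "std_boundary 0 = {}"
  by (auto simp: std_boundary_def standard_simplex_0)

lemma continuous_on_coordinate: "continuous_on S (\<lambda>x :: nat \<Rightarrow> real. x i)"
  by (rule continuous_on_subset[OF continuous_on_product_coordinates]) simp

lemma standard_simplex_1_interval:
  "homeomorphic_maps (top_of_set (standard_simplex 1)) (top_of_set {0..1::real})
     (\<lambda>x. x 0) (\<lambda>s i. if i = 0 then s else if i = 1 then 1 - s else 0)"
  "(\<lambda>x. x 0) ` std_boundary 1 = frontier {0..1::real}"
proof -
  let ?q = "\<lambda>(s::real) (i::nat). if i = 0 then s else if i = 1 then 1 - s else 0"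
  have in1: "x \<in> standard_simplex 1 \<longleftrightarrow> 0 \<le> x 0 \<and> x 0 \<le> 1 \<and> x = ?q (x 0)" for x :: "nat \<Rightarrow> real"
  proof
    assume x: "x \<in> standard_simplex 1"
    then have "x 1 = 1 - x 0" "\<And>i. i > 1 \<Longrightarrow> x i = 0" by (auto simp: standard_simplex_def)
    then have c: "x i = ?q (x 0) i" for i
    proof -
      consider "i = 0" | "i = 1" | "i > 1" by linarith
      then show ?thesis using \<open>x 1 = 1 - x 0\<close> \<open>\<And>i. i > 1 \<Longrightarrow> x i = 0\<close> by cases auto
    qed
    have "x = ?q (x 0)" by (rule ext) (rule c)
    moreover have "0 \<le> x 0" "x 0 \<le> 1" using x unfolding standard_simplex_def by blast+
    ultimately show "0 \<le> x 0 \<and> x 0 \<le> 1 \<and> x = ?q (x 0)" by blast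
  next
    assume a: "0 \<le> x 0 \<and> x 0 \<le> 1 \<and> x = ?q (x 0)"
    then have eq: "\<And>i. x i = ?q (x 0) i" by metis
    have x1: "x 1 = 1 - x 0" using eq[of 1] by simp
    moreover have "x i = 0" if "i > 1" for i using eq[of i] that by simp
    moreover have "0 \<le> x i \<and> x i \<le> 1" for i
    proof -
      have "i = 0 \<or> i = 1 \<or> i > 1" by linarith
      then show ?thesis using a x1 eq[of i] by auto
    qed
    ultimately show "x \<in> standard_simplex 1" unfolding standard_simplex_def by simp
  qed
  have q: "?q s \<in> standard_simplex 1" if "s \<in> {0..1}" for s
    unfolding in1 using that by simp
  have cq: "continuous_on {0..1} ?q"
  proof (rule continuous_on_coordinatewise_then_product)
    fix i :: nat
    show "continuous_on {0..1} (\<lambda>z. ?q z i)"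
      by (cases "i = 0"; cases "i = 1"; cases "i = 2"; cases "i = 3") (auto intro!: continuous_intros)
  qed
  show "homeomorphic_maps (top_of_set (standard_simplex 1)) (top_of_set {0..1::real}) (\<lambda>x. x 0) ?q"
    unfolding homeomorphic_maps_def
  proof (intro conjI ballI)
    show "continuous_map (top_of_set (standard_simplex 1)) (top_of_set {0..1}) (\<lambda>x. x 0)"
      using in1 by (auto simp: continuous_on_coordinate)
    show "continuous_map (top_of_set {0..1}) (top_of_set (standard_simplex 1)) ?q"
      using cq q by auto
    show "?q (x 0) = x" if "x \<in> topspace (top_of_set (standard_simplex 1))" for x
      using that in1[of x] by simp
  qed simp
  show "(\<lambda>x. x 0) ` std_boundary 1 = frontier {0..1::real}"
  proof
    show "(\<lambda>x. x 0) ` std_boundary 1 \<subseteq> frontier {0..1}"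
    proof (rule image_subsetI)
      fix x assume "x \<in> std_boundary 1"
      then obtain i where i: "x \<in> standard_simplex 1" "i \<le> 1" "x i = 0" unfolding std_boundary_def by blast
      then have "i = 0 \<or> i = 1" "x 0 + x 1 = 1" by (auto simp: standard_simplex_def)
      then show "x 0 \<in> frontier {0..1}" using i(3) by (auto simp: frontier_unit_interval)
    qed
    have "?q 0 \<in> std_boundary 1" "?q 1 \<in> std_boundary 1"
      using q[of 0] q[of 1] unfolding std_boundary_def by auto
    then show "frontier {0..1} \<subseteq> (\<lambda>x. x 0) ` std_boundary 1"
      unfolding frontier_unit_interval by (auto intro: image_eqI[of _ _ "?q 0"] image_eqI[of _ _ "?q 1"])
  qed
qed

text \<open>
  The image of the standard 2-simplex under its first two barycentric coordinates, as an
  intersection of half-planes, whose interiors are known.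
\<close>

definition std_triangle :: "(real \<times> real) set" where
  "std_triangle = {z. (1, 0) \<bullet> z \<ge> 0} \<inter> {z. (0, 1) \<bullet> z \<ge> 0} \<inter> {z. (1, 1) \<bullet> z \<le> 1}"

lemma mem_triangle: "(a, b) \<in> std_triangle \<longleftrightarrow> 0 \<le> a \<and> 0 \<le> b \<and> a + b \<le> 1"
  by (auto simp: std_triangle_def inner_Pair)

lemma interior_triangle: "(a, b) \<in> interior std_triangle \<longleftrightarrow> 0 < a \<and> 0 < b \<and> a + b < 1"
  unfolding std_triangle_def by (simp add: interior_Int interior_halfspace_ge interior_halfspace_le zero_prod_def inner_Pair)

lemma std_triangle: "convex std_triangle" "compact std_triangle" "interior std_triangle \<noteq> {}"
proof -
  show "convex std_triangle"
    unfolding std_triangle_def by (intro convex_Int convex_halfspace_ge convex_halfspace_le)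
  have "closed std_triangle"
    unfolding std_triangle_def by (intro closed_Int closed_halfspace_ge closed_halfspace_le)
  moreover have "std_triangle \<subseteq> {0..1} \<times> {0..1}"
    by (auto simp: mem_triangle)
  then have "bounded std_triangle"
    by (rule bounded_subset[OF compact_imp_bounded[OF compact_Times[OF compact_Icc compact_Icc]]])
  ultimately show "compact std_triangle" by (simp add: compact_eq_bounded_closed)
  have "(1/4, 1/4) \<in> interior std_triangle" by (simp add: interior_triangle)
  then show "interior std_triangle \<noteq> {}" by blast
qed

lemma frontier_triangle: "(a, b) \<in> frontier std_triangle \<longleftrightarrow> (a, b) \<in> std_triangle \<and> (a = 0 \<or> b = 0 \<or> a + b = 1)"
proof -
  have fr: "frontier std_triangle = std_triangle - interior std_triangle"
    using std_triangle(2) by (simp add: frontier_def compact_imp_closed)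
  show ?thesis unfolding fr Diff_iff mem_triangle interior_triangle by linarith
qed

lemma standard_simplex_2_triangle:
  "homeomorphic_maps (top_of_set (standard_simplex 2)) (top_of_set std_triangle)
     (\<lambda>x. (x 0, x 1)) (\<lambda>z i. if i = 0 then fst z else if i = 1 then snd z else if i = 2 then 1 - fst z - snd z else 0)"
  "(\<lambda>x. (x 0, x 1)) ` std_boundary 2 = frontier std_triangle"
proof -
  let ?q = "\<lambda>(z::real \<times> real) (i::nat). if i = 0 then fst z else if i = 1 then snd z else if i = 2 then 1 - fst z - snd z else 0"
  have s2: "(\<Sum>i\<le>2. x i) = x 0 + x 1 + x 2" for x :: "nat \<Rightarrow> real"
    by (simp add: numeral_2_eq_2)
  have in2: "x \<in> standard_simplex 2 \<longleftrightarrow> (x 0, x 1) \<in> std_triangle \<and> x = ?q (x 0, x 1)" for x :: "nat \<Rightarrow> real"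
  proof
    assume x: "x \<in> standard_simplex 2"
    then have c: "x 2 = 1 - x 0 - x 1" "\<And>i. i > 2 \<Longrightarrow> x i = 0" "0 \<le> x 0" "0 \<le> x 1" "0 \<le> x 2"
      using s2[of x] by (auto simp: standard_simplex_def)
    have "x i = ?q (x 0, x 1) i" for i
    proof -
      have "i = 0 \<or> i = 1 \<or> i = 2 \<or> i > 2" by linarith
      then show ?thesis using c(1,2) by auto
    qed
    then have "x = ?q (x 0, x 1)" by (rule ext)
    moreover have "(x 0, x 1) \<in> std_triangle" unfolding mem_triangle using c(1,3,4,5) by linarith
    ultimately show "(x 0, x 1) \<in> std_triangle \<and> x = ?q (x 0, x 1)" by blast
  next
    assume a: "(x 0, x 1) \<in> std_triangle \<and> x = ?q (x 0, x 1)"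
    then have eq: "\<And>i. x i = ?q (x 0, x 1) i" by metis
    have "x 2 = 1 - x 0 - x 1" using eq[of 2] by simp
    moreover have "x i = 0" if "i > 2" for i using eq[of i] that by simp
    moreover have "0 \<le> x 0" "0 \<le> x 1" "x 0 + x 1 \<le> 1" using conjunct1[OF a] unfolding mem_triangle by blast+
    moreover have "0 \<le> x i \<and> x i \<le> 1" for i
    proof -
      consider "i = 0" | "i = 1" | "i = 2" | "i > 2" by linarith
      then show ?thesis using calculation by cases auto
    qed
    ultimately show "x \<in> standard_simplex 2" unfolding standard_simplex_def using s2[of x] by auto
  qed
  have q: "?q z \<in> standard_simplex 2" if "z \<in> std_triangle" for z
  proof -
    have "(?q z 0, ?q z 1) = z" by simp
    then show ?thesis unfolding in2 using that by metis
  qed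
  have cq: "continuous_on std_triangle ?q"
  proof (rule continuous_on_coordinatewise_then_product)
    fix i :: nat
    show "continuous_on std_triangle (\<lambda>z. ?q z i)"
      by (cases "i = 0"; cases "i = 1"; cases "i = 2"; cases "i = 3") (auto intro!: continuous_intros)
  qed
  show "homeomorphic_maps (top_of_set (standard_simplex 2)) (top_of_set std_triangle) (\<lambda>x. (x 0, x 1)) ?q"
    unfolding homeomorphic_maps_def
  proof (intro conjI ballI)
    show "continuous_map (top_of_set (standard_simplex 2)) (top_of_set std_triangle) (\<lambda>x. (x 0, x 1))"
      using in2 by (auto intro!: continuous_on_Pair continuous_on_coordinate)
    show "continuous_map (top_of_set std_triangle) (top_of_set (standard_simplex 2)) ?q"
      using cq q by auto
    show "?q (x 0, x 1) = x" if "x \<in> topspace (top_of_set (standard_simplex 2))" for x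
      using that in2[of x] by (metis topspace_euclidean_subtopology)
  qed simp
  show "(\<lambda>x. (x 0, x 1)) ` std_boundary 2 = frontier std_triangle"
  proof
    show "(\<lambda>x. (x 0, x 1)) ` std_boundary 2 \<subseteq> frontier std_triangle"
    proof (rule image_subsetI)
      fix x assume "x \<in> std_boundary 2"
      then obtain i where i: "x \<in> standard_simplex 2" "i \<le> 2" "x i = 0" unfolding std_boundary_def by blast
      have "i = 0 \<or> i = 1 \<or> i = 2" using i(2) by linarith
      moreover have "x 0 + x 1 + x 2 = 1" using i(1) s2[of x] by (simp add: standard_simplex_def)
      ultimately have "x 0 = 0 \<or> x 1 = 0 \<or> x 0 + x 1 = 1" using i(3) by auto
      then show "(x 0, x 1) \<in> frontier std_triangle" using i(1) in2[of x] by (simp add: frontier_triangle)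
    qed
    show "frontier std_triangle \<subseteq> (\<lambda>x. (x 0, x 1)) ` std_boundary 2"
    proof
      fix z assume z: "z \<in> frontier std_triangle"
      obtain a b where ab: "z = (a, b)" by (cases z)
      then have t: "(a, b) \<in> std_triangle" "a = 0 \<or> b = 0 \<or> a + b = 1" using z frontier_triangle by auto
      have "\<exists>i\<le>2. ?q (a, b) i = 0"
        using t(2)
      proof (elim disjE)
        show ?thesis if "a = 0" by (rule exI[of _ 0]) (use that in simp)
        show ?thesis if "b = 0" by (rule exI[of _ 1]) (use that in simp)
        show ?thesis if "a + b = 1" by (rule exI[of _ 2]) (use that in simp)
      qed
      then have "?q (a, b) \<in> std_boundary 2"
        unfolding std_boundary_def using q[OF t(1)] by blast
      then show "z \<in> (\<lambda>x. (x 0, x 1)) ` std_boundary 2" using ab by (intro image_eqI[of _ _ "?q (a, b)"]) auto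
    qed
  qed
qed

lemma std_boundary_subset: "std_boundary k \<subseteq> standard_simplex k"
  by (auto simp: std_boundary_def)

lemma cell_standard_simplex:
  assumes point: "\<And>(M :: (nat \<Rightarrow> real) topology) p. topspace M = {p} \<Longrightarrow> clearable M {} X Y P Q"
    and interval: "clearable (top_of_set {0..1::real}) (frontier {0..1}) X Y P Q"
    and square: "clearable (top_of_set unit_square) (frontier unit_square) X Y P Q"
    and k: "k \<le> 2"
  shows "cylinder_retracts (top_of_set (standard_simplex k)) (std_boundary k) \<and>
    clearable (top_of_set (standard_simplex k)) (std_boundary k) X Y P Q"
proof -
  have I: "convex {0..1::real}" "compact {0..1::real}" "interior {0..1::real} \<noteq> {}" by auto
  consider "k = 0" | "k = 1" | "k = 2" using k by linarith
  then show ?thesis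
  proof cases
    case 1
    have "clearable (top_of_set (standard_simplex 0)) {} X Y P Q"
      by (rule point) (simp add: standard_simplex_0)
    then show ?thesis
      using 1 cylinder_retracts_empty by (simp add: std_boundary_0)
  next
    case 2
    have sub: "std_boundary 1 \<subseteq> topspace (top_of_set (standard_simplex 1))"
      using std_boundary_subset by simp
    show ?thesis unfolding 2
      by (intro conjI clearable_homeomorphic[OF standard_simplex_1_interval(1) sub standard_simplex_1_interval(2) interval]
          cylinder_retracts_homeomorphic[OF standard_simplex_1_interval(1) sub standard_simplex_1_interval(2)
            cylinder_retracts_convex[OF I]])
  next
    case 3
    have sub: "std_boundary 2 \<subseteq> topspace (top_of_set (standard_simplex 2))"
      using std_boundary_subset by simp
    show ?thesis unfolding 3
      by (intro conjI clearable_homeomorphic[OF standard_simplex_2_triangle(1) sub standard_simplex_2_triangle(2)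
            clearable_convex[OF std_triangle prism_convex[OF I] square]]
          cylinder_retracts_homeomorphic[OF standard_simplex_2_triangle(1) sub standard_simplex_2_triangle(2)
            cylinder_retracts_convex[OF std_triangle]])
  qed
qed

context triangulated_space
begin

lemma cell_simplex:
  assumes s: "\<sigma> \<in> simplices K"
    and std: "cylinder_retracts (top_of_set (domain_of \<sigma>)) (std_boundary (simplex_dim K \<sigma>)) \<and>
      clearable (top_of_set (domain_of \<sigma>)) (std_boundary (simplex_dim K \<sigma>)) Z Y P Q"
  shows "cylinder_retracts (subtopology X \<sigma>) (simplex_boundary \<sigma>)"
    and "clearable (subtopology X \<sigma>) (simplex_boundary \<sigma>) Z Y P Q"
proof -
  have h: "homeomorphic_maps (subtopology X \<sigma>) (top_of_set (domain_of \<sigma>)) (coords \<sigma>) (char_map K \<sigma>)"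
    by (rule iffD1[OF homeomorphic_maps_sym coords[OF s]])
  have sub: "simplex_boundary \<sigma> \<subseteq> topspace (subtopology X \<sigma>)"
    using boundary_subset_simplex[OF s] simplex_subset[OF s] by auto
  have im: "coords \<sigma> ` simplex_boundary \<sigma> = std_boundary (simplex_dim K \<sigma>)"
  proof -
    have "coords \<sigma> ` simplex_boundary \<sigma> = (\<lambda>u. coords \<sigma> (char_map K \<sigma> u)) ` std_boundary (simplex_dim K \<sigma>)"
      unfolding simplex_boundary_def std_boundary_def by (simp add: image_image)
    also have "\<dots> = (\<lambda>u. u) ` std_boundary (simplex_dim K \<sigma>)"
      by (rule image_cong[OF refl]) (auto simp: std_boundary_def coords_char_map[OF s])
    finally show ?thesis by simp
  qed
  show "cylinder_retracts (subtopology X \<sigma>) (simplex_boundary \<sigma>)"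
    by (rule cylinder_retracts_homeomorphic[OF h sub im conjunct1[OF std]])
  show "clearable (subtopology X \<sigma>) (simplex_boundary \<sigma>) Z Y P Q"
    by (rule clearable_homeomorphic[OF h sub im conjunct2[OF std]])
qed

section \<open>Triangulated manifolds of dimension at most two\<close>

text \<open>
  A simplex of larger dimension would contain a copy of an open subset of 3-space; near one of its
  points the manifold has coordinates in the plane, and these would embed an open subset of 3-space into
  the plane, against invariance of dimension.
\<close>

lemma simplex_dim_le_2:
  assumes M: "manifold_with_boundary n X" and n: "n \<le> 2" and s: "\<sigma> \<in> simplices K"
  shows "simplex_dim K \<sigma> \<le> 2"
proof (rule ccontr)
  assume "\<not> simplex_dim K \<sigma> \<le> 2"
  then have "standard_simplex 3 \<subseteq> domain_of \<sigma>" by (intro standard_simplex_mono) simp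
  \<comment> \<open>Three free barycentric coordinates; the fourth is determined by the sum, the others vanish.\<close>
  define e :: "real \<times> real \<times> real \<Rightarrow> nat \<Rightarrow> real" where
    "e = (\<lambda>z i. if i = 0 then fst z else if i = 1 then fst (snd z) else if i = 2 then snd (snd z)
                else if i = 3 then 1 - fst z - fst (snd z) - snd (snd z) else 0)"
  define B :: "(real \<times> real \<times> real) set" where
    "B = {z. 0 < fst z \<and> 0 < fst (snd z) \<and> 0 < snd (snd z) \<and> fst z + fst (snd z) + snd (snd z) < 1}"
  have openB: "open B"
    unfolding B_def by (intro open_Collect_conj open_Collect_less continuous_intros)
  have eB: "e z \<in> domain_of \<sigma>" if "z \<in> B" for z
  proof -
    have "(\<Sum>i\<le>3. e z i) = 1" by (simp add: e_def numeral_3_eq_3 numeral_2_eq_2)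
    then have "e z \<in> standard_simplex 3"
      using that unfolding standard_simplex_def B_def by (auto simp: e_def)
    then show ?thesis using \<open>standard_simplex 3 \<subseteq> domain_of \<sigma>\<close> by blast
  qed
  have e_inj: "z = w" if "e z = e w" for z w
    using fun_cong[OF that, of 0] fun_cong[OF that, of 1] fun_cong[OF that, of 2] by (simp add: e_def prod_eq_iff)
  have "continuous_on B e"
  proof (rule continuous_on_coordinatewise_then_product)
    fix i :: nat
    show "continuous_on B (\<lambda>z. e z i)"
      by (cases "i = 0"; cases "i = 1"; cases "i = 2"; cases "i = 3") (auto simp: e_def intro!: continuous_intros)
  qed
  then have "continuous_map (top_of_set B) (top_of_set (domain_of \<sigma>)) e" using eB by auto
  from continuous_map_compose[OF this continuous_char_map[OF s]]
  have j: "continuous_map (top_of_set B) X (char_map K \<sigma> \<circ> e)" by (simp add: continuous_map_in_subtopology)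
  let ?j = "char_map K \<sigma> \<circ> e"
  have jX: "?j z \<in> topspace X" if "z \<in> B" for z
    using simplex_subset[OF s] char_map_in[OF s eB[OF that]] by auto
  have j_inj: "z = w" if "z \<in> B" "w \<in> B" "?j z = ?j w" for z w
    using coords_char_map[OF s eB[OF that(1)]] coords_char_map[OF s eB[OF that(2)]] that(3) e_inj
    unfolding comp_apply by metis
  define z0 :: "real \<times> real \<times> real" where "z0 = (1/8, 1/8, 1/8)"
  have z0: "z0 \<in> B" unfolding z0_def B_def by simp
  have "locally_modelled_at (half_space n) X (?j z0)"
    using M jX[OF z0] unfolding manifold_with_boundary_def by blast
  then obtain U W where U: "openin X U" "?j z0 \<in> U"
    and hom: "subtopology X U homeomorphic_space subtopology (half_space n) W"
    unfolding locally_modelled_at_def by blast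
  obtain p q where pq: "homeomorphic_maps (subtopology X U) (subtopology (half_space n) W) p q"
    using hom unfolding homeomorphic_space_def by blast
  have p: "continuous_map (subtopology X U) (subtopology (half_space n) W) p"
    and qp: "\<And>x. x \<in> topspace (subtopology X U) \<Longrightarrow> q (p x) = x"
    using pq unfolding homeomorphic_maps_def by blast+
  have pE: "continuous_map (subtopology X U) (powertop_real UNIV) p"
    and pn: "\<And>x i. x \<in> topspace (subtopology X U) \<Longrightarrow> i \<ge> n \<Longrightarrow> p x i = 0"
    using p unfolding half_space_def Euclidean_space_def continuous_map_in_subtopology by blast+
  define B' where "B' = {z \<in> B. ?j z \<in> U}"
  have "openin (top_of_set B) {z \<in> topspace (top_of_set B). ?j z \<in> U}"
    using j U(1) by (rule openin_continuous_map_preimage)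
  then have "open B'"
    using openB openin_open_eq[OF openB] unfolding B'_def by simp
  have jU: "?j z \<in> topspace (subtopology X U)" if "z \<in> B'" for z
    using that jX unfolding B'_def by auto
  have "continuous_map (top_of_set B') (subtopology X U) ?j"
    using continuous_map_from_subtopology_mono[OF j, of B'] jU by (auto simp: continuous_map_in_subtopology B'_def)
  from continuous_map_compose[OF this pE]
  have m: "continuous_map (top_of_set B') (powertop_real UNIV) (p \<circ> ?j)" .
  \<comment> \<open>The chart \<open>p\<close> takes values whose coordinates beyond the first two vanish, since \<open>n \<le> 2\<close>.\<close>
  define m' where "m' = (\<lambda>z. (p (?j z) 0, p (?j z) 1))"
  have "continuous_on B' (\<lambda>z. p (?j z) i)" for i
    using m unfolding continuous_map_componentwise_UNIV by (simp add: o_def)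
  then have cm: "continuous_on B' m'" unfolding m'_def by (intro continuous_on_Pair)
  have "inj_on m' B'"
  proof (rule inj_onI)
    fix z w assume zw: "z \<in> B'" "w \<in> B'" "m' z = m' w"
    have "p (?j z) i = p (?j w) i" for i
    proof -
      have "i = 0 \<or> i = 1 \<or> i \<ge> n" using n by linarith
      then show ?thesis using zw(3) pn[OF jU[OF zw(1)]] pn[OF jU[OF zw(2)]] unfolding m'_def by auto
    qed
    then have "p (?j z) = p (?j w)" by blast
    then have "?j z = ?j w" using qp[OF jU[OF zw(1)]] qp[OF jU[OF zw(2)]] by metis
    then show "z = w" using j_inj zw(1,2) unfolding B'_def by blast
  qed
  moreover have "z0 \<in> B'" using z0 U(2) unfolding B'_def by blast
  then have "B' \<noteq> {}" by blast
  ultimately have "DIM(real \<times> real \<times> real) \<le> DIM(real \<times> real)"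
    using invariance_of_dimension[OF cm \<open>open B'\<close>] by blast
  then show False by simp
qed

text \<open>
  The simplices outside \<open>A\<close> are added in an order in which every simplex comes after its proper faces. An
  inclusion-maximal simplex \<open>\<sigma>\<close> of the family can be added last: what is present before meets it exactly
  in its boundary.
\<close>

lemma cleared_on_simplices:
  assumes f: "continuous_map X Z f" and Y: "f ` A \<inter> Y = {}" and A: "subcomplex K A"
    and cell: "\<And>\<sigma>. \<sigma> \<in> simplices K \<Longrightarrow> cylinder_retracts (subtopology X \<sigma>) (simplex_boundary \<sigma>) \<and>
      clearable (subtopology X \<sigma>) (simplex_boundary \<sigma>) Z Y (topspace Z) (topspace Z)"
    and fin: "finite F" and F: "F \<subseteq> simplices K" "\<And>\<sigma>. \<sigma> \<in> F \<Longrightarrow> \<not> \<sigma> \<subseteq> A"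
    and down: "\<And>\<sigma> \<tau>. \<sigma> \<in> F \<Longrightarrow> \<tau> \<in> simplices K \<Longrightarrow> \<tau> \<subset> \<sigma> \<Longrightarrow> \<tau> \<in> F \<or> \<tau> \<subseteq> A"
  shows "cleared_on X Z Y f (\<lambda>x. if x \<in> A then {f x} else topspace Z) (A \<union> \<Union>F)"
  using fin F down
proof (induction F rule: finite_psubset_induct)
  case (psubset F)
  let ?D = "\<lambda>x. if x \<in> A then {f x} else topspace Z"
  obtain C where C: "C \<subseteq> simplices K" "A = \<Union>C" using A unfolding subcomplex_def by blast
  have AX: "A \<subseteq> topspace X" using C Union_simplices by blast
  have clA: "closedin X A" unfolding C(2) by (rule closedin_Union_simplices[OF C(1)])
  show ?case
  proof (cases "F = {}")
    case True
    have "cleared_on X Z Y f ?D A"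
      by (rule cleared_on_boundary[OF f AX]) (use Y in auto)
    then show ?thesis using True by simp
  next
    case False
    \<comment> \<open>A maximal simplex is a proper face of no other simplex in \<open>F\<close>, so the rest is again closed under faces.\<close>
    obtain \<sigma> where \<sigma>: "\<sigma> \<in> F" "\<And>\<tau>. \<tau> \<in> F \<Longrightarrow> \<sigma> \<subseteq> \<tau> \<Longrightarrow> \<sigma> = \<tau>"
      using finite_has_maximal[OF psubset.hyps(1) False] by blast
    have s: "\<sigma> \<in> simplices K" using \<sigma>(1) psubset.prems(1) by blast
    let ?F = "F - {\<sigma>}"
    let ?A = "A \<union> \<Union>?F"
    have IH: "cleared_on X Z Y f ?D ?A"
    proof (rule psubset.IH)
      show "?F \<subset> F" using \<sigma>(1) by blast
      show "?F \<subseteq> simplices K" using psubset.prems(1) by blast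
      show "\<not> \<tau> \<subseteq> A" if "\<tau> \<in> ?F" for \<tau> using psubset.prems(2) that by blast
      show "\<tau> \<in> ?F \<or> \<tau> \<subseteq> A" if "\<rho> \<in> ?F" "\<tau> \<in> simplices K" "\<tau> \<subset> \<rho>" for \<rho> \<tau>
        using psubset.prems(3)[OF _ that(2,3)] that(1,3) \<sigma>(2)[of \<rho>] by blast
    qed
    have bd: "\<sigma> \<inter> ?A = simplex_boundary \<sigma>"
    proof
      show "\<sigma> \<inter> ?A \<subseteq> simplex_boundary \<sigma>"
      proof
        fix x assume x: "x \<in> \<sigma> \<inter> ?A"
        have "\<exists>\<tau> \<in> simplices K. x \<in> \<tau> \<and> \<not> \<sigma> \<subseteq> \<tau>"
        proof (cases "x \<in> A")
          case True
          then obtain c where "c \<in> C" "x \<in> c" using C(2) by blast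
          moreover have "\<not> \<sigma> \<subseteq> A" by (rule psubset.prems(2)[OF \<sigma>(1)])
          ultimately show ?thesis using C by blast
        next
          case False
          then obtain \<tau> where "\<tau> \<in> ?F" "x \<in> \<tau>" using x by blast
          then show ?thesis using \<sigma>(2)[of \<tau>] psubset.prems(1) by blast
        qed
        then show "x \<in> simplex_boundary \<sigma>" using simplex_Int_boundary[OF s] x by blast
      qed
      show "simplex_boundary \<sigma> \<subseteq> \<sigma> \<inter> ?A"
      proof
        fix x assume x: "x \<in> simplex_boundary \<sigma>"
        then obtain \<tau> where \<tau>: "\<tau> \<in> simplices K" "\<tau> \<subset> \<sigma>" "x \<in> \<tau>" using boundary_in_proper_face[OF s] by blast
        then have "\<tau> \<in> F \<or> \<tau> \<subseteq> A" using psubset.prems(3)[OF \<sigma>(1)] by blast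
        then show "x \<in> \<sigma> \<inter> ?A" using \<tau> by blast
      qed
    qed
    have "cleared_on X Z Y f ?D (?A \<union> \<sigma>)"
    proof (rule cleared_on_insert_cell[OF f _ closedin_simplex[OF s] IH, where P = "topspace Z" and Q = "topspace Z"])
      show "closedin X ?A"
        using psubset.prems(1) by (intro closedin_Un clA closedin_Union_simplices) blast
      show "cylinder_retracts (subtopology X \<sigma>) (\<sigma> \<inter> ?A)" unfolding bd using cell[OF s] by blast
      show "clearable (subtopology X \<sigma>) (\<sigma> \<inter> ?A) Z Y (topspace Z) (topspace Z)" unfolding bd using cell[OF s] by blast
      show "f ` \<sigma> \<subseteq> topspace Z"
        using continuous_map_funspace[OF f] simplex_subset[OF s] by blast
      show "?D x \<subseteq> topspace Z" if "x \<in> \<sigma> \<inter> ?A" for x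
        using continuous_map_funspace[OF f] AX by auto
      show "topspace Z \<subseteq> ?D x" if "x \<in> \<sigma> - ?A" for x
        using that by auto
    qed simp
    moreover have "?A \<union> \<sigma> = A \<union> \<Union>F" using \<sigma>(1) by blast
    ultimately show ?thesis by simp
  qed
qed

end

section \<open>Moving a surface off a subcomplex\<close>

theorem proposition5p8:
  fixes X :: "'a topology" and K :: "'a triangulation" and Y :: "'a set"
    and S :: "'b topology" and L :: "'b triangulation" and S' :: "'b set"
    and n :: nat and f :: "'b \<Rightarrow> 'a"
  assumes "triangulates K X" and "subcomplex K Y"
    and "X closure_of (topspace X - Y) = topspace X"
    and "\<And>y U. y \<in> Y \<Longrightarrow> openin X U \<Longrightarrow> y \<in> U \<Longrightarrow>
           \<exists>V. openin X V \<and> V \<subseteq> U \<and> y \<in> V \<and> path_connectedin X (V - Y)"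
    and "\<And>y. y \<in> Y \<Longrightarrow>
           \<exists>V. openin X V \<and> y \<in> V \<and> path_connectedin X V \<and>
               (\<forall>v \<in> V. carrier (pi2 (subtopology X V) v) = {\<one>\<^bsub>pi2 (subtopology X V) v\<^esub>}) \<and>
               (\<forall>v \<in> V - Y. inj_on (pi1_map v (subtopology X V) id)
                              (carrier (pi1 (subtopology X (V - Y)) v)))"
    and "manifold_with_boundary n S" and "compact_space S" and "n \<le> 2"
    and "closedin S S'" and "manifold_boundary n S \<subseteq> S'"
    and "triangulates L S" and "subcomplex L S'"
    and "continuous_map S X f" and "f ` S' \<subseteq> topspace X - Y"
    and "simplicial_map (induced_triangulation L S') K f"
  shows "\<exists>h. continuous_map S X h \<and>
             homotopic_with (\<lambda>k. \<forall>s \<in> S'. k s = f s) S X f h \<and>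
             h ` topspace S \<inter> Y = {}"
proof -
  interpret X: triangulated_space K X by unfold_locales (rule assms(1))
  interpret S: triangulated_space L S by unfold_locales (rule assms(11))
  obtain C where C: "C \<subseteq> simplices K" "Y = \<Union>C" using assms(2) unfolding subcomplex_def by blast
  have clY: "closedin X Y" unfolding C(2) by (rule X.closedin_Union_simplices[OF C(1)])
  have point: "clearable M {} X Y U U" if "openin X U" "topspace M = {p}" for U and M :: "'m topology" and p
    by (rule clearable_point[OF X.path_off_subcomplex[OF assms(2,3) that(1)] that(2)])
  have openX: "openin X (topspace X)" by simp
  have small: "\<exists>V. openin X V \<and> y \<in> V \<and> V \<subseteq> U \<and> clearable (top_of_set {0..1::real}) (frontier {0..1}) X Y V U"
    if U: "openin X U" and y: "y \<in> U" for U y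
  proof (cases "y \<in> Y")
    case True
    obtain W c where W: "openin X W" "y \<in> W" "W \<subseteq> U" and c: "continuous_map (cylinder (subtopology X W)) X c"
      "\<And>x. x \<in> W \<Longrightarrow> c (0, x) = x" "\<And>x. x \<in> W \<Longrightarrow> c (1, x) = y"
      "\<And>t x. t \<in> {0..1} \<Longrightarrow> x \<in> W \<Longrightarrow> c (t, x) \<in> U"
      using X.locally_contractible[OF U y] by (elim exE conjE) blast
    obtain V where V: "openin X V" "V \<subseteq> W" "y \<in> V" "path_connectedin X (V - Y)"
      using assms(4)[OF True W(1,2)] by blast
    have "clearable (top_of_set {0..1::real}) (frontier {0..1}) X Y V U"
      by (rule clearable_interval_if_contractible[OF c V(2,4)])
    then show ?thesis using V W(3) by blast
  next
    case False
    have "openin X (U - Y)" using U clY by (rule openin_diff)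
    moreover have "clearable (top_of_set {0..1::real}) (frontier {0..1}) X Y (U - Y) U"
      by (rule clearable_trivial) blast+
    ultimately show ?thesis using False y by blast
  qed
  have interval: "clearable (top_of_set {0..1::real}) (frontier {0..1}) X Y U U" if "openin X U" for U
    by (rule clearable_interval[OF point small that])
  have Q: "convex unit_square" "compact unit_square"
      "interior unit_square \<noteq> {}"
    by (rule prism_convex; simp)+
  have piece: "\<exists>V. openin X V \<and> y \<in> V \<and>
      clearable (top_of_set unit_square) (frontier unit_square) X Y V V"
    if y: "y \<in> topspace X" for y
  proof (cases "y \<in> Y")
    case True
    from assms(5)[OF True] obtain V where V: "openin X V" "y \<in> V"
      and pi: "\<forall>v \<in> V. carrier (pi2 (subtopology X V) v) = {\<one>\<^bsub>pi2 (subtopology X V) v\<^esub>}"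
        "\<forall>v \<in> V - Y. inj_on (pi1_map v (subtopology X V) id) (carrier (pi1 (subtopology X (V - Y)) v))"
      by (elim exE conjE)
    show ?thesis
      by (intro exI[of _ V] conjI V clearable_disk[OF Q bspec[OF pi(1)] bspec[OF pi(2)] openin_subset[OF V(1)]])
  next
    case False
    have "openin X (topspace X - Y)" using clY by blast
    moreover have "clearable (top_of_set unit_square) (frontier unit_square) X Y
        (topspace X - Y) (topspace X - Y)"
      by (rule clearable_trivial) blast+
    ultimately show ?thesis using False y by blast
  qed
  have square: "clearable (top_of_set unit_square) (frontier unit_square) X Y
      (topspace X) (topspace X)"
    by (rule clearable_square[OF point interval piece])
  have cell: "cylinder_retracts (subtopology S \<sigma>) (S.simplex_boundary \<sigma>) \<and>
      clearable (subtopology S \<sigma>) (S.simplex_boundary \<sigma>) X Y (topspace X) (topspace X)"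
    if s: "\<sigma> \<in> simplices L" for \<sigma>
  proof -
    have dim: "simplex_dim L \<sigma> \<le> 2" by (rule S.simplex_dim_le_2[OF assms(6,8) s])
    have "cylinder_retracts (top_of_set (S.domain_of \<sigma>)) (std_boundary (simplex_dim L \<sigma>)) \<and>
        clearable (top_of_set (S.domain_of \<sigma>)) (std_boundary (simplex_dim L \<sigma>)) X Y (topspace X) (topspace X)"
      by (rule cell_standard_simplex[OF point[OF openX] interval[OF openX] square dim])
    from S.cell_simplex[OF s this] show ?thesis by (rule conjI)
  qed
  have S': "S' \<subseteq> topspace S" using assms(9) by (rule closedin_subset)
  let ?F = "{\<sigma> \<in> simplices L. \<not> \<sigma> \<subseteq> S'}"
  have "Hausdorff_space S" using assms(6) unfolding manifold_with_boundary_def by blast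
  then have fin: "finite ?F" using S.finite_simplices_if_compact[OF assms(7)] by simp
  have "cleared_on S X Y f (\<lambda>x. if x \<in> S' then {f x} else topspace X) (S' \<union> \<Union>?F)"
    by (rule S.cleared_on_simplices[OF assms(13) _ assms(12) cell fin]) (use assms(14) in blast)+
  moreover have "S' \<union> \<Union>?F = topspace S"
    using S' S.Union_simplices by blast
  ultimately have "cleared_on S X Y f (\<lambda>x. if x \<in> S' then {f x} else topspace X) (topspace S)" by simp
  then obtain H where H: "continuous_map (cylinder S) X H"
    and H01: "\<And>x. x \<in> topspace S \<Longrightarrow> H (0, x) = f x \<and> H (1, x) \<notin> Y"
    and HD: "\<And>t x. t \<in> {0..1} \<Longrightarrow> x \<in> topspace S \<Longrightarrow> H (t, x) \<in> (if x \<in> S' then {f x} else topspace X)"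
    unfolding cleared_on_def subtopology_topspace by blast
  have HS': "H (t, s) = f s" if "t \<in> {0..1}" "s \<in> S'" for t s
    using HD[OF that(1), of s] that(2) S' by auto
  let ?h = "\<lambda>x. H (1, x)"
  have hom: "homotopic_with (\<lambda>k. \<forall>s \<in> S'. k s = f s) S X f ?h"
  proof (subst homotopic_with)
    show "(\<forall>s \<in> S'. h s = f s) = (\<forall>s \<in> S'. k s = f s)" if "\<And>x. x \<in> topspace S \<Longrightarrow> h x = k x" for h k
      using that S' by (metis subsetD)
    show "\<exists>h. continuous_map (cylinder S) X h \<and> (\<forall>x \<in> topspace S. h (0, x) = f x) \<and>
        (\<forall>x \<in> topspace S. h (1, x) = ?h x) \<and> (\<forall>t \<in> {0..1}. \<forall>s \<in> S'. h (t, s) = f s)"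
      using H H01 HS' by blast
  qed
  moreover have "continuous_map S X ?h"
    using homotopic_with_imp_continuous_maps[OF hom] by blast
  moreover have "?h ` topspace S \<inter> Y = {}" using H01 by blast
  ultimately show ?thesis by blast
qed

end
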